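(* Let $(X_n)_{n\ge0}$ be the linear autoregressive model on $\mathbb R$ defined in the context, with parameters $\alpha\in(-1,1)$, $r_0>0$, and assume that the distribution of $X_0$ is either the stationary probability measure $\pi$ of the chain or $\delta_x$ for some $x\in\mathbb R$. Assume that $\kappa$ is bounded, that $\xi$ is coercive (i.e. $\lim_{|x|\to+\infty}\xi(x)=+\infty$), that the Lebesgue measure of the set $\{\xi=0\}$ is zero, and that $\sup_{x\in\mathbb R}\frac{\xi(x)}{(1+|x|)^{r_0}}<\infty$. Then $\nu$ is well defined (finite), and it is independent of the choice of the distribution of $X_0$ in $\{\pi\}\cup\{\delta_x:\ x\in\mathbb R\}$. If moreover there exists $\tau>0$ such that $\sup_{x\in\mathbb R}\frac{\xi(x)^{1+\tau}}{(1+|x|)^{r_0}}<\infty$, then the limit $$C_\nu:=\lim_{\gamma\to0^+}\frac{\gamma}{\gamma+\nu}G(\nu+\gamma)$$ is well defined in $(0,+\infty)$, and $$\lim_{t\to\infty}\frac1t\int_0^te^{-\nu s}\,\mathbb E(N_s)\,ds=C_\nu.$$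
   Context: Linear autoregressive model. $\mathbb X:=\mathbb R$ and $X_n=\alpha X_{n-1}+\vartheta_n$ for $n\ge1$, where $X_0$ is a real random variable, $\alpha\in(-1,1)$, and $(\vartheta_n)_{n\ge1}$ are i.i.d. real random variables independent of $X_0$. Let $r_0>0$. It is assumed that $\vartheta_1$ has a continuous Lebesgue probability density $p>0$ on $\mathbb R$ such that: for every $x_0\in\mathbb R$ there exist a neighbourhood $V_{x_0}$ of $x_0$ and a nonnegative function $q_{x_0}$ such that $y\mapsto(1+|y|)^{r_0}q_{x_0}(y)$ is Lebesgue-integrable and $p(y+v)\le q_{x_0}(y)$ for all $y\in\mathbb R$ and $v\in V_{x_0}$. $\xi:\mathbb R\to[0,+\infty)$ and $\kappa:\mathbb R\to\{2,3,\dots\}$ are measurable. $S_n:=\sum_{k=0}^n\xi(X_k)$; $g_n(\gamma):=\mathbb E[(\prod_{j=0}^{n-1}\kappa(X_j))(\kappa(X_n)-1)e^{-\gamma S_n}]$; $G(\gamma):=\sum_{n\ge0}g_n(\gamma)$; $\nu:=\inf\{\gamma>0:G(\gamma)<\infty\}$. Branching process. Cells are labelled by finite sequences $v=(k_1,\dots,k_n)$ of positive integers (the empty sequence labels the initial cell, born at time $0$). To each label $v$ is attached an $\mathbb X$-valued random variable $X_v$ such that, along every infinite line of descent $(v_n)_{n\ge0}$ ($v_0=\emptyset$, $v_{n+1}$ obtained from $v_n$ by appending one positive integer), $(X_{v_n})_{n\ge0}$ has the law of $(X_n)_{n\ge0}$. A cell $v$ lives for a time $\xi(X_v)$ and then splits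 into $\kappa(X_v)$ cells, labelled by appending $1,\dots,\kappa(X_v)$ to $v$. $N_t$ is the number of cells alive at time $t$ (a cell being alive from its birth time, included, to its death time, excluded). *)

theory Defs
  imports "HOL-Probability.Probability"
begin

section \<open>The linear autoregressive model\<close>

text \<open>\<open>X0_indep_noise\<close> is independence of the \<open>\<sigma>\<close>-algebras generated by \<open>X\<^sub>0\<close> and by the whole
  sequence \<open>(\<theta>\<^sub>n)\<^sub>n\<^sub>\<ge>\<^sub>1\<close>; \<open>indep_var\<close> is not usable, as it wants both variables of the same type.\<close>

locale linear_ar = prob_space M
  for M :: "'a measure" and \<alpha> r\<^sub>0 :: real and p :: "real \<Rightarrow> real"
    and \<theta> :: "nat \<Rightarrow> 'a \<Rightarrow> real" and X :: "nat \<Rightarrow> 'a \<Rightarrow> real" +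
  assumes alpha: "-1 < \<alpha>" "\<alpha> < 1"
    and r0_pos: "r\<^sub>0 > 0"
    and rv_X0: "random_variable borel (X 0)"
    and recursion: "\<And>n \<omega>. n \<ge> 1 \<Longrightarrow> \<omega> \<in> space M \<Longrightarrow> X n \<omega> = \<alpha> * X (n - 1) \<omega> + \<theta> n \<omega>"
    and noise_indep: "indep_vars (\<lambda>_. borel) \<theta> {1..}"
    and noise_ident: "\<And>n. n \<ge> 1 \<Longrightarrow> distr M borel (\<theta> n) = distr M borel (\<theta> 1)"
    and X0_indep_noise:
      "indep_set (sets (vimage_algebra (space M) (X 0) borel))
                 (sets (vimage_algebra (space M) (\<lambda>\<omega>. \<lambda>n\<in>{1..}. \<theta> n \<omega>) (PiM {1..} (\<lambda>_. borel))))"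
    and p_pos: "\<And>y. p y > 0"
    and p_cont: "continuous_on UNIV p"
    and p_density: "distributed M lborel (\<theta> 1) (\<lambda>y. ennreal (p y))"
    and p_dominated:
      "\<And>x\<^sub>0. \<exists>V q. x\<^sub>0 \<in> interior V \<and> (\<forall>y. q y \<ge> 0)
          \<and> integrable lebesgue (\<lambda>y. (1 + \<bar>y\<bar>) powr r\<^sub>0 * q y)
          \<and> (\<forall>y. \<forall>v\<in>V. p (y + v) \<le> q y)"

definition ar_kernel :: "real \<Rightarrow> (real \<Rightarrow> real) \<Rightarrow> real \<Rightarrow> real measure" where
  "ar_kernel \<alpha> p x = distr (density lborel (\<lambda>y. ennreal (p y))) borel (\<lambda>y. \<alpha> * x + y)"

definition ar_stationary :: "real \<Rightarrow> (real \<Rightarrow> real) \<Rightarrow> real measure \<Rightarrow> bool" where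
  "ar_stationary \<alpha> p \<pi> \<longleftrightarrow> prob_space \<pi> \<and> sets \<pi> = sets borel \<and>
     (\<forall>A\<in>sets borel. emeasure \<pi> A = (\<integral>\<^sup>+ x. emeasure (ar_kernel \<alpha> p x) A \<partial>\<pi>))"

text \<open>The laws \<open>\<pi>\<close> and \<open>\<delta>\<^sub>x\<close>, the latter being \<open>return borel x\<close>.\<close>

definition ar_initial_law :: "real \<Rightarrow> (real \<Rightarrow> real) \<Rightarrow> real measure \<Rightarrow> bool" where
  "ar_initial_law \<alpha> p \<mu> \<longleftrightarrow> ar_stationary \<alpha> p \<mu> \<or> (\<exists>x. \<mu> = return borel x)"

section \<open>The functions \<open>g\<^sub>n\<close> and \<open>G\<close>, and the rate \<open>\<nu>\<close>\<close>

definition S_sum :: "(real \<Rightarrow> real) \<Rightarrow> (nat \<Rightarrow> 'a \<Rightarrow> real) \<Rightarrow> nat \<Rightarrow> 'a \<Rightarrow> real" where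
  "S_sum \<xi> X n \<omega> = (\<Sum>k\<le>n. \<xi> (X k \<omega>))"

definition g_fun :: "'a measure \<Rightarrow> (nat \<Rightarrow> 'a \<Rightarrow> real) \<Rightarrow> (real \<Rightarrow> real) \<Rightarrow> (real \<Rightarrow> nat)
    \<Rightarrow> nat \<Rightarrow> real \<Rightarrow> ennreal" where
  "g_fun M X \<xi> \<kappa> n \<gamma> =
     (\<integral>\<^sup>+ \<omega>. ennreal ((\<Prod>j<n. real (\<kappa> (X j \<omega>))) * (real (\<kappa> (X n \<omega>)) - 1)
                    * exp (- \<gamma> * S_sum \<xi> X n \<omega>)) \<partial>M)"

definition G_fun :: "'a measure \<Rightarrow> (nat \<Rightarrow> 'a \<Rightarrow> real) \<Rightarrow> (real \<Rightarrow> real) \<Rightarrow> (real \<Rightarrow> nat)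
    \<Rightarrow> real \<Rightarrow> ennreal" where
  "G_fun M X \<xi> \<kappa> \<gamma> = (\<Sum>n. g_fun M X \<xi> \<kappa> n \<gamma>)"

text \<open>The infimum is taken in the extended reals, so that it is \<open>\<infinity>\<close> when
  \<open>G(\<gamma>) = \<infinity>\<close> for all \<open>\<gamma> > 0\<close>.\<close>

definition nu_rate :: "'a measure \<Rightarrow> (nat \<Rightarrow> 'a \<Rightarrow> real) \<Rightarrow> (real \<Rightarrow> real) \<Rightarrow> (real \<Rightarrow> nat)
    \<Rightarrow> ereal" where
  "nu_rate M X \<xi> \<kappa> = (INF \<gamma>\<in>{\<gamma>. \<gamma> > 0 \<and> G_fun M X \<xi> \<kappa> \<gamma> < \<infinity>}. ereal \<gamma>)"

section \<open>The branching process\<close>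

type_synonym label = "nat list"

definition labels :: "label set" where
  "labels = {v. \<forall>k\<in>set v. 1 \<le> k}"

text \<open>An infinite line of descent is given by the sequence \<open>k\<close> of positive integers appended
  one after the other; its \<open>n\<close>-th label is \<open>[k 0, \<dots>, k (n - 1)]\<close>. The law of
  \<open>Y\<close> along each line is that of \<open>X\<close>; the joint law across different lines is arbitrary.\<close>

definition branching_family :: "'a measure \<Rightarrow> (nat \<Rightarrow> 'a \<Rightarrow> real)
    \<Rightarrow> 'c measure \<Rightarrow> (label \<Rightarrow> 'c \<Rightarrow> real) \<Rightarrow> bool" where
  "branching_family M X W Y \<longleftrightarrow> prob_space W \<and>
     (\<forall>v\<in>labels. Y v \<in> borel_measurable W) \<and>
     (\<forall>k :: nat \<Rightarrow> nat. (\<forall>i. 1 \<le> k i) \<longrightarrow>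
        distr W (PiM UNIV (\<lambda>_. borel)) (\<lambda>\<omega> n. Y (map k [0..<n]) \<omega>)
      = distr M (PiM UNIV (\<lambda>_. borel)) (\<lambda>\<omega> n. X n \<omega>))"

text \<open>The functions below take the realisation \<open>x :: label \<Rightarrow> real\<close> of the family.\<close>

definition cell_exists :: "(real \<Rightarrow> nat) \<Rightarrow> (label \<Rightarrow> real) \<Rightarrow> label \<Rightarrow> bool" where
  "cell_exists \<kappa> x v \<longleftrightarrow> (\<forall>i<length v. 1 \<le> v ! i \<and> v ! i \<le> \<kappa> (x (take i v)))"

definition birth_time :: "(real \<Rightarrow> real) \<Rightarrow> (label \<Rightarrow> real) \<Rightarrow> label \<Rightarrow> real" where
  "birth_time \<xi> x v = (\<Sum>i<length v. \<xi> (x (take i v)))"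

definition alive :: "(real \<Rightarrow> real) \<Rightarrow> (real \<Rightarrow> nat) \<Rightarrow> (label \<Rightarrow> real) \<Rightarrow> real \<Rightarrow> label set" where
  "alive \<xi> \<kappa> x t = {v. cell_exists \<kappa> x v \<and> birth_time \<xi> x v \<le> t
                        \<and> t < birth_time \<xi> x v + \<xi> (x v)}"

text \<open>Infinitely many cells may be alive at the same time; then the count is \<open>\<infinity>\<close>.\<close>

definition N_alive :: "(real \<Rightarrow> real) \<Rightarrow> (real \<Rightarrow> nat) \<Rightarrow> (label \<Rightarrow> real) \<Rightarrow> real \<Rightarrow> ennreal" where
  "N_alive \<xi> \<kappa> x t = emeasure (count_space UNIV) (alive \<xi> \<kappa> x t)"

definition mean_alive :: "'c measure \<Rightarrow> (label \<Rightarrow> 'c \<Rightarrow> real) \<Rightarrow> (real \<Rightarrow> real) \<Rightarrow> (real \<Rightarrow> nat)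
    \<Rightarrow> real \<Rightarrow> ennreal" where
  "mean_alive W Y \<xi> \<kappa> t = (\<integral>\<^sup>+ \<omega>. N_alive \<xi> \<kappa> (\<lambda>v. Y v \<omega>) t \<partial>W)"

end

theory Submission
  imports Defs "HOL-Real_Asymp.Real_Asymp"
begin

text \<open>Let \<open>Q\<^sub>\<gamma> f(x) = \<kappa>(x) exp(-\<gamma> \<xi>(x)) \<integral> p(y - \<alpha> x) f(y) dy\<close>. The Markov property turns \<open>G(\<gamma>)\<close> into the
  mean of the potential \<open>\<Sum>\<^sub>n Q\<^sub>\<gamma>\<^sup>n h\<^sub>\<gamma>\<close> under the initial law. Because \<open>\<xi>\<close> is coercive, the weight is tiny
  outside a compact interval \<open>D\<close>, so the potential of \<open>1\<close> is bounded as soon as its integral \<open>m\<close> over \<open>D\<close>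
  is finite; whether this happens does not depend on the initial law, and it defines \<open>\<nu>\<close>.

  Since \<open>p > 0\<close>, one can split off a rank one part, \<open>Q\<^sub>\<gamma> f = T\<^sub>\<gamma> f + m(f) s\<^sub>\<gamma>\<close> with \<open>s\<^sub>\<gamma> > 0\<close>, and the potential
  of \<open>T\<^sub>\<gamma>\<close> stays bounded down to \<open>\<gamma> = \<nu>\<close>. At \<open>\<nu>\<close> the functional \<open>\<sigma> f = m(\<Sum>\<^sub>n T\<^sub>\<nu>\<^sup>n f)\<close> is an eigenmeasure,
  \<open>\<sigma> Q\<^sub>\<nu> = \<sigma>\<close>. Pairing it with \<open>f\<^sub>\<gamma> = h\<^sub>\<gamma> + Q\<^sub>\<gamma> f\<^sub>\<gamma>\<close> gives \<open>\<sigma>(h\<^sub>\<gamma>) = \<sigma>((Q\<^sub>\<nu> - Q\<^sub>\<gamma>) f\<^sub>\<gamma>)\<close>, from which monotone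
  convergence along \<open>\<gamma> \<down> \<nu>\<close> reads off that the pole of \<open>G\<close> at \<open>\<nu>\<close> is simple. The Laplace transform of the mean
  number of living cells is \<open>(1 + G(\<gamma>)) / \<gamma>\<close>, and Karamata's Tauberian theorem gives the Cesaro limit.\<close>

section \<open>Potentials of positive kernels\<close>

text \<open>No minorization is uniform over the whole line. For \<open>|y| <= R\<close> the density
  \<open>p (y - \<alpha> x)\<close> is at least the minimum of \<open>p\<close> on
  \<open>[-(R + |x|), R + |x|]\<close>, which is positive but tends to 0 as \<open>|x|\<close>
  grows; this is why \<open>s\<close> depends on \<open>x\<close>, while \<open>m\<close> is
  Lebesgue measure on \<open>D\<close>. The decomposition is Nummelin's splitting, and the scalar
  identity \<open>m(\<Sum> T^n s) = 1\<close> at \<nu> plays the role of a Perron eigenvalue equal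
  to 1. It holds because the value is at most 1 for exponents above \<nu>, hence also at \<nu> by
  monotone convergence, while a value below 1 would produce a bounded potential at some exponent
  left of \<nu>. The latter rests on a perturbation bound for the weights that is uniform in
  \<open>x\<close> although \<xi> is unbounded. Functions take values in
  \<open>[0, \<infinity>]\<close>, so series and integrals exist at every exponent. Finiteness is
  won by absorption on truncated sums. Limits are taken along decreasing exponents, where weights,
  potentials and the difference quotients of the weights all increase.\<close>

lemma suminf_split0: "(\<Sum>n. f n) = f 0 + (\<Sum>n. f (Suc n))" for f :: "nat \<Rightarrow> ennreal"
  using suminf_offset[of f 1] by simp

text \<open>The term with index \<open>max i j\<close> dominates the mixed product of indices
  \<open>i\<close> and \<open>j\<close>. Phrased with suprema, the rule has no exception for
  \<open>0\<close> times \<open>\<infinity>\<close>, where multiplication is not continuous.\<close>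

lemma SUP_mult_incseq_ennreal:
  fixes a b :: "nat \<Rightarrow> ennreal"
  assumes "incseq a" "incseq b"
  shows "(SUP n. a n * b n) = (SUP n. a n) * (SUP n. b n)"
proof (rule antisym)
  show "(SUP n. a n * b n) \<le> (SUP n. a n) * (SUP n. b n)"
    by (intro SUP_least mult_mono SUP_upper) auto
  have "a i * b j \<le> (SUP n. a n * b n)" for i j
    using assms by (intro SUP_upper2[of "max i j"] mult_mono) (auto intro: incseqD)
  then show "(SUP n. a n) * (SUP n. b n) \<le> (SUP n. a n * b n)"
    by (auto simp: SUP_mult_left_ennreal SUP_mult_right_ennreal intro!: SUP_least)
qed

text \<open>Finiteness of \<open>S\<close> is essential, as \<open>\<top>\<close> satisfies the
  inequality too. It is therefore applied to truncated sums, which are finite, and the resulting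
  bound is passed to the supremum afterwards.\<close>

lemma ennreal_absorb_half:
  fixes S a :: ennreal
  assumes "S \<noteq> \<top>" "S \<le> a + ennreal (1/2) * S"
  shows "S \<le> 2 * a"
proof (cases a)
  case (real r)
  obtain s where s: "S = ennreal s" "s \<ge> 0" using assms(1) by (cases S) auto
  have "ennreal (1/2) * ennreal s = ennreal (1/2 * s)" using s by (subst ennreal_mult) auto
  then have "ennreal s \<le> ennreal (r + 1/2 * s)"
    using assms(2) real s by (simp only: ennreal_plus)
  then have "s \<le> 2 * r" using real s by (subst (asm) ennreal_le_iff) auto
  then have "ennreal s \<le> ennreal (2 * r)" by (rule ennreal_leI)
  then show ?thesis using s real by (simp add: ennreal_mult)
qed (simp add: ennreal_mult_top)

lemma nn_integral_pos:
  assumes "f \<in> borel_measurable N" "emeasure N (space N) \<noteq> 0" "AE x in N. f x > 0"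
  shows "(\<integral>\<^sup>+ x. f x \<partial>N) > 0"
proof (rule ccontr)
  assume "\<not> ?thesis"
  then have "AE x in N. f x = 0" using assms(1) by (simp add: nn_integral_0_iff_AE)
  with assms(3) have "AE x in N. False" by eventually_elim auto
  then have "emeasure N (space N) = 0" using emeasure_eq_0_AE[of "\<lambda>_. True" N] by simp
  with assms(2) show False by simp
qed

lemma incseq_SUP_eqI: "incseq f \<Longrightarrow> f \<longlonglongrightarrow> l \<Longrightarrow> (SUP n. f n) = (l :: ennreal)"
  using LIMSEQ_SUP LIMSEQ_unique by blast

definition kop :: "'a measure \<Rightarrow> ('a \<Rightarrow> 'a \<Rightarrow> ennreal) \<Rightarrow> ('a \<Rightarrow> ennreal) \<Rightarrow> 'a \<Rightarrow> ennreal" where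
  "kop N k f x = (\<integral>\<^sup>+ y. k x y * f y \<partial>N)"

text \<open>The Neumann series of the kernel, by \<open>pot_eq\<close> and
  \<open>pot_le_supersolution\<close> the least nonnegative solution of \<open>u = f + k u\<close>.
  With values in \<open>ennreal\<close> it makes sense also where it diverges.\<close>

definition pot :: "'a measure \<Rightarrow> ('a \<Rightarrow> 'a \<Rightarrow> ennreal) \<Rightarrow> ('a \<Rightarrow> ennreal) \<Rightarrow> 'a \<Rightarrow> ennreal" where
  "pot N k f x = (\<Sum>n. (kop N k ^^ n) f x)"

lemma kop_mono: "(\<And>x y. k x y \<le> k' x y) \<Longrightarrow> (\<And>x. f x \<le> g x) \<Longrightarrow> kop N k f x \<le> kop N k' g x"
  unfolding kop_def by (intro nn_integral_mono mult_mono) auto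

lemma kop_funpow_mono:
  assumes "\<And>x y. k x y \<le> k' x y" and "\<And>x. f x \<le> g x"
  shows "(kop N k ^^ n) f x \<le> (kop N k' ^^ n) g x"
proof (induction n arbitrary: x)
  case (Suc n)
  then show ?case by (auto intro!: kop_mono assms)
qed (simp add: assms)

lemma pot_mono:
  assumes "\<And>x y. k x y \<le> k' x y" and "\<And>x. f x \<le> g x"
  shows "pot N k f x \<le> pot N k' g x"
  unfolding pot_def by (intro suminf_le kop_funpow_mono assms) auto

lemma pot_eq_SUP: "pot N k f x = (SUP n. \<Sum>i<n. (kop N k ^^ i) f x)"
  unfolding pot_def by (rule suminf_eq_SUP)

lemma psum_le_pot: "(\<Sum>i<n. (kop N k ^^ i) f x) \<le> pot N k f x"
  unfolding pot_eq_SUP by (rule SUP_upper) simp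

lemma le_pot: "f x \<le> pot N k f x"
  using psum_le_pot[of N k f x 1] by simp

locale pos_kernel = sigma_finite_measure N
  for N :: "'a measure" and k :: "'a \<Rightarrow> 'a \<Rightarrow> ennreal" +
  assumes kernel_measurable [measurable]: "case_prod k \<in> borel_measurable (N \<Otimes>\<^sub>M N)"
begin

lemma kop_measurable [measurable]:
  assumes [measurable]: "f \<in> borel_measurable N"
  shows "kop N k f \<in> borel_measurable N"
  unfolding kop_def by measurable

lemma kop_funpow_measurable [measurable]:
  assumes [measurable]: "f \<in> borel_measurable N"
  shows "(kop N k ^^ n) f \<in> borel_measurable N"
  by (induction n) auto

lemma pot_measurable [measurable]:
  assumes [measurable]: "f \<in> borel_measurable N"
  shows "pot N k f \<in> borel_measurable N"
  unfolding pot_def by measurable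

lemma kernel_measurable_snd [measurable]: "x \<in> space N \<Longrightarrow> k x \<in> borel_measurable N"
  using measurable_compose[OF measurable_Pair1' kernel_measurable] by simp

lemma kop_add:
  assumes [measurable]: "f \<in> borel_measurable N" "g \<in> borel_measurable N" and "x \<in> space N"
  shows "kop N k (\<lambda>x. f x + g x) x = kop N k f x + kop N k g x"
  unfolding kop_def using assms(3) by (simp add: distrib_left nn_integral_add)

lemma kop_cmult:
  assumes [measurable]: "f \<in> borel_measurable N" and "x \<in> space N"
  shows "kop N k (\<lambda>x. c * f x) x = c * kop N k f x"
proof -
  have "kop N k (\<lambda>x. c * f x) x = (\<integral>\<^sup>+ y. c * (k x y * f y) \<partial>N)"
    unfolding kop_def by (simp add: mult.left_commute)
  then show ?thesis unfolding kop_def using assms(2) by (subst (asm) nn_integral_cmult) auto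
qed

lemma kop_cong: "(\<And>y. y \<in> space N \<Longrightarrow> f y = g y) \<Longrightarrow> kop N k f x = kop N k g x"
  unfolding kop_def by (rule nn_integral_cong) simp

lemma kop_funpow_add:
  assumes [measurable]: "f \<in> borel_measurable N" "g \<in> borel_measurable N" and "x \<in> space N"
  shows "(kop N k ^^ n) (\<lambda>x. f x + g x) x = (kop N k ^^ n) f x + (kop N k ^^ n) g x"
  using assms(3)
proof (induction n arbitrary: x)
  case (Suc n)
  have "(kop N k ^^ Suc n) (\<lambda>x. f x + g x) x
      = kop N k (\<lambda>x. (kop N k ^^ n) f x + (kop N k ^^ n) g x) x"
    using Suc.IH by (auto intro: kop_cong)
  then show ?case using Suc.prems by (simp add: kop_add)
qed simp

lemma kop_funpow_cmult:
  assumes [measurable]: "f \<in> borel_measurable N" and "x \<in> space N"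
  shows "(kop N k ^^ n) (\<lambda>x. c * f x) x = c * (kop N k ^^ n) f x"
  using assms(2)
proof (induction n arbitrary: x)
  case (Suc n)
  have "(kop N k ^^ Suc n) (\<lambda>x. c * f x) x = kop N k (\<lambda>x. c * (kop N k ^^ n) f x) x"
    using Suc.IH by (auto intro: kop_cong)
  then show ?case using Suc.prems by (simp add: kop_cmult)
qed simp

lemma pot_add:
  assumes [measurable]: "f \<in> borel_measurable N" "g \<in> borel_measurable N" and "x \<in> space N"
  shows "pot N k (\<lambda>x. f x + g x) x = pot N k f x + pot N k g x"
  unfolding pot_def using assms by (simp add: kop_funpow_add suminf_add)

lemma pot_cmult:
  assumes [measurable]: "f \<in> borel_measurable N" and "x \<in> space N"
  shows "pot N k (\<lambda>x. c * f x) x = c * pot N k f x"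
  unfolding pot_def using assms by (simp add: kop_funpow_cmult)

lemma kop_suminf:
  assumes [measurable]: "\<And>i. f i \<in> borel_measurable N" and "x \<in> space N"
  shows "kop N k (\<lambda>x. \<Sum>i. f i x) x = (\<Sum>i. kop N k (f i) x)"
  unfolding kop_def using assms(2)
  by (simp add: ennreal_suminf_cmult[symmetric] nn_integral_suminf del: ennreal_suminf_cmult)

lemma pot_eq:
  assumes [measurable]: "f \<in> borel_measurable N" and "x \<in> space N"
  shows "pot N k f x = f x + kop N k (pot N k f) x"
proof -
  have "pot N k f x = f x + (\<Sum>n. kop N k ((kop N k ^^ n) f) x)"
    unfolding pot_def by (subst suminf_split0) simp
  also have "(\<Sum>n. kop N k ((kop N k ^^ n) f) x) = kop N k (pot N k f) x"
    unfolding pot_def[abs_def] using assms by (subst kop_suminf) auto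
  finally show ?thesis .
qed

text \<open>Here the kernel is split off next to \<open>f\<close>, in \<open>pot_eq\<close> on the
  outside. This form computes how a functional composed with the potential acts on
  \<open>k f\<close>, which is needed for the eigenmeasure.\<close>

lemma pot_eq':
  "pot N k f x = f x + pot N k (kop N k f) x"
  unfolding pot_def by (subst suminf_split0) (simp add: funpow_swap1)

lemma psum_Suc:
  assumes [measurable]: "f \<in> borel_measurable N" and "x \<in> space N"
  shows "(\<Sum>i<Suc n. (kop N k ^^ i) f x) = f x + kop N k (\<lambda>x. \<Sum>i<n. (kop N k ^^ i) f x) x"
proof -
  have "kop N k (\<lambda>x. \<Sum>i<n. (kop N k ^^ i) f x) x = (\<Sum>i<n. kop N k ((kop N k ^^ i) f) x)"
    unfolding kop_def[of N k "\<lambda>x. \<Sum>i<n. (kop N k ^^ i) f x"] using assms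
    by (simp add: sum_distrib_left nn_integral_sum kop_def[of N k "(kop N k ^^ _) f"])
  then show ?thesis by (simp add: sum.lessThan_Suc_shift del: sum.lessThan_Suc)
qed

text \<open>Induction shows that each partial sum stays below \<open>V\<close>. Upper bounds on
  potentials can thus be proved by exhibiting some \<open>V\<close>, without solving the Poisson
  equation.\<close>

lemma pot_le_supersolution:
  assumes [measurable]: "f \<in> borel_measurable N"
    and V: "\<And>x. x \<in> space N \<Longrightarrow> f x + kop N k V x \<le> V x" and "x \<in> space N"
  shows "pot N k f x \<le> V x"
proof -
  have "(\<Sum>i<n. (kop N k ^^ i) f x) \<le> V x" if "x \<in> space N" for n x
    using that
  proof (induction n arbitrary: x)
    case (Suc n)
    have "(\<Sum>i<Suc n. (kop N k ^^ i) f x) = f x + kop N k (\<lambda>x. \<Sum>i<n. (kop N k ^^ i) f x) x"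
      using Suc.prems by (simp add: psum_Suc del: sum.lessThan_Suc)
    also have "\<dots> \<le> f x + kop N k V x"
      unfolding kop_def[of N k V] kop_def[of N k "\<lambda>x. \<Sum>i<n. (kop N k ^^ i) f x"]
      using Suc.IH by (intro add_left_mono nn_integral_mono mult_left_mono) auto
    finally show ?case using V[OF Suc.prems] by simp
  qed simp
  then show ?thesis unfolding pot_eq_SUP using assms(3) by (intro SUP_least) auto
qed

text \<open>Uniqueness of the bounded solution of the Poisson equation holds as soon as the potential
  of the constant function \<open>1\<close> is finite, since then \<open>k\<^sup>n 1 \<longlonglongrightarrow> 0\<close>.\<close>

lemma pot_unique:
  assumes [measurable]: "f \<in> borel_measurable N" "V \<in> borel_measurable N"
    and V: "\<And>x. x \<in> space N \<Longrightarrow> V x = f x + kop N k V x"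
    and bound: "\<And>x. x \<in> space N \<Longrightarrow> V x \<le> c" and c: "c \<noteq> \<top>"
    and x: "x \<in> space N" and fin: "pot N k (\<lambda>_. 1) x \<noteq> \<top>"
  shows "V x = pot N k f x"
proof (rule antisym)
  have V_eq: "V x = (\<Sum>i<n. (kop N k ^^ i) f x) + (kop N k ^^ n) V x" if "x \<in> space N" for n x
    using that
  proof (induction n arbitrary: x)
    case (Suc n)
    \<comment> \<open>The equation for \<open>V\<close> holds on the space of \<open>N\<close> only.
      That suffices under at least one integral, and for \<open>n = 0\<close> the point
      \<open>x\<close> itself lies in the space.\<close>
    have "(kop N k ^^ n) V x = (kop N k ^^ n) (\<lambda>x. f x + kop N k V x) x"
    proof (cases n)
      case (Suc m)
      have *: "(kop N k ^^ Suc m) V = (kop N k ^^ m) (kop N k V)"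
        "(kop N k ^^ Suc m) (\<lambda>x. f x + kop N k V x) = (kop N k ^^ m) (kop N k (\<lambda>x. f x + kop N k V x))"
        by (simp_all add: funpow_swap1)
      have "kop N k V = kop N k (\<lambda>x. f x + kop N k V x)"
        by (rule ext, rule kop_cong) (rule V)
      with Suc show ?thesis by (simp only: *)
    qed (use V Suc.prems in simp)
    also have "\<dots> = (kop N k ^^ n) f x + (kop N k ^^ Suc n) V x"
      using Suc.prems by (simp add: kop_funpow_add funpow_swap1)
    finally show ?case using Suc by (simp add: add.assoc)
  qed simp
  have "(\<lambda>n. (kop N k ^^ n) (\<lambda>_. 1) x) \<longlonglongrightarrow> 0"
  proof -
    have sum: "(\<Sum>n. (kop N k ^^ n) (\<lambda>_. 1) x) \<noteq> \<top>" using fin by (simp add: pot_def)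
    then have *: "(kop N k ^^ n) (\<lambda>_. 1) x < \<top>" for n
      using ennreal_suminf_lessD[of "\<lambda>n. (kop N k ^^ n) (\<lambda>_. 1) x" \<top>] by (auto simp: less_top)
    then have eq: "ennreal (enn2real ((kop N k ^^ n) (\<lambda>_. 1) x)) = (kop N k ^^ n) (\<lambda>_. 1) x" for n
      by (simp add: less_top)
    have "summable (\<lambda>n. enn2real ((kop N k ^^ n) (\<lambda>_. 1) x))"
      by (rule summable_suminf_not_top) (simp_all only: eq sum enn2real_nonneg not_False_eq_True)
    then have "(\<lambda>n. ennreal (enn2real ((kop N k ^^ n) (\<lambda>_. 1) x))) \<longlonglongrightarrow> ennreal 0"
      by (intro tendsto_ennrealI summable_LIMSEQ_zero)
    then show ?thesis by (simp only: eq ennreal_0)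
  qed
  then have "(\<lambda>n. pot N k f x + c * (kop N k ^^ n) (\<lambda>_. 1) x) \<longlonglongrightarrow> pot N k f x + c * 0"
    using c by (intro tendsto_add ennreal_tendsto_cmult tendsto_const) (auto simp: less_top)
  moreover have "V x \<le> pot N k f x + c * (kop N k ^^ n) (\<lambda>_. 1) x" for n
  proof -
    have "(kop N k ^^ n) V x \<le> (kop N k ^^ n) (\<lambda>_. c * 1) x"
    proof -
      have "(kop N k ^^ n) V x \<le> (kop N k ^^ n) (\<lambda>_. c * 1) x" if "x \<in> space N" for x
        using that
      proof (induction n arbitrary: x)
        case (Suc n)
        then show ?case
          by (auto simp: kop_def[of N k "(kop N k ^^ n) _"] intro!: nn_integral_mono mult_left_mono)
      qed (simp add: bound)
      then show ?thesis using x .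
    qed
    also have "\<dots> = c * (kop N k ^^ n) (\<lambda>_. 1) x"
      using x by (subst kop_funpow_cmult) auto
    finally show ?thesis
      by (subst V_eq[OF x, of n]) (intro add_mono psum_le_pot)
  qed
  ultimately show "V x \<le> pot N k f x" by (intro LIMSEQ_le_const) auto
next
  show "pot N k f x \<le> V x" using V x by (intro pot_le_supersolution) auto
qed

end

text \<open>Kernel and function move together: every iterate is a supremum by induction, the product
  under the integral being handled by \<open>SUP_mult_incseq_ennreal\<close>. This is the form in
  which continuity from the right in the exponent is used.\<close>

lemma pot_monotone_convergence:
  assumes k: "\<And>i. pos_kernel N (k i)"
    and f: "\<And>i. f i \<in> borel_measurable N"
    and k_inc: "\<And>x y. incseq (\<lambda>i. k i x y)" and k_sup: "\<And>x y. k' x y = (SUP i. k i x y)"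
    and f_inc: "\<And>x. incseq (\<lambda>i. f i x)" and f_sup: "\<And>x. f' x = (SUP i. f i x)"
    and x: "x \<in> space N"
  shows "pot N k' f' x = (SUP i. pot N (k i) (f i) x)"
proof -
  have inc: "incseq (\<lambda>i. (kop N (k i) ^^ n) (f i) x)" for n x
    using k_inc f_inc by (auto simp: incseq_def intro!: kop_funpow_mono)
  have "(kop N k' ^^ n) f' x = (SUP i. (kop N (k i) ^^ n) (f i) x)" if "x \<in> space N" for n
    using that
  proof (induction n arbitrary: x)
    case (Suc n)
    have "(kop N k' ^^ Suc n) f' x
        = (\<integral>\<^sup>+ y. (SUP i. k i x y) * (SUP i. (kop N (k i) ^^ n) (f i) y) \<partial>N)"
      using Suc.IH by (auto simp: kop_def[of N k' "(kop N k' ^^ n) f'"] k_sup[of x] intro!: nn_integral_cong)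
    also have "\<dots> = (\<integral>\<^sup>+ y. (SUP i. k i x y * (kop N (k i) ^^ n) (f i) y) \<partial>N)"
      by (simp add: SUP_mult_incseq_ennreal[OF k_inc inc])
    also have "\<dots> = (SUP i. \<integral>\<^sup>+ y. k i x y * (kop N (k i) ^^ n) (f i) y \<partial>N)"
    proof (rule nn_integral_monotone_convergence_SUP)
      show "incseq (\<lambda>i y. k i x y * (kop N (k i) ^^ n) (f i) y)"
        using k_inc inc by (auto simp: incseq_def le_fun_def intro!: mult_mono)
      show "(\<lambda>y. k i x y * (kop N (k i) ^^ n) (f i) y) \<in> borel_measurable N" for i
        using pos_kernel.kop_funpow_measurable[OF k f] pos_kernel.kernel_measurable_snd[OF k Suc.prems]
        by simp
    qed
    finally show ?case by (simp add: kop_def[of N "k _" "(kop N (k _) ^^ n) _"])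
  qed (simp add: f_sup)
  then show ?thesis unfolding pot_def using x
    by (simp add: ennreal_suminf_SUP_eq[OF inc])
qed

lemma incseq_pot:
  assumes "\<And>x y. incseq (\<lambda>i. k i x y)" "\<And>x. incseq (\<lambda>i. f i x)"
  shows "incseq (\<lambda>i. pot N (k i) (f i) x)"
  using assms by (auto simp: incseq_def intro!: pot_mono)

section \<open>The weighted autoregressive kernel and its critical exponent\<close>

context pos_kernel
begin

lemma kop_funpow_one_le:
  assumes "\<And>x. x \<in> space N \<Longrightarrow> kop N k (\<lambda>_. 1) x \<le> c" "x \<in> space N"
  shows "(kop N k ^^ n) (\<lambda>_. 1) x \<le> c ^ n"
  using assms(2)
proof (induction n arbitrary: x)
  case (Suc n)
  have "(kop N k ^^ Suc n) (\<lambda>_. 1) x \<le> kop N k (\<lambda>_. c ^ n * 1) x"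
    using Suc.IH
    by (auto simp: kop_def[of N k "(kop N k ^^ n) _"] kop_def[of N k "\<lambda>_. c ^ n"]
        intro!: nn_integral_mono mult_left_mono)
  also have "\<dots> = c ^ n * kop N k (\<lambda>_. 1) x" using Suc.prems by (subst kop_cmult) auto
  also have "\<dots> \<le> c ^ n * c" using assms(1) Suc.prems by (intro mult_left_mono) auto
  finally show ?case by (simp add: mult.commute)
qed simp

text \<open>A crude geometric bound; its purpose is to make truncated sums finite, so that
  \<open>ennreal_absorb_half\<close> applies to them.\<close>

lemma psum_one_finite:
  assumes "\<And>x. x \<in> space N \<Longrightarrow> kop N k (\<lambda>_. 1) x \<le> ennreal c" "x \<in> space N" "c \<ge> 0"
  shows "(\<Sum>i<n. (kop N k ^^ i) (\<lambda>_. 1) x) \<le> ennreal (\<Sum>i<n. c ^ i)"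
proof -
  have "(kop N k ^^ i) (\<lambda>_. 1) x \<le> ennreal (c ^ i)" for i
    using kop_funpow_one_le[of "ennreal c" x i] assms by (simp add: ennreal_power)
  then show ?thesis
    using assms(3) by (subst sum_ennreal[symmetric]) (simp_all add: sum_mono del: sum_ennreal)
qed

text \<open>Applying the iterates to the drift bound \<open>k 1 <= 1/2 + c 1_D\<close> and summing
  yields \<open>S <= 1 + S/2 + c pot(1_D)\<close> for each truncated sum \<open>S\<close> of the
  potential of 1, and \<open>S/2\<close> can be absorbed.\<close>

lemma pot_one_le_pot_indicator:
  assumes le: "\<And>x. x \<in> space N \<Longrightarrow> kop N k (\<lambda>_. 1) x \<le> ennreal (1/2) + ennreal c * indicator D x"
    and [measurable]: "D \<in> sets N" and x: "x \<in> space N" and c: "c \<ge> 0"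
  shows "pot N k (\<lambda>_. 1) x \<le> 2 * (1 + ennreal c * pot N k (indicator D) x)"
proof -
  have [measurable]: "(indicator D :: 'a \<Rightarrow> ennreal) \<in> borel_measurable N" by measurable
  have "(\<Sum>i<n. (kop N k ^^ i) (\<lambda>_. 1) x) \<le> 2 * (1 + ennreal c * pot N k (indicator D) x)" for n
  proof (rule ennreal_absorb_half)
    have le2: "kop N k (\<lambda>_. 1) x \<le> ennreal (1/2 + c)" if "x \<in> space N" for x
    proof -
      have "ennreal (1/2) + ennreal c * indicator D x \<le> ennreal (1/2 + c)"
        using c by (subst ennreal_plus) (auto intro!: add_left_mono simp: indicator_def)
      then show ?thesis using le[OF that] order_trans by blast
    qed
    show "(\<Sum>i<n. (kop N k ^^ i) (\<lambda>_. 1) x) \<noteq> \<top>"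
      by (rule less_imp_neq, rule le_less_trans[OF psum_one_finite[OF le2 x]]) (use c in auto)
    have "(\<Sum>i<n. (kop N k ^^ i) (\<lambda>_. 1) x) \<le> (\<Sum>i<Suc n. (kop N k ^^ i) (\<lambda>_. 1) x)" by simp
    also have "\<dots> = 1 + (\<Sum>i<n. (kop N k ^^ i) (kop N k (\<lambda>_. 1)) x)"
      by (simp add: sum.lessThan_Suc_shift funpow_swap1 del: sum.lessThan_Suc)
    also have "(\<Sum>i<n. (kop N k ^^ i) (kop N k (\<lambda>_. 1)) x)
        \<le> (\<Sum>i<n. ennreal (1/2) * (kop N k ^^ i) (\<lambda>_. 1) x
            + ennreal c * (kop N k ^^ i) (indicator D) x)"
    proof (rule sum_mono)
      fix i
      have "(kop N k ^^ i) (kop N k (\<lambda>_. 1)) x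
          \<le> (kop N k ^^ i) (\<lambda>x. ennreal (1/2) * 1 + ennreal c * indicator D x) x"
        using x
      proof (induction i arbitrary: x)
        case (Suc i)
        then show ?case
          by (auto simp: kop_def[of N k "(kop N k ^^ i) _"] intro!: nn_integral_mono mult_left_mono)
      qed (use le in simp)
      also have "\<dots> = ennreal (1/2) * (kop N k ^^ i) (\<lambda>_. 1) x
            + ennreal c * (kop N k ^^ i) (indicator D) x"
        using x kop_funpow_cmult[of "\<lambda>_. 1" x i "ennreal (1/2)"]
          kop_funpow_cmult[of "indicator D" x i "ennreal c"]
        by (subst kop_funpow_add) (auto simp del: divide_ennreal)
      finally show "(kop N k ^^ i) (kop N k (\<lambda>_. 1)) x
          \<le> ennreal (1/2) * (kop N k ^^ i) (\<lambda>_. 1) x + ennreal c * (kop N k ^^ i) (indicator D) x" .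
    qed
    also have "\<dots> = ennreal (1/2) * (\<Sum>i<n. (kop N k ^^ i) (\<lambda>_. 1) x)
        + ennreal c * (\<Sum>i<n. (kop N k ^^ i) (indicator D) x)"
      by (simp only: sum.distrib sum_distrib_left)
    also have "\<dots> \<le> ennreal (1/2) * (\<Sum>i<n. (kop N k ^^ i) (\<lambda>_. 1) x)
        + ennreal c * pot N k (indicator D) x"
      by (intro add_left_mono mult_left_mono psum_le_pot) auto
    finally show "(\<Sum>i<n. (kop N k ^^ i) (\<lambda>_. 1) x)
        \<le> 1 + ennreal c * pot N k (indicator D) x + ennreal (1/2) * (\<Sum>i<n. (kop N k ^^ i) (\<lambda>_. 1) x)"
      by (simp add: algebra_simps)
  qed
  then show ?thesis unfolding pot_eq_SUP[of N k "\<lambda>_. 1"] by (intro SUP_least) auto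
qed

end

text \<open>The analytic data alone, without a probability space, so that the same kernels serve
  every initial law. The growth bound on \<xi> enters through
  \<open>xi_locally_bounded\<close>.\<close>

locale weighted_ar =
  fixes \<alpha> :: real and p :: "real \<Rightarrow> real" and \<xi> :: "real \<Rightarrow> real" and \<kappa> :: "real \<Rightarrow> nat" and K :: real
  assumes abs_alpha: "\<bar>\<alpha>\<bar> < 1"
    and p_pos: "\<And>y. p y > 0"
    and p_cont: "continuous_on UNIV p"
    and p_int: "(\<integral>\<^sup>+ y. ennreal (p y) \<partial>lborel) = 1"
    and xi_meas [measurable]: "\<xi> \<in> borel_measurable borel"
    and xi_nonneg: "\<And>x. \<xi> x \<ge> 0"
    and kappa_meas [measurable]: "(\<lambda>x. real (\<kappa> x)) \<in> borel_measurable borel"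
    and kappa_ge2: "\<And>x. \<kappa> x \<ge> 2"
    and kappa_le: "\<And>x. real (\<kappa> x) \<le> K"
    and xi_coercive: "filterlim \<xi> at_top at_infinity"
    and xi_zero_null: "emeasure lborel {x. \<xi> x = 0} = 0"
    and xi_locally_bounded: "\<And>R. \<exists>B. \<forall>x. \<bar>x\<bar> \<le> R \<longrightarrow> \<xi> x \<le> B"
begin

definition wt :: "real \<Rightarrow> real \<Rightarrow> ennreal" where
  "wt \<gamma> x = ennreal (real (\<kappa> x) * exp (- \<gamma> * \<xi> x))"

definition hw :: "real \<Rightarrow> real \<Rightarrow> ennreal" where
  "hw \<gamma> x = ennreal ((real (\<kappa> x) - 1) * exp (- \<gamma> * \<xi> x))"

definition Qk :: "real \<Rightarrow> real \<Rightarrow> real \<Rightarrow> ennreal" where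
  "Qk \<gamma> x y = wt \<gamma> x * ennreal (p (y - \<alpha> * x))"

definition PP :: "(real \<Rightarrow> ennreal) \<Rightarrow> real \<Rightarrow> ennreal" where
  "PP f x = (\<integral>\<^sup>+ y. ennreal (p (y - \<alpha> * x)) * f y \<partial>lborel)"

text \<open>\<open>max 0 r\<close> keeps the interval nonempty for negative \<open>r\<close>, so
  that the infimum is attained, hence positive, for every \<open>r\<close>.\<close>

definition pmin :: "real \<Rightarrow> real" where
  "pmin r = Inf (p ` {- max 0 r..max 0 r})"

text \<open>Since \<open>|\<alpha>| < 1\<close>, the argument \<open>y - \<alpha> x\<close> has
  modulus at most \<open>R + |x|\<close> when \<open>|y| <= R\<close>. So \<open>sw\<close> times
  the indicator of \<open>[-R, R]\<close> is a product lower bound of the kernel \<open>Qk\<close>,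
  and \<open>Tk\<close> is what remains after removing it.\<close>

definition sw :: "real \<Rightarrow> real \<Rightarrow> real \<Rightarrow> ennreal" where
  "sw R \<gamma> x = wt \<gamma> x * ennreal (pmin (R + \<bar>x\<bar>))"

definition Tk :: "real \<Rightarrow> real \<Rightarrow> real \<Rightarrow> real \<Rightarrow> ennreal" where
  "Tk R \<gamma> x y = wt \<gamma> x * ennreal (p (y - \<alpha> * x) - pmin (R + \<bar>x\<bar>) * indicator {-R..R} y)"

abbreviation "kopQ \<gamma> \<equiv> kop lborel (Qk \<gamma>)"
abbreviation "kopT R \<gamma> \<equiv> kop lborel (Tk R \<gamma>)"
abbreviation "potQ \<gamma> \<equiv> pot lborel (Qk \<gamma>)"
abbreviation "potT R \<gamma> \<equiv> pot lborel (Tk R \<gamma>)"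

definition mD :: "real \<Rightarrow> (real \<Rightarrow> ennreal) \<Rightarrow> ennreal" where
  "mD R f = (\<integral>\<^sup>+ y. f y * indicator {-R..R} y \<partial>lborel)"

definition potQ_bounded :: "real \<Rightarrow> bool" where
  "potQ_bounded \<gamma> \<longleftrightarrow> (\<exists>B. \<forall>x. potQ \<gamma> (\<lambda>_. 1) x \<le> ennreal B)"

section \<open>Elementary properties of the weights and kernels\<close>

lemma K_ge2: "K \<ge> 2"
  using kappa_ge2[of 0] kappa_le[of 0] by linarith

lemma kappa_ge2_real: "real (\<kappa> x) \<ge> 2"
  using kappa_ge2[of x] by linarith

lemma p_measurable [measurable]: "p \<in> borel_measurable borel"
  using p_cont by (rule borel_measurable_continuous_onI)

lemma wt_measurable [measurable]: "wt \<gamma> \<in> borel_measurable borel"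
  unfolding wt_def[abs_def] by measurable

lemma hw_measurable [measurable]: "hw \<gamma> \<in> borel_measurable borel"
  unfolding hw_def[abs_def] by measurable

lemma p_bdd_below: "bdd_below (p ` A)"
  using p_pos by (intro bdd_belowI[of _ 0]) (auto intro: less_imp_le)

lemma pmin_pos: "pmin r > 0"
proof -
  have "compact (p ` {- max 0 r..max 0 r})"
    by (intro compact_continuous_image continuous_on_subset[OF p_cont]) auto
  then have "pmin r \<in> p ` {- max 0 r..max 0 r}"
    unfolding pmin_def by (intro closed_contains_Inf compact_imp_closed p_bdd_below) auto
  then show ?thesis using p_pos by auto
qed

lemma pmin_le: "\<bar>z\<bar> \<le> r \<Longrightarrow> pmin r \<le> p z"
  unfolding pmin_def by (intro cInf_lower p_bdd_below imageI) auto

lemma pmin_antimono: "r \<le> r' \<Longrightarrow> pmin r' \<le> pmin r"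
  unfolding pmin_def by (intro cInf_superset_mono p_bdd_below image_mono) auto

lemma pmin_measurable [measurable]: "pmin \<in> borel_measurable borel"
proof -
  have "(\<lambda>x. - pmin x) \<in> borel_measurable borel"
    by (rule borel_measurable_mono) (auto simp: mono_def pmin_antimono)
  then show ?thesis by simp
qed

lemma pmin_le_density: "y \<in> {-R..R} \<Longrightarrow> pmin (R + \<bar>x\<bar>) \<le> p (y - \<alpha> * x)"
proof (rule pmin_le)
  assume "y \<in> {-R..R}"
  moreover have "\<bar>\<alpha> * x\<bar> \<le> \<bar>x\<bar>"
    using abs_alpha mult_right_mono[of "\<bar>\<alpha>\<bar>" 1 "\<bar>x\<bar>"] by (simp add: abs_mult)
  ultimately show "\<bar>y - \<alpha> * x\<bar> \<le> R + \<bar>x\<bar>" by auto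
qed

lemma sw_measurable [measurable]: "sw R \<gamma> \<in> borel_measurable borel"
  unfolding sw_def[abs_def] by measurable

lemma pos_kernel_Qk: "pos_kernel lborel (Qk \<gamma>)"
  by unfold_locales (unfold Qk_def[abs_def] wt_def, measurable)

lemma pos_kernel_Tk: "pos_kernel lborel (Tk R \<gamma>)"
  by unfold_locales (unfold Tk_def[abs_def] wt_def, measurable)

lemma kop_Qk: "f \<in> borel_measurable borel \<Longrightarrow> kopQ \<gamma> f x = wt \<gamma> x * PP f x"
  unfolding kop_def Qk_def PP_def by (simp add: mult.assoc nn_integral_cmult)

lemma PP_measurable [measurable]:
  assumes [measurable]: "f \<in> borel_measurable borel"
  shows "PP f \<in> borel_measurable borel"
  unfolding PP_def[abs_def] by measurable

lemma PP_const: "PP (\<lambda>_. c) x = c"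
proof -
  have "(\<integral>\<^sup>+ y. ennreal (p (y - \<alpha> * x)) \<partial>lborel) = (\<integral>\<^sup>+ y. ennreal (p y) \<partial>lborel)"
    by (subst nn_integral_real_affine[of "\<lambda>y. ennreal (p y)" 1 "- \<alpha> * x"]) (auto simp: algebra_simps)
  then show ?thesis unfolding PP_def by (simp add: nn_integral_multc p_int)
qed

lemma PP_mono: "(\<And>y. f y \<le> g y) \<Longrightarrow> PP f x \<le> PP g x"
  unfolding PP_def by (intro nn_integral_mono mult_left_mono) auto

lemma PP_add: "f \<in> borel_measurable borel \<Longrightarrow> g \<in> borel_measurable borel \<Longrightarrow>
    PP (\<lambda>y. f y + g y) x = PP f x + PP g x"
  unfolding PP_def by (simp add: distrib_left nn_integral_add)

lemma PP_cmult: "f \<in> borel_measurable borel \<Longrightarrow> PP (\<lambda>y. c * f y) x = c * PP f x"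
  unfolding PP_def by (subst nn_integral_cmult[symmetric]) (auto simp: mult.left_commute)

lemma mD_mono: "(\<And>y. f y \<le> g y) \<Longrightarrow> mD R f \<le> mD R g"
  unfolding mD_def by (intro nn_integral_mono mult_right_mono) auto

lemma mD_add: "f \<in> borel_measurable borel \<Longrightarrow> g \<in> borel_measurable borel \<Longrightarrow>
    mD R (\<lambda>y. f y + g y) = mD R f + mD R g"
  unfolding mD_def by (simp add: distrib_right nn_integral_add)

lemma mD_cmult: "f \<in> borel_measurable borel \<Longrightarrow> mD R (\<lambda>y. c * f y) = c * mD R f"
  unfolding mD_def by (subst nn_integral_cmult[symmetric]) (auto simp: mult.assoc)

lemma mD_const: "R \<ge> 0 \<Longrightarrow> mD R (\<lambda>_. c) = c * ennreal (2 * R)"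
  unfolding mD_def by (simp add: nn_integral_cmult_indicator)

lemma kop_decomp:
  assumes [measurable]: "f \<in> borel_measurable borel"
  shows "kopQ \<gamma> f x = kopT R \<gamma> f x + sw R \<gamma> x * mD R f"
proof -
  interpret T: pos_kernel lborel "Tk R \<gamma>" by (rule pos_kernel_Tk)
  have [measurable]: "Tk R \<gamma> x \<in> borel_measurable borel" using T.kernel_measurable_snd[of x] by simp
  have "ennreal (p (y - \<alpha> * x)) = ennreal (p (y - \<alpha> * x) - pmin (R + \<bar>x\<bar>) * indicator {-R..R} y)
      + ennreal (pmin (R + \<bar>x\<bar>)) * indicator {-R..R} y" for y
    using pmin_le_density[of y R x] pmin_pos[of "R + \<bar>x\<bar>"] less_imp_le[OF p_pos]
    by (auto simp: indicator_def ennreal_plus[symmetric] simp del: ennreal_plus)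
  then have "Qk \<gamma> x y * f y = Tk R \<gamma> x y * f y + sw R \<gamma> x * (f y * indicator {-R..R} y)" for y
    by (simp add: Qk_def Tk_def sw_def algebra_simps)
  then show ?thesis unfolding kop_def mD_def
    by (simp add: nn_integral_add nn_integral_cmult)
qed

lemma Tk_le_Qk: "Tk R \<gamma> x y \<le> Qk \<gamma> x y"
  unfolding Tk_def Qk_def using less_imp_le[OF pmin_pos[of "R + \<bar>x\<bar>"]]
  by (intro mult_left_mono ennreal_leI) (auto simp: indicator_def)

lemma wt_le: "\<gamma> \<ge> 0 \<Longrightarrow> wt \<gamma> x \<le> ennreal K"
proof -
  assume "\<gamma> \<ge> 0"
  then have "real (\<kappa> x) * exp (- \<gamma> * \<xi> x) \<le> K * 1"
    using kappa_le[of x] xi_nonneg[of x] by (intro mult_mono) auto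
  then show ?thesis unfolding wt_def by (intro ennreal_leI) auto
qed

lemma wt_antimono: "\<gamma> \<le> \<gamma>' \<Longrightarrow> wt \<gamma>' x \<le> wt \<gamma> x"
  unfolding wt_def using xi_nonneg[of x] by (intro ennreal_leI mult_left_mono) (auto simp: mult_right_mono)

lemma wt_pos: "wt \<gamma> x > 0"
  using kappa_ge2_real[of x] unfolding wt_def by simp

lemma hw_pos: "hw \<gamma> x > 0"
  using kappa_ge2_real[of x] unfolding hw_def by simp

lemma hw_antimono: "\<gamma> \<le> \<gamma>' \<Longrightarrow> hw \<gamma>' x \<le> hw \<gamma> x"
  unfolding hw_def using xi_nonneg[of x] kappa_ge2_real[of x]
  by (intro ennreal_leI mult_left_mono) (auto simp: mult_right_mono)

lemma hw_le_wt: "hw \<gamma> x \<le> wt \<gamma> x"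
  unfolding wt_def hw_def by (intro ennreal_leI mult_right_mono) auto

lemma Qk_antimono: "\<gamma> \<le> \<gamma>' \<Longrightarrow> Qk \<gamma>' x y \<le> Qk \<gamma> x y"
  unfolding Qk_def by (intro mult_right_mono wt_antimono) auto

lemma Tk_antimono: "\<gamma> \<le> \<gamma>' \<Longrightarrow> Tk R \<gamma>' x y \<le> Tk R \<gamma> x y"
  unfolding Tk_def by (intro mult_right_mono wt_antimono) auto

lemma kop_Qk_one_le: "\<gamma> \<ge> 0 \<Longrightarrow> kopQ \<gamma> (\<lambda>_. 1) x \<le> ennreal K"
  using wt_le[of \<gamma> x] by (simp add: kop_Qk PP_const)

section \<open>Consequences of coercivity, uniform in the exponent\<close>

lemma wt_tail:
  assumes "\<gamma>\<^sub>0 > 0" "e > 0"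
  obtains R where "R \<ge> 1" "\<And>\<gamma> x. \<gamma> \<ge> \<gamma>\<^sub>0 \<Longrightarrow> x \<notin> {-R..R} \<Longrightarrow> wt \<gamma> x \<le> ennreal e"
proof -
  \<comment> \<open>The level of \<xi> at which \<open>K * exp (- \<gamma>\<^sub>0 * L)\<close>
    equals \<open>e\<close>.\<close>
  define L where "L = ln (K / e) / \<gamma>\<^sub>0"
  have "eventually (\<lambda>x. \<xi> x \<ge> L) at_infinity"
    using xi_coercive by (simp add: filterlim_at_top)
  then obtain b where b: "\<And>x. \<bar>x\<bar> \<ge> b \<Longrightarrow> \<xi> x \<ge> L"
    by (auto simp: eventually_at_infinity)
  have "wt \<gamma> x \<le> ennreal e" if "\<gamma> \<ge> \<gamma>\<^sub>0" "x \<notin> {-max 1 b..max 1 b}" for \<gamma> x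
  proof -
    have "\<xi> x \<ge> L" using that by (intro b) auto
    then have "ln (K / e) \<le> \<gamma>\<^sub>0 * \<xi> x"
      using assms unfolding L_def by (simp add: pos_divide_le_eq mult.commute)
    then have "- \<gamma>\<^sub>0 * \<xi> x \<le> ln (e / K)" using K_ge2 assms by (simp add: ln_div)
    then have "exp (- \<gamma>\<^sub>0 * \<xi> x) \<le> exp (ln (e / K))" by (subst exp_le_cancel_iff)
    then have "K * exp (- \<gamma>\<^sub>0 * \<xi> x) \<le> e" using K_ge2 assms by (simp add: field_simps)
    moreover have "real (\<kappa> x) * exp (- \<gamma>\<^sub>0 * \<xi> x) \<le> K * exp (- \<gamma>\<^sub>0 * \<xi> x)"
      using kappa_le by (intro mult_right_mono) auto
    ultimately have "wt \<gamma>\<^sub>0 x \<le> ennreal e" unfolding wt_def by (intro ennreal_leI) linarith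
    then show ?thesis using wt_antimono[OF that(1)] order_trans by blast
  qed
  then show thesis by (intro that[of "max 1 b"]) auto
qed

text \<open>\<open>good_radius R \<gamma>\<^sub>0\<close>: outside \<open>[-R, R]\<close> the weights are so small that the mass of the potential
  has to sit inside.\<close>

definition good_radius :: "real \<Rightarrow> real \<Rightarrow> bool" where
  "good_radius R \<gamma>\<^sub>0 \<longleftrightarrow> R \<ge> 1 \<and> (\<forall>\<gamma>\<ge>\<gamma>\<^sub>0. \<forall>x. x \<notin> {-R..R} \<longrightarrow> wt \<gamma> x \<le> ennreal (1 / (2 * K)))"

lemma good_radius_exists: "\<gamma>\<^sub>0 > 0 \<Longrightarrow> \<exists>R. good_radius R \<gamma>\<^sub>0"
  using wt_tail[of \<gamma>\<^sub>0 "1 / (2 * K)"] K_ge2 unfolding good_radius_def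
  by (metis divide_pos_pos less_le_trans mult_pos_pos zero_less_numeral zero_less_one)

text \<open>Let \<open>F\<close> be the truncated sum, \<open>S\<close> its supremum and
  \<open>D = [-R, R]\<close>. Off \<open>D\<close> the small weight gives
  \<open>F <= q = 1 + S / (2 K)\<close>. From a point of \<open>D\<close>, one step landing in
  \<open>D\<close> contributes at most \<open>B m(F)\<close>, one landing outside at most
  \<open>q\<close>. Together \<open>S <= 1 + K (B m(F) + q)\<close>, where \<open>S\<close>
  reappears with factor \<open>K / (2 K) = 1/2\<close>: this is the origin of the threshold in
  \<open>good_radius\<close>. The constant depends neither on \<open>n\<close> nor on the
  exponent.\<close>

lemma psum_bound:
  assumes "good_radius R \<gamma>\<^sub>0" "\<gamma>\<^sub>0 > 0"
  obtains c where "c > 0" "\<And>\<gamma> n x. \<gamma> \<ge> \<gamma>\<^sub>0 \<Longrightarrow>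
    (\<Sum>i<n. (kopQ \<gamma> ^^ i) (\<lambda>_. 1) x)
      \<le> ennreal c * (1 + mD R (\<lambda>x. \<Sum>i<n. (kopQ \<gamma> ^^ i) (\<lambda>_. 1) x))"
proof -
  have R: "R \<ge> 1" and tail: "\<And>\<gamma> x. \<gamma> \<ge> \<gamma>\<^sub>0 \<Longrightarrow> x \<notin> {-R..R} \<Longrightarrow> wt \<gamma> x \<le> ennreal (1 / (2 * K))"
    using assms by (auto simp: good_radius_def)
  \<comment> \<open>For \<open>x\<close> and \<open>y\<close> in \<open>[-R, R]\<close> the argument
    \<open>y - \<alpha> x\<close> of the density stays in \<open>[-2R, 2R]\<close>.\<close>
  have "compact (p ` {-(2*R)..2*R})"
    by (intro compact_continuous_image continuous_on_subset[OF p_cont]) auto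
  then have "bdd_above (p ` {-(2*R)..2*R})"
    by (intro bounded_imp_bdd_above compact_imp_bounded)
  then obtain B where B: "\<And>z. z \<in> {-(2*R)..2*R} \<Longrightarrow> p z \<le> B"
    unfolding bdd_above_def by blast
  have "p 0 \<le> B" by (rule B) (use R in auto)
  then have B_pos: "B > 0" using p_pos[of 0] by linarith
  define c where "c = 2 * (1 + K + K * B)"
  have "(\<Sum>i<n. (kopQ \<gamma> ^^ i) (\<lambda>_. 1) x)
      \<le> ennreal c * (1 + mD R (\<lambda>x. \<Sum>i<n. (kopQ \<gamma> ^^ i) (\<lambda>_. 1) x))"
    if g: "\<gamma> \<ge> \<gamma>\<^sub>0" for \<gamma> n x
  proof -
    interpret Q: pos_kernel lborel "Qk \<gamma>" by (rule pos_kernel_Qk)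
    have g0: "\<gamma> \<ge> 0" using g assms by simp
    define F where "F x = (\<Sum>i<n. (kopQ \<gamma> ^^ i) (\<lambda>_. 1) x)" for x
    have F_meas [measurable]: "F \<in> borel_measurable borel"
      unfolding F_def[abs_def] using Q.kop_funpow_measurable[of "\<lambda>_. 1"] by simp
    define S where "S = (SUP x. F x)"
    have "S \<le> ennreal (\<Sum>i<n. K ^ i)"
      unfolding S_def F_def using Q.psum_one_finite[OF kop_Qk_one_le[OF g0]] K_ge2
      by (intro SUP_least) auto
    then have S_fin: "S \<noteq> \<top>" by (auto simp: top_unique)
    have F_le_S: "F x \<le> S" for x unfolding S_def by (rule SUP_upper) simp
    have F_le: "F x \<le> 1 + wt \<gamma> x * PP F x" for x
    proof -
      have "F x \<le> (\<Sum>i<Suc n. (kopQ \<gamma> ^^ i) (\<lambda>_. 1) x)" unfolding F_def by simp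
      also have "\<dots> = 1 + kopQ \<gamma> F x"
        unfolding F_def[abs_def] by (subst Q.psum_Suc) auto
      finally show ?thesis by (simp add: kop_Qk)
    qed
    define q where "q = 1 + ennreal (1 / (2 * K)) * S"
    have off: "F x \<le> q" if "x \<notin> {-R..R}" for x
    proof -
      have "wt \<gamma> x * PP F x \<le> ennreal (1 / (2 * K)) * PP (\<lambda>_. S) x"
        by (intro mult_mono tail g that PP_mono F_le_S) auto
      then show ?thesis using F_le[of x] by (auto simp: PP_const q_def intro: order_trans add_left_mono)
    qed
    have on: "PP F x \<le> ennreal B * mD R F + q" if "x \<in> {-R..R}" for x
    proof -
      have "ennreal (p (y - \<alpha> * x)) * F y
          \<le> ennreal B * (F y * indicator {-R..R} y) + ennreal (p (y - \<alpha> * x)) * q" for y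
      proof (cases "y \<in> {-R..R}")
        case True
        have "\<bar>\<alpha> * x\<bar> \<le> R"
          using abs_alpha mult_mono[of "\<bar>\<alpha>\<bar>" 1 "\<bar>x\<bar>" R] that by (auto simp: abs_mult)
        then have "p (y - \<alpha> * x) \<le> B" using True by (intro B) auto
        then have "ennreal (p (y - \<alpha> * x)) * F y \<le> ennreal B * F y"
          by (intro mult_right_mono ennreal_leI) auto
        then show ?thesis using True by (auto intro: order_trans)
      next
        case False
        then show ?thesis by (auto intro!: mult_left_mono off)
      qed
      then have "PP F x \<le> (\<integral>\<^sup>+ y. ennreal B * (F y * indicator {-R..R} y)
          + ennreal (p (y - \<alpha> * x)) * q \<partial>lborel)"
        unfolding PP_def by (intro nn_integral_mono)
      also have "\<dots> = ennreal B * mD R F + PP (\<lambda>_. q) x"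
        unfolding mD_def PP_def by (simp add: nn_integral_add nn_integral_cmult)
      finally show ?thesis by (simp add: PP_const)
    qed
    have K1: "1 \<le> ennreal K" using K_ge2 by (simp add: ennreal_ge_1)
    have "F x \<le> 1 + ennreal K * (ennreal B * mD R F + q)" for x
    proof (cases "x \<in> {-R..R}")
      case True
      have "wt \<gamma> x * PP F x \<le> ennreal K * (ennreal B * mD R F + q)"
        by (intro mult_mono wt_le g0 on True) auto
      then show ?thesis using F_le[of x] by (auto intro: order_trans add_left_mono)
    next
      case False
      have "F x \<le> 1 * q" using off[OF False] by simp
      also have "\<dots> \<le> ennreal K * (ennreal B * mD R F + q)"
        by (intro mult_mono K1) auto
      finally show ?thesis by (simp add: add_increasing)
    qed
    then have "S \<le> 1 + ennreal K * (ennreal B * mD R F + q)"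
      unfolding S_def by (intro SUP_least)
    also have "\<dots> = (1 + ennreal K + ennreal K * ennreal B * mD R F) + (ennreal K * ennreal (1 / (2 * K))) * S"
      unfolding q_def by (simp add: algebra_simps)
    also have "ennreal K * ennreal (1 / (2 * K)) = ennreal (1/2)"
      using K_ge2 by (subst ennreal_mult[symmetric]) auto
    finally have "S \<le> 2 * (1 + ennreal K + ennreal K * ennreal B * mD R F)"
      using S_fin by (rule ennreal_absorb_half[rotated])
    also have "\<dots> \<le> 2 * ((1 + ennreal K + ennreal K * ennreal B) * (1 + mD R F))"
    proof (intro mult_left_mono)
      have "(1 + ennreal K + ennreal K * ennreal B) * (1 + mD R F)
        = (1 + ennreal K + ennreal K * ennreal B * mD R F) + (ennreal K * ennreal B + (1 + ennreal K) * mD R F)"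
        by (simp add: algebra_simps)
      then show "1 + ennreal K + ennreal K * ennreal B * mD R F
          \<le> (1 + ennreal K + ennreal K * ennreal B) * (1 + mD R F)" by simp
    qed simp
    also have "\<dots> = ennreal c * (1 + mD R F)"
    proof -
      have "ennreal c = 2 * (1 + ennreal K + ennreal K * ennreal B)"
        using K_ge2 B_pos unfolding c_def by (simp add: ennreal_mult')
      then show ?thesis by (simp only: mult.assoc)
    qed
    finally show ?thesis using F_le_S[of x] unfolding F_def by (rule order_trans[rotated])
  qed
  moreover have "c > 0" using K_ge2 B_pos unfolding c_def by (simp add: add_pos_pos)
  ultimately show thesis using that by blast
qed

lemma pot_Qk_one_bound:
  assumes "good_radius R \<gamma>\<^sub>0" "\<gamma>\<^sub>0 > 0"
  obtains c where "c > 0" "\<And>\<gamma> x. \<gamma> \<ge> \<gamma>\<^sub>0 \<Longrightarrow>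
    potQ \<gamma> (\<lambda>_. 1) x \<le> ennreal c * (1 + mD R (potQ \<gamma> (\<lambda>_. 1)))"
proof -
  obtain c where "c > 0" and c: "\<And>\<gamma> n x. \<gamma> \<ge> \<gamma>\<^sub>0 \<Longrightarrow>
    (\<Sum>i<n. (kopQ \<gamma> ^^ i) (\<lambda>_. 1) x)
      \<le> ennreal c * (1 + mD R (\<lambda>x. \<Sum>i<n. (kopQ \<gamma> ^^ i) (\<lambda>_. 1) x))"
    using psum_bound[OF assms] by blast
  have "(\<Sum>i<n. (kopQ \<gamma> ^^ i) (\<lambda>_. 1) x)
      \<le> ennreal c * (1 + mD R (potQ \<gamma> (\<lambda>_. 1)))" if "\<gamma> \<ge> \<gamma>\<^sub>0" for \<gamma> n x
    by (rule order_trans[OF c[OF that]]) (intro mult_left_mono add_left_mono mD_mono psum_le_pot; simp)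
  then have "potQ \<gamma> (\<lambda>_. 1) x
      \<le> ennreal c * (1 + mD R (potQ \<gamma> (\<lambda>_. 1)))" if "\<gamma> \<ge> \<gamma>\<^sub>0" for \<gamma> x
    unfolding pot_eq_SUP[of _ _ _ x] using that by (intro SUP_least) auto
  with \<open>c > 0\<close> show thesis using that by blast
qed

text \<open>Stated for any kernel below \<open>Qk\<close>, so that it serves both \<open>Qk\<close>
  and the residual kernel \<open>Tk\<close>. The drift bound holds because the total mass from
  \<open>x\<close> is at most \<open>wt \<gamma> x\<close>, which is at most \<open>K\<close> on the
  interval and at most \<open>1/2\<close> outside.\<close>

lemma pot_one_le_pot_indicator:
  assumes R: "good_radius R \<gamma>\<^sub>0" "\<gamma>\<^sub>0 > 0" and g: "\<gamma> \<ge> \<gamma>\<^sub>0"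
    and k: "pos_kernel lborel k" and le: "\<And>x y. k x y \<le> Qk \<gamma> x y"
  shows "pot lborel k (\<lambda>_. 1) x \<le> 2 * (1 + ennreal K * pot lborel k (indicator {-R..R}) x)"
proof (rule pos_kernel.pot_one_le_pot_indicator[OF k])
  show "kop lborel k (\<lambda>_. 1) x \<le> ennreal (1/2) + ennreal K * indicator {-R..R} x" for x
  proof -
    have "kop lborel k (\<lambda>_. 1) x \<le> wt \<gamma> x"
      using kop_mono[of k "Qk \<gamma>" "\<lambda>_. 1" "\<lambda>_. 1" lborel x] le by (simp add: kop_Qk PP_const)
    also have "\<dots> \<le> ennreal (1/2) + ennreal K * indicator {-R..R} x"
    proof (cases "x \<in> {-R..R}")
      case True
      then show ?thesis using wt_le[of \<gamma> x] R g by (auto intro: add_increasing)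
    next
      case False
      then have "wt \<gamma> x \<le> ennreal (1 / (2 * K))" using R g unfolding good_radius_def by blast
      also have "\<dots> \<le> ennreal (1/2)" using K_ge2 by (intro ennreal_leI) (simp add: field_simps)
      finally show ?thesis using False by simp
    qed
    finally show ?thesis .
  qed
qed (use K_ge2 in auto)

section \<open>Independence of the initial law\<close>

lemma exp_xi_locally_bounded_below:
  assumes "\<gamma> \<ge> 0"
  obtains l where "l > 0" "\<And>x. x \<in> {-R..R} \<Longrightarrow> l \<le> exp (- \<gamma> * \<xi> x)"
proof -
  obtain B where B: "\<And>x. \<bar>x\<bar> \<le> R \<Longrightarrow> \<xi> x \<le> B" using xi_locally_bounded[of R] by blast
  show thesis
    by (rule that[of "exp (- \<gamma> * B)"]) (use B assms in \<open>auto intro: mult_left_mono\<close>)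
qed

lemma exp_le_hw: "ennreal (exp (- \<gamma> * \<xi> x)) \<le> hw \<gamma> x"
  using kappa_ge2_real[of x] unfolding hw_def by (intro ennreal_leI) (simp add: mult_le_cancel_right1)

lemma exp_le_wt: "ennreal (exp (- \<gamma> * \<xi> x)) \<le> wt \<gamma> x"
  using exp_le_hw hw_le_wt order_trans by blast

lemma sw_pos: "sw R \<gamma> x > 0"
  unfolding sw_def using wt_pos pmin_pos by (simp add: ennreal_zero_less_mult_iff)

text \<open>The right-hand side does not mention \<open>\<mu>\<close>, whence one critical exponent
  for all initial laws. If the mean is finite, so is the mean of the potential \<open>F\<close> of
  1, because \<open>hw\<close> is bounded below on the interval. One step from \<open>\<mu>\<close>
  dominates a positive multiple of \<open>m\<close>, so \<open>m(F)\<close> is finite, and then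
  \<open>F\<close> is bounded by \<open>pot_Qk_one_bound\<close>.\<close>

lemma mean_pot_finite_iff:
  assumes "prob_space \<mu>" and sets_mu [measurable_cong]: "sets \<mu> = sets borel" and g: "\<gamma> > 0"
  shows "(\<integral>\<^sup>+ x. potQ \<gamma> (hw \<gamma>) x \<partial>\<mu>) < \<top> \<longleftrightarrow> potQ_bounded \<gamma>"
proof
  interpret mu: prob_space \<mu> by fact
  interpret Q: pos_kernel lborel "Qk \<gamma>" by (rule pos_kernel_Qk)
  have [measurable]: "potQ \<gamma> f \<in> borel_measurable borel" if "f \<in> borel_measurable borel" for f
    using Q.pot_measurable[of f] that by simp
  {
    assume "potQ_bounded \<gamma>"
    then obtain B where B: "\<And>x. potQ \<gamma> (\<lambda>_. 1) x \<le> ennreal B"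
      by (auto simp: potQ_bounded_def)
    have "potQ \<gamma> (hw \<gamma>) x \<le> ennreal K * ennreal B" for x
    proof -
      have "potQ \<gamma> (hw \<gamma>) x \<le> potQ \<gamma> (\<lambda>_. ennreal K * 1) x"
        using g by (intro pot_mono) (auto intro: order_trans[OF hw_le_wt wt_le])
      also have "\<dots> \<le> ennreal K * ennreal B"
        by (subst Q.pot_cmult) (auto intro!: mult_left_mono B)
      finally show ?thesis .
    qed
    then have "(\<integral>\<^sup>+ x. potQ \<gamma> (hw \<gamma>) x \<partial>\<mu>) \<le> (\<integral>\<^sup>+ x. ennreal K * ennreal B \<partial>\<mu>)"
      by (intro nn_integral_mono)
    also have "\<dots> < \<top>" by (simp add: mu.emeasure_space_1 ennreal_mult_less_top)
    finally show "(\<integral>\<^sup>+ x. potQ \<gamma> (hw \<gamma>) x \<partial>\<mu>) < \<top>" .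
  next
    assume fin: "(\<integral>\<^sup>+ x. potQ \<gamma> (hw \<gamma>) x \<partial>\<mu>) < \<top>"
    obtain R where R: "good_radius R \<gamma>" using good_radius_exists[OF g] by blast
    obtain l where l: "l > 0" "\<And>x. x \<in> {-R..R} \<Longrightarrow> l \<le> exp (- \<gamma> * \<xi> x)"
      using exp_xi_locally_bounded_below[of \<gamma> R] g by auto
    have "indicator {-R..R} x \<le> ennreal (1 / l) * hw \<gamma> x" for x
    proof (cases "x \<in> {-R..R}")
      case True
      have "1 = ennreal (1 / l) * ennreal l" using l(1) by (simp flip: ennreal_mult)
      also have "\<dots> \<le> ennreal (1 / l) * hw \<gamma> x"
        using l(2)[OF True] by (intro mult_left_mono order_trans[OF ennreal_leI exp_le_hw]) auto
      finally show ?thesis using True by simp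
    qed simp
    then have "potQ \<gamma> (indicator {-R..R}) x \<le> ennreal (1 / l) * potQ \<gamma> (hw \<gamma>) x" for x
      by (subst Q.pot_cmult[symmetric]) (auto intro!: pot_mono)
    then have "2 * (1 + ennreal K * potQ \<gamma> (indicator {-R..R}) x)
        \<le> 2 * (1 + ennreal K * (ennreal (1 / l) * potQ \<gamma> (hw \<gamma>) x))" for x
      by (intro mult_left_mono add_left_mono) auto
    then have pot1: "potQ \<gamma> (\<lambda>_. 1) x
        \<le> 2 * (1 + ennreal K * (ennreal (1 / l) * potQ \<gamma> (hw \<gamma>) x))" for x
      using pot_one_le_pot_indicator[OF R g order_refl pos_kernel_Qk order_refl] order_trans by blast
    define F where "F = potQ \<gamma> (\<lambda>_. 1)"
    have [measurable]: "F \<in> borel_measurable borel" unfolding F_def by simp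
    have "(\<integral>\<^sup>+ x. sw R \<gamma> x \<partial>\<mu>) * mD R F = (\<integral>\<^sup>+ x. sw R \<gamma> x * mD R F \<partial>\<mu>)"
      by (simp add: nn_integral_multc)
    also have "\<dots> \<le> (\<integral>\<^sup>+ x. F x \<partial>\<mu>)"
    proof (rule nn_integral_mono)
      show "sw R \<gamma> x * mD R F \<le> F x" for x
        using Q.pot_eq[of "\<lambda>_. 1" x] kop_decomp[of F \<gamma> x R] unfolding F_def[symmetric] by simp
    qed
    also have "\<dots> \<le> (\<integral>\<^sup>+ x. 2 * (1 + ennreal K * (ennreal (1 / l) * potQ \<gamma> (hw \<gamma>) x)) \<partial>\<mu>)"
      unfolding F_def by (intro nn_integral_mono pot1)
    also have "\<dots> = 2 * (1 + ennreal K * (ennreal (1 / l) * (\<integral>\<^sup>+ x. potQ \<gamma> (hw \<gamma>) x \<partial>\<mu>)))"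
      by (simp add: nn_integral_cmult nn_integral_add mu.emeasure_space_1)
    also have "\<dots> < \<top>" using fin by (simp add: ennreal_mult_less_top)
    finally have "(\<integral>\<^sup>+ x. sw R \<gamma> x \<partial>\<mu>) * mD R F < \<top>" .
    moreover have "(\<integral>\<^sup>+ x. sw R \<gamma> x \<partial>\<mu>) > 0"
      by (rule nn_integral_pos) (auto simp: sw_pos mu.emeasure_space_1)
    ultimately have mF: "mD R F < \<top>" by (auto simp: ennreal_mult_less_top)
    obtain c where "\<And>\<gamma>' x. \<gamma>' \<ge> \<gamma> \<Longrightarrow>
      potQ \<gamma>' (\<lambda>_. 1) x \<le> ennreal c * (1 + mD R (potQ \<gamma>' (\<lambda>_. 1)))"
      using pot_Qk_one_bound[OF R g] by blast
    then have "F x \<le> ennreal c * (1 + mD R F)" for x unfolding F_def by auto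
    moreover obtain B where "ennreal c * (1 + mD R F) = ennreal B"
      using mF by (cases "ennreal c * (1 + mD R F)") (auto simp: ennreal_mult_eq_top_iff)
    ultimately show "potQ_bounded \<gamma>" unfolding potQ_bounded_def F_def by auto
  }
qed

section \<open>The critical exponent is finite, positive and not attained\<close>

lemma potQ_bounded_mono: "potQ_bounded \<gamma> \<Longrightarrow> \<gamma> \<le> \<gamma>' \<Longrightarrow> potQ_bounded \<gamma>'"
  unfolding potQ_bounded_def
  using pot_mono[of "Qk \<gamma>'" "Qk \<gamma>" "\<lambda>_. 1" "\<lambda>_. 1"] Qk_antimono by (meson order_refl order_trans)

text \<open>Where \<xi> is positive the weight decays exponentially, but on
  \<open>{\<xi> = 0}\<close> it keeps the value \<kappa> for every exponent; dominated convergence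
  works because that set is null.\<close>

lemma mD_wt_tendsto_0:
  assumes "R \<ge> 0"
  shows "(\<lambda>n. mD R (wt (real n))) \<longlonglongrightarrow> 0"
proof -
  have "(\<lambda>n. \<integral>\<^sup>+ y. wt (real n) y * indicator {-R..R} y \<partial>lborel) \<longlonglongrightarrow> (\<integral>\<^sup>+ y. 0 \<partial>(lborel :: real measure))"
  proof (rule nn_integral_dominated_convergence[where w="\<lambda>y. ennreal K * indicator {-R..R} y"])
    show "(\<integral>\<^sup>+ y. ennreal K * indicator {-R..R} y \<partial>lborel) < \<infinity>"
      using assms by (simp add: nn_integral_cmult_indicator ennreal_mult_less_top)
    show "AE y in lborel. wt (real n) y * indicator {-R..R} y \<le> ennreal K * indicator {-R..R} y" for n
      by (auto intro!: mult_right_mono wt_le)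
    have "AE y in lborel. \<xi> y \<noteq> 0"
      using xi_zero_null by (intro AE_I[of _ _ "{x. \<xi> x = 0}"]) auto
    then show "AE y in lborel. (\<lambda>n. wt (real n) y * indicator {-R..R} y) \<longlonglongrightarrow> 0"
    proof eventually_elim
      case (elim y)
      then have "\<xi> y > 0" using xi_nonneg[of y] by simp
      then have "(\<lambda>n. real (\<kappa> y) * exp (- (real n) * \<xi> y)) \<longlonglongrightarrow> real (\<kappa> y) * 0"
        by (intro tendsto_mult tendsto_const) real_asymp
      then have "(\<lambda>n. wt (real n) y) \<longlonglongrightarrow> ennreal 0"
        unfolding wt_def by (intro tendsto_ennrealI) simp
      then show ?case by (auto simp: indicator_def)
    qed
  qed auto
  then show ?thesis by (simp add: mD_def)
qed

text \<open>Integrating \<open>F <= 1 + S wt\<close> over the interval gives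
  \<open>m(F) <= 2 R + S m(wt)\<close>. Inserted into the bound \<open>S <= c (1 + m(F))\<close> of
  \<open>psum_bound\<close>, whose \<open>c\<close> is the same for all exponents above 1, this
  allows absorption once \<open>m(wt) <= 1 / (2 c)\<close>, which holds for a large
  exponent.\<close>

lemma potQ_bounded_exists: "\<exists>\<gamma>>0. potQ_bounded \<gamma>"
proof -
  obtain R where R: "good_radius R 1" using good_radius_exists[of 1] by auto
  then have R1: "R \<ge> 1" by (simp add: good_radius_def)
  obtain c where "c > 0" and c: "\<And>\<gamma> n x. \<gamma> \<ge> 1 \<Longrightarrow>
    (\<Sum>i<n. (kopQ \<gamma> ^^ i) (\<lambda>_. 1) x)
      \<le> ennreal c * (1 + mD R (\<lambda>x. \<Sum>i<n. (kopQ \<gamma> ^^ i) (\<lambda>_. 1) x))"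
    using psum_bound[OF R] by auto
  have "eventually (\<lambda>n. mD R (wt (real n)) < ennreal (1 / (2 * c))) sequentially"
    using mD_wt_tendsto_0[of R] R1 \<open>c > 0\<close> by (intro order_tendstoD) auto
  then have "eventually (\<lambda>n. mD R (wt (real n)) < ennreal (1 / (2 * c)) \<and> n \<ge> 1) sequentially"
    using eventually_ge_at_top eventually_conj by blast
  then obtain n0 where n0: "mD R (wt (real n0)) < ennreal (1 / (2 * c))" "n0 \<ge> 1"
    using eventually_happens by fastforce
  define \<gamma> where "\<gamma> = real n0"
  have g: "\<gamma> \<ge> 1" "mD R (wt \<gamma>) \<le> ennreal (1 / (2 * c))" using n0 by (auto simp: \<gamma>_def)
  interpret Q: pos_kernel lborel "Qk \<gamma>" by (rule pos_kernel_Qk)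
  have "(\<Sum>i<n. (kopQ \<gamma> ^^ i) (\<lambda>_. 1) x) \<le> 2 * (ennreal c * (1 + ennreal (2 * R)))" for n x
  proof -
    define F where "F x = (\<Sum>i<n. (kopQ \<gamma> ^^ i) (\<lambda>_. 1) x)" for x
    have [measurable]: "F \<in> borel_measurable borel"
      unfolding F_def[abs_def] using Q.kop_funpow_measurable[of "\<lambda>_. 1"] by simp
    define S where "S = (SUP x. F x)"
    have "S \<le> ennreal (\<Sum>i<n. K ^ i)"
      unfolding S_def F_def using Q.psum_one_finite[OF kop_Qk_one_le] g K_ge2
      by (intro SUP_least) auto
    then have S_fin: "S \<noteq> \<top>" by (auto simp: top_unique)
    have F_le_S: "F x \<le> S" for x unfolding S_def by (rule SUP_upper) simp
    have "F x \<le> 1 + wt \<gamma> x * S" for x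
    proof -
      have "F x \<le> (\<Sum>i<Suc n. (kopQ \<gamma> ^^ i) (\<lambda>_. 1) x)" unfolding F_def by simp
      also have "\<dots> = 1 + kopQ \<gamma> F x"
        unfolding F_def[abs_def] by (subst Q.psum_Suc) auto
      also have "\<dots> \<le> 1 + wt \<gamma> x * PP (\<lambda>_. S) x"
        by (simp add: kop_Qk) (intro mult_left_mono PP_mono F_le_S; simp)
      finally show ?thesis by (simp add: PP_const)
    qed
    then have "mD R F \<le> mD R (\<lambda>x. 1 + S * wt \<gamma> x)"
      by (intro mD_mono) (simp add: mult.commute)
    also have "\<dots> = ennreal (2 * R) + S * mD R (wt \<gamma>)"
      using R1 by (simp add: mD_add mD_cmult mD_const)
    also have "\<dots> \<le> ennreal (2 * R) + S * ennreal (1 / (2 * c))"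
      by (intro add_left_mono mult_left_mono g) simp
    finally have mF: "mD R F \<le> ennreal (2 * R) + S * ennreal (1 / (2 * c))" .
    have "F x \<le> ennreal c * (1 + mD R F)" for x
      using c[OF g(1), where n=n and x=x] unfolding F_def .
    then have "S \<le> ennreal c * (1 + mD R F)" unfolding S_def by (intro SUP_least)
    also have "\<dots> \<le> ennreal c * (1 + (ennreal (2 * R) + S * ennreal (1 / (2 * c))))"
      by (intro mult_left_mono add_left_mono mF) simp
    also have "\<dots> = ennreal c * (1 + ennreal (2 * R)) + (ennreal c * ennreal (1 / (2 * c))) * S"
      by (simp add: algebra_simps)
    also have "ennreal c * ennreal (1 / (2 * c)) = ennreal (1/2)"
      using \<open>c > 0\<close> by (subst ennreal_mult[symmetric]) auto
    finally have "S \<le> 2 * (ennreal c * (1 + ennreal (2 * R)))"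
      using S_fin by (rule ennreal_absorb_half[rotated])
    then show ?thesis using F_le_S[of x] unfolding F_def by (rule order_trans[rotated])
  qed
  then have "potQ \<gamma> (\<lambda>_. 1) x \<le> 2 * (ennreal c * (1 + ennreal (2 * R)))" for x
    unfolding pot_eq_SUP by (intro SUP_least)
  also have "2 * (ennreal c * (1 + ennreal (2 * R))) = ennreal (2 * (c * (1 + 2 * R)))"
    using \<open>c > 0\<close> R1 by (simp add: ennreal_mult)
  finally show ?thesis using g(1) unfolding potQ_bounded_def by (intro exI[of _ \<gamma>]) auto
qed

text \<open>For a small exponent the population grows on a fixed interval around 0: the chain stays
  there with probability at least \<open>3/4\<close> and the weight there is at least
  \<open>3/2\<close>. Since \<open>3/2 * 3/4 >= 1\<close>, the indicator of the interval lies below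
  its image under \<open>Q\<close>, so every term of the series at 0 is at least 1.\<close>

lemma potQ_unbounded_exists: "\<exists>\<gamma>>0. \<not> potQ_bounded \<gamma>"
proof -
  define A where "A n = {- real n..real n}" for n
  have UN: "(\<Union>n. A n) = UNIV"
  proof -
    have "\<exists>n. x \<in> A n" for x :: real
    proof -
      obtain n where "\<bar>x\<bar> \<le> real n" using real_arch_simple by blast
      then have "x \<in> A n" by (auto simp: A_def)
      then show ?thesis by blast
    qed
    then show ?thesis by auto
  qed
  have "(\<lambda>n. emeasure (density lborel (\<lambda>y. ennreal (p y))) (A n))
      \<longlonglongrightarrow> emeasure (density lborel (\<lambda>y. ennreal (p y))) (\<Union>n. A n)"
    by (rule Lim_emeasure_incseq) (auto simp: A_def incseq_def)
  also have "emeasure (density lborel (\<lambda>y. ennreal (p y))) (\<Union>n. A n) = 1"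
    unfolding UN by (simp add: emeasure_density p_int)
  finally have "eventually (\<lambda>n. emeasure (density lborel (\<lambda>y. ennreal (p y))) (A n) > ennreal (3/4)) sequentially"
    by (intro order_tendstoD) auto
  then obtain n where n: "emeasure (density lborel (\<lambda>y. ennreal (p y))) (A n) > ennreal (3/4)"
    using eventually_happens by force
  \<comment> \<open>Solves \<open>n + |\<alpha>| r = r\<close>: noise of size at most
    \<open>n\<close> cannot push the chain out of \<open>[-r, r]\<close>.\<close>
  define r where "r = real n / (1 - \<bar>\<alpha>\<bar>)"
  have r0: "r \<ge> 0" unfolding r_def using abs_alpha by simp
  have PE: "PP (indicator {-r..r}) x \<ge> ennreal (3/4)" if "x \<in> {-r..r}" for x
  proof -
    have "ennreal (3/4) \<le> (\<integral>\<^sup>+ y. ennreal (p y) * indicator (A n) y \<partial>lborel)"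
      using n by (simp add: emeasure_density A_def)
    also have "\<dots> = (\<integral>\<^sup>+ y. ennreal (p (y - \<alpha> * x)) * indicator (A n) (y - \<alpha> * x) \<partial>lborel)"
      by (subst nn_integral_real_affine[of _ 1 "- \<alpha> * x"]) (auto simp: algebra_simps A_def)
    also have "\<dots> \<le> PP (indicator {-r..r}) x"
      unfolding PP_def
    proof (intro nn_integral_mono mult_left_mono)
      fix y
      have "\<bar>\<alpha> * x\<bar> \<le> \<bar>\<alpha>\<bar> * r" using that by (auto simp: abs_mult intro!: mult_left_mono)
      moreover have "real n + \<bar>\<alpha>\<bar> * r = r" unfolding r_def using abs_alpha by (simp add: field_simps)
      ultimately show "indicator (A n) (y - \<alpha> * x) \<le> (indicator {-r..r} y :: ennreal)"
        by (auto simp: indicator_def A_def abs_le_iff)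
    qed simp
    finally show ?thesis .
  qed
  obtain B where B: "\<And>x. \<bar>x\<bar> \<le> r \<Longrightarrow> \<xi> x \<le> B" using xi_locally_bounded[of r] by blast
  \<comment> \<open>Small enough for \<open>exp (- \<gamma> * \<xi> x) >= 3/4\<close> on
    \<open>[-r, r]\<close>; the \<open>+ 1\<close> keeps the denominator positive.\<close>
  define \<gamma> where "\<gamma> = ln (4/3) / (\<bar>B\<bar> + 1)"
  have g0: "\<gamma> > 0" unfolding \<gamma>_def by (intro divide_pos_pos) auto
  have wE: "wt \<gamma> x \<ge> ennreal (3/2)" if "x \<in> {-r..r}" for x
  proof -
    have "\<xi> x \<le> \<bar>B\<bar> + 1" using B[of x] that abs_ge_self[of B] by (simp add: abs_le_iff)
    then have "\<gamma> * \<xi> x \<le> ln (4/3)"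
      unfolding \<gamma>_def using mult_left_mono[of "\<xi> x" "\<bar>B\<bar> + 1" "ln (4/3)"] by (simp add: field_simps)
    then have "- \<gamma> * \<xi> x \<ge> ln (3/4)" by (simp add: ln_div)
    then have "exp (- \<gamma> * \<xi> x) \<ge> exp (ln (3/4))" by (subst exp_le_cancel_iff)
    then have "2 * (3/4) \<le> real (\<kappa> x) * exp (- \<gamma> * \<xi> x)"
      using kappa_ge2_real[of x] by (intro mult_mono) auto
    then show ?thesis unfolding wt_def by (intro ennreal_leI) auto
  qed
  interpret Q: pos_kernel lborel "Qk \<gamma>" by (rule pos_kernel_Qk)
  have step: "indicator {-r..r} x \<le> kopQ \<gamma> (indicator {-r..r}) x" for x
  proof (cases "x \<in> {-r..r}")
    case True
    have "(1::ennreal) = ennreal 1" by simp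
    also have "\<dots> \<le> ennreal (3/2 * (3/4))" by (intro ennreal_leI) simp
    also have "\<dots> = ennreal (3/2) * ennreal (3/4)" by (subst ennreal_mult) auto
    also have "\<dots> \<le> wt \<gamma> x * PP (indicator {-r..r}) x"
      by (intro mult_mono wE PE True) auto
    finally show ?thesis using True by (simp add: kop_Qk)
  qed simp
  have ge: "indicator {-r..r} x \<le> (kopQ \<gamma> ^^ i) (indicator {-r..r}) x" for i x
  proof (induction i arbitrary: x)
    case (Suc i)
    have "indicator {-r..r} x \<le> kopQ \<gamma> (indicator {-r..r}) x" by (rule step)
    also have "\<dots> \<le> kopQ \<gamma> ((kopQ \<gamma> ^^ i) (indicator {-r..r})) x"
      by (rule kop_mono) (auto intro: Suc.IH)
    finally show ?case by simp
  qed simp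
  have "of_nat m \<le> potQ \<gamma> (\<lambda>_. 1) 0" for m
  proof -
    have "(\<Sum>i<m. 1) \<le> (\<Sum>i<m. (kopQ \<gamma> ^^ i) (indicator {-r..r}) 0)"
      using ge[of 0] r0 by (intro sum_mono) simp
    also have "\<dots> \<le> potQ \<gamma> (indicator {-r..r}) 0" by (rule psum_le_pot)
    also have "\<dots> \<le> potQ \<gamma> (\<lambda>_. 1) 0" by (rule pot_mono) (auto simp: indicator_def)
    finally show ?thesis by simp
  qed
  then have "potQ \<gamma> (\<lambda>_. 1) 0 = \<top>"
    using ennreal_SUP_of_nat_eq_top by (metis SUP_least top_unique)
  then have "\<not> potQ_bounded \<gamma>" unfolding potQ_bounded_def by (metis ennreal_neq_top top_unique)
  with g0 show ?thesis by blast
qed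

text \<open>With \<open>u = \<xi> x\<close>, the inequality \<open>1 - exp (- z) <= z\<close> bounds
  the difference of the exponentials by \<open>(\<gamma> - \<gamma>') u exp (- \<gamma>' u)\<close>,
  and \<open>u exp (- \<gamma>' u) <= 1 / \<gamma>'\<close> for all \<open>u >= 0\<close>. So the
  bound is uniform in \<open>x\<close> although \<xi> is unbounded.\<close>

lemma wt_lipschitz:
  assumes "0 < \<gamma>'" "\<gamma>' \<le> \<gamma>"
  shows "wt \<gamma>' x \<le> wt \<gamma> x + ennreal (K * ((\<gamma> - \<gamma>') / \<gamma>'))"
proof -
  define u where "u = \<xi> x"
  have u: "u \<ge> 0" using xi_nonneg by (simp add: u_def)
  have "exp (- \<gamma>' * u) - exp (- \<gamma> * u) = exp (- \<gamma>' * u) * (1 - exp (- ((\<gamma> - \<gamma>') * u)))"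
    by (simp add: algebra_simps exp_add[symmetric])
  also have "\<dots> \<le> exp (- \<gamma>' * u) * ((\<gamma> - \<gamma>') * u)"
    using exp_ge_add_one_self[of "- ((\<gamma> - \<gamma>') * u)"] by (intro mult_left_mono) auto
  also have "\<dots> = (\<gamma> - \<gamma>') * (u * exp (- \<gamma>' * u))" by simp
  also have "\<dots> \<le> (\<gamma> - \<gamma>') * (1 / \<gamma>')"
  proof (intro mult_left_mono)
    have "\<gamma>' * u \<le> exp (\<gamma>' * u)" using exp_ge_add_one_self[of "\<gamma>' * u"] by linarith
    then show "u * exp (- \<gamma>' * u) \<le> 1 / \<gamma>'"
      using assms by (simp add: exp_minus field_simps)
  qed (use assms in auto)
  finally have *: "exp (- \<gamma>' * u) - exp (- \<gamma> * u) \<le> (\<gamma> - \<gamma>') / \<gamma>'" by simp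
  have "real (\<kappa> x) * (exp (- \<gamma>' * u) - exp (- \<gamma> * u)) \<le> K * ((\<gamma> - \<gamma>') / \<gamma>')"
    using * kappa_le[of x] K_ge2 assms u by (intro mult_mono) (auto simp: mult_right_mono)
  then have "real (\<kappa> x) * exp (- \<gamma>' * u) \<le> real (\<kappa> x) * exp (- \<gamma> * u) + K * ((\<gamma> - \<gamma>') / \<gamma>')"
    by (simp add: algebra_simps)
  then have "wt \<gamma>' x \<le> ennreal (real (\<kappa> x) * exp (- \<gamma> * u) + K * ((\<gamma> - \<gamma>') / \<gamma>'))"
    unfolding wt_def u_def[symmetric] by (rule ennreal_leI)
  also have "\<dots> = wt \<gamma> x + ennreal (K * ((\<gamma> - \<gamma>') / \<gamma>'))"
    unfolding wt_def u_def[symmetric] using K_ge2 assms by (intro ennreal_plus) auto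
  finally show ?thesis .
qed

text \<open>Lowering the exponent slightly costs at most half of the slack 1, so \<open>V\<close>
  remains a supersolution, now for the constant \<open>1/2\<close>. A supersolution is assumed
  rather than a bounded potential because the lemma is also used at \<open>nu\<close>, with a
  \<open>V\<close> built from the residual kernel.\<close>

lemma potQ_bounded_left:
  assumes [measurable]: "V \<in> borel_measurable borel"
    and V: "\<And>x. 1 + kopQ \<gamma> V x \<le> V x" and B: "\<And>x. V x \<le> ennreal B" and g: "\<gamma> > 0"
  shows "\<exists>\<gamma>'>0. \<gamma>' < \<gamma> \<and> potQ_bounded \<gamma>'"
proof -
  have "1 \<le> V 0" using V[of 0] by (auto intro: order_trans[rotated])
  then have "1 \<le> ennreal B" using B[of 0] by (rule order_trans)
  then have B1: "B \<ge> 1" by simp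
  \<comment> \<open>chosen such that \<open>K * B * (\<gamma> - \<gamma>') / \<gamma>' = 1/2\<close>\<close>
  define \<gamma>' where "\<gamma>' = \<gamma> / (1 + 1 / (2 * K * B))"
  have KB: "K * B > 0" using K_ge2 B1 by simp
  have g': "\<gamma>' > 0" "\<gamma>' < \<gamma>" unfolding \<gamma>'_def using g KB by (auto simp: field_simps add_pos_pos)
  have "\<gamma> = \<gamma>' * (1 + 1 / (2 * K * B))"
  proof -
    have "0 < 1 / (2 * (K * B))" using KB by simp
    then have "1 + 1 / (2 * K * B) \<noteq> 0" unfolding mult.assoc by linarith
    moreover have "\<gamma> = \<gamma> / d * d" if "d \<noteq> 0" for d using that by simp
    ultimately show ?thesis unfolding \<gamma>'_def by blast
  qed
  then have eq: "K * ((\<gamma> - \<gamma>') / \<gamma>') * B = 1/2"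
    using g' K_ge2 B1 by (simp add: field_simps)
  interpret Q: pos_kernel lborel "Qk \<gamma>'" by (rule pos_kernel_Qk)
  have "ennreal (1/2) + kopQ \<gamma>' V x \<le> V x" for x
  proof -
    have "PP V x \<le> ennreal B" using PP_mono[OF B] by (simp add: PP_const)
    then have "wt \<gamma> x * PP V x + ennreal (K * ((\<gamma> - \<gamma>') / \<gamma>')) * PP V x
        \<le> wt \<gamma> x * PP V x + ennreal (K * ((\<gamma> - \<gamma>') / \<gamma>')) * ennreal B"
      by (intro add_left_mono mult_left_mono) auto
    moreover have "kopQ \<gamma>' V x \<le> (wt \<gamma> x + ennreal (K * ((\<gamma> - \<gamma>') / \<gamma>'))) * PP V x"
      unfolding kop_Qk[OF assms(1)] using g' by (intro mult_right_mono wt_lipschitz) auto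
    ultimately have "kopQ \<gamma>' V x
        \<le> wt \<gamma> x * PP V x + ennreal (K * ((\<gamma> - \<gamma>') / \<gamma>')) * ennreal B"
      unfolding distrib_right by (rule order_trans[rotated])
    also have "ennreal (K * ((\<gamma> - \<gamma>') / \<gamma>')) * ennreal B = ennreal (1/2)"
      using g' K_ge2 B1 by (subst ennreal_mult[symmetric]) (simp_all only: eq, auto)
    finally have "ennreal (1/2) + kopQ \<gamma>' V x
        \<le> ennreal (1/2) + (kopQ \<gamma> V x + ennreal (1/2))"
      unfolding kop_Qk[OF assms(1), of \<gamma>] by (intro add_left_mono)
    also have "\<dots> = (ennreal (1/2) + ennreal (1/2)) + kopQ \<gamma> V x" by (simp only: add_ac)
    also have "ennreal (1/2) + ennreal (1/2) = 1" by (subst ennreal_plus[symmetric]) auto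
    finally show ?thesis using V[of x] by simp
  qed
  then have "potQ \<gamma>' (\<lambda>_. ennreal (1/2) * 1) x \<le> V x" for x
    by (intro Q.pot_le_supersolution) auto
  then have *: "ennreal (1/2) * potQ \<gamma>' (\<lambda>_. 1) x \<le> ennreal B" for x
    using B[of x] by (subst Q.pot_cmult[symmetric]) (auto intro: order_trans)
  have "potQ \<gamma>' (\<lambda>_. 1) x \<le> ennreal (2 * B)" for x
  proof -
    have "potQ \<gamma>' (\<lambda>_. 1) x = (ennreal 2 * ennreal (1/2)) * potQ \<gamma>' (\<lambda>_. 1) x"
      by (subst ennreal_mult[symmetric]) auto
    also have "\<dots> \<le> ennreal 2 * ennreal B" unfolding mult.assoc by (intro mult_left_mono *) auto
    finally show ?thesis using B1 by (simp add: ennreal_mult)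
  qed
  then have "potQ_bounded \<gamma>'" unfolding potQ_bounded_def by blast
  with g' show ?thesis by blast
qed

text \<open>Defined through the kernels alone; \<open>nu_rate_eq\<close> identifies it with the rate
  of every model that has these data.\<close>

definition nu :: real where
  "nu = Inf {\<gamma>. \<gamma> > 0 \<and> potQ_bounded \<gamma>}"

lemma nu_pos: "nu > 0"
proof -
  obtain \<gamma> where \<gamma>: "\<gamma> > 0" "\<not> potQ_bounded \<gamma>" using potQ_unbounded_exists by blast
  have "\<gamma> \<le> nu" unfolding nu_def using potQ_bounded_exists \<gamma> potQ_bounded_mono
    by (intro cInf_greatest) (auto intro: linear[THEN disjE])
  with \<gamma> show ?thesis by simp
qed

lemma potQ_bounded_imp_left:
  assumes "\<gamma> > 0" "potQ_bounded \<gamma>"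
  shows "\<exists>\<gamma>'>0. \<gamma>' < \<gamma> \<and> potQ_bounded \<gamma>'"
proof -
  interpret Q: pos_kernel lborel "Qk \<gamma>" by (rule pos_kernel_Qk)
  obtain B where B: "\<And>x. potQ \<gamma> (\<lambda>_. 1) x \<le> ennreal B"
    using assms(2) by (auto simp: potQ_bounded_def)
  show ?thesis
  proof (rule potQ_bounded_left[OF _ _ B assms(1)])
    show "potQ \<gamma> (\<lambda>_. 1) \<in> borel_measurable borel"
      using Q.pot_measurable[of "\<lambda>_. 1"] by simp
    show "1 + kopQ \<gamma> (potQ \<gamma> (\<lambda>_. 1)) x \<le> potQ \<gamma> (\<lambda>_. 1) x" for x
      using Q.pot_eq[of "\<lambda>_. 1" x] by simp
  qed
qed

text \<open>The set of exponents with bounded potential is closed upwards and, by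
  \<open>potQ_bounded_imp_left\<close>, has no least element. It is therefore the open ray above
  \<open>nu\<close>; its failure at \<open>nu\<close> itself is what produces a pole there.\<close>

lemma potQ_bounded_iff:
  assumes "\<gamma> > 0"
  shows "potQ_bounded \<gamma> \<longleftrightarrow> \<gamma> > nu"
proof
  have bdd: "bdd_below {\<gamma>. \<gamma> > 0 \<and> potQ_bounded \<gamma>}" by (intro bdd_belowI[of _ 0]) auto
  {
    assume "potQ_bounded \<gamma>"
    then obtain \<gamma>' where "\<gamma>' > 0" "\<gamma>' < \<gamma>" "potQ_bounded \<gamma>'"
      using potQ_bounded_imp_left[OF assms] by blast
    then have "nu \<le> \<gamma>'" unfolding nu_def by (intro cInf_lower bdd) auto
    then show "\<gamma> > nu" using \<open>\<gamma>' < \<gamma>\<close> by simp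
  next
    assume "\<gamma> > nu"
    then obtain \<gamma>' where "\<gamma>' < \<gamma>" "potQ_bounded \<gamma>'"
      unfolding nu_def using potQ_bounded_exists by (subst (asm) cInf_less_iff[OF _ bdd]) auto
    then show "potQ_bounded \<gamma>" using potQ_bounded_mono by simp
  }
qed

end

section \<open>The rank one splitting at the critical exponent\<close>

context weighted_ar
begin

lemma pot_Tk_measurable [measurable]:
  "f \<in> borel_measurable borel \<Longrightarrow> potT R \<gamma> f \<in> borel_measurable borel"
  using pos_kernel.pot_measurable[OF pos_kernel_Tk, of f R \<gamma>] by simp

lemma pot_Qk_measurable [measurable]:
  "f \<in> borel_measurable borel \<Longrightarrow> potQ \<gamma> f \<in> borel_measurable borel"
  using pos_kernel.pot_measurable[OF pos_kernel_Qk, of f \<gamma>] by simp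

text \<open>With \<open>F\<close> the potential of \<open>1\<close>, the equation \<open>F = 1 + T F + m(F) s\<close> makes \<open>F\<close> a
  supersolution for \<open>m(F) s\<close>; the estimate is uniform because \<open>F \<le> c (1 + m(F))\<close>.\<close>

lemma pot_Tk_sw_le:
  assumes "good_radius R nu"
  obtains c where "c > 0" "\<And>\<gamma> x. \<gamma> > nu \<Longrightarrow> potT R \<gamma> (sw R \<gamma>) x \<le> ennreal c \<and>
    mD R (potT R \<gamma> (sw R \<gamma>)) \<le> 1"
proof -
  have R1: "R \<ge> 1" using assms by (simp add: good_radius_def)
  obtain c where "c > 0" and c: "\<And>\<gamma> x. \<gamma> \<ge> nu \<Longrightarrow>
    potQ \<gamma> (\<lambda>_. 1) x \<le> ennreal c * (1 + mD R (potQ \<gamma> (\<lambda>_. 1)))"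
    using pot_Qk_one_bound[OF assms nu_pos] by blast
  have main: "potT R \<gamma> (sw R \<gamma>) x \<le> ennreal (2 * c)"
    "mD R (potT R \<gamma> (sw R \<gamma>)) \<le> 1" if g: "\<gamma> > nu" for \<gamma> x
  proof -
    interpret Q: pos_kernel lborel "Qk \<gamma>" by (rule pos_kernel_Qk)
    interpret T: pos_kernel lborel "Tk R \<gamma>" by (rule pos_kernel_Tk)
    define F where "F = potQ \<gamma> (\<lambda>_. 1)"
    have [measurable]: "F \<in> borel_measurable borel" unfolding F_def by measurable
    have "potQ_bounded \<gamma>" using potQ_bounded_iff g nu_pos by simp
    then obtain B where B: "\<And>x. F x \<le> ennreal B" unfolding F_def by (auto simp: potQ_bounded_def)
    have "mD R F \<le> mD R (\<lambda>_. ennreal B)" by (rule mD_mono) (rule B)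
    also have "\<dots> < \<top>" using R1 by (simp add: mD_const ennreal_mult_less_top)
    finally have fin: "mD R F \<noteq> \<top>" by simp
    \<comment> \<open>This is where \<open>R >= 1\<close> matters: \<open>m(F) >= 1\<close> turns
      \<open>1 + m(F)\<close> into at most \<open>2 m(F)\<close> and, with finiteness, permits
      cancelling \<open>m(F)\<close>.\<close>
    have "1 \<le> ennreal (2 * R)" using R1 by (simp add: ennreal_ge_1)
    also have "\<dots> = mD R (\<lambda>_. 1)" using R1 by (simp add: mD_const)
    also have "\<dots> \<le> mD R F" unfolding F_def by (intro mD_mono le_pot[of "\<lambda>_. 1", simplified])
    finally have ge1: "1 \<le> mD R F" .
    have F_eq: "F x = 1 + (kopT R \<gamma> F x + sw R \<gamma> x * mD R F)" for x
      using Q.pot_eq[of "\<lambda>_. 1" x] kop_decomp[of F \<gamma> x R] unfolding F_def[symmetric] by simp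
    have le: "mD R F * potT R \<gamma> (sw R \<gamma>) x \<le> F x" for x
    proof (subst T.pot_cmult[symmetric])
      show "potT R \<gamma> (\<lambda>x. mD R F * sw R \<gamma> x) x \<le> F x"
      proof (rule T.pot_le_supersolution)
        show "mD R F * sw R \<gamma> x + kopT R \<gamma> F x \<le> F x" for x
          by (subst F_eq) (simp add: ac_simps add_increasing)
      qed auto
    qed auto
    have "mD R F * potT R \<gamma> (sw R \<gamma>) x \<le> ennreal c * (1 + mD R F)"
      using le[of x] c[of \<gamma> x] g unfolding F_def by (auto intro: order_trans)
    also have "\<dots> \<le> ennreal c * (mD R F + mD R F)"
      by (intro mult_left_mono add_right_mono ge1) simp
    also have "\<dots> = mD R F * ennreal (2 * c)"
      using \<open>c > 0\<close> by (simp add: ennreal_mult ac_simps flip: mult_2)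
    finally show "potT R \<gamma> (sw R \<gamma>) x \<le> ennreal (2 * c)"
      using ge1 fin by (subst (asm) ennreal_mult_le_mult_iff) auto
    have "mD R F * mD R (potT R \<gamma> (sw R \<gamma>)) = mD R (\<lambda>x. mD R F * potT R \<gamma> (sw R \<gamma>) x)"
      by (simp add: mD_cmult)
    also have "\<dots> \<le> mD R F * 1" using mD_mono[OF le] by simp
    finally show "mD R (potT R \<gamma> (sw R \<gamma>)) \<le> 1"
      using ge1 fin by (subst (asm) ennreal_mult_le_mult_iff) auto
  qed
  show thesis by (rule that[of "2 * c"]) (use main \<open>c > 0\<close> in auto)
qed

section \<open>Monotone limits along decreasing exponents\<close>

lemma wt_SUP:
  assumes "decseq g" "g \<longlonglongrightarrow> \<gamma>"
  shows "(SUP n. wt (g n) x) = wt \<gamma> x" "incseq (\<lambda>n. wt (g n) x)"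
proof -
  show "incseq (\<lambda>n. wt (g n) x)" using assms(1) by (auto simp: incseq_def decseq_def intro: wt_antimono)
  moreover have "(\<lambda>n. wt (g n) x) \<longlonglongrightarrow> wt \<gamma> x"
    unfolding wt_def using assms(2) by (intro tendsto_intros)
  ultimately show "(SUP n. wt (g n) x) = wt \<gamma> x" by (rule incseq_SUP_eqI)
qed

lemma hw_SUP:
  assumes "decseq g" "g \<longlonglongrightarrow> \<gamma>"
  shows "(SUP n. hw (g n) x) = hw \<gamma> x" "incseq (\<lambda>n. hw (g n) x)"
proof -
  show "incseq (\<lambda>n. hw (g n) x)" using assms(1) by (auto simp: incseq_def decseq_def intro: hw_antimono)
  moreover have "(\<lambda>n. hw (g n) x) \<longlonglongrightarrow> hw \<gamma> x"
    unfolding hw_def using assms(2) by (intro tendsto_intros)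
  ultimately show "(SUP n. hw (g n) x) = hw \<gamma> x" by (rule incseq_SUP_eqI)
qed

lemma sw_SUP:
  assumes "decseq g" "g \<longlonglongrightarrow> \<gamma>"
  shows "(SUP n. sw R (g n) x) = sw R \<gamma> x" "incseq (\<lambda>n. sw R (g n) x)"
  using wt_SUP[OF assms, of x] unfolding sw_def
  by (auto simp: SUP_mult_right_ennreal[symmetric] incseq_def intro: mult_right_mono)

lemma Tk_SUP:
  assumes "decseq g" "g \<longlonglongrightarrow> \<gamma>"
  shows "(SUP n. Tk R (g n) x y) = Tk R \<gamma> x y" "incseq (\<lambda>n. Tk R (g n) x y)"
  using wt_SUP[OF assms, of x] unfolding Tk_def
  by (auto simp: SUP_mult_right_ennreal[symmetric] incseq_def intro: mult_right_mono)

lemma pot_Tk_SUP: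
  assumes g: "decseq g" "g \<longlonglongrightarrow> \<gamma>" and "\<And>n. f n \<in> borel_measurable borel"
    and "\<And>x. incseq (\<lambda>n. f n x)" "\<And>x. f' x = (SUP n. f n x)"
  shows "potT R \<gamma> f' x = (SUP n. potT R (g n) (f n) x)"
    "incseq (\<lambda>n. potT R (g n) (f n) x)"
  using assms(3-) Tk_SUP[OF g]
  by (auto intro!: pot_monotone_convergence incseq_pot pos_kernel_Tk)

lemma mD_SUP:
  assumes "\<And>n. f n \<in> borel_measurable borel" "\<And>x. incseq (\<lambda>n. f n x)" "\<And>x. f' x = (SUP n. f n x)"
  shows "mD R f' = (SUP n. mD R (f n))" "incseq (\<lambda>n. mD R (f n))"
proof -
  show "incseq (\<lambda>n. mD R (f n))" using assms(2) by (auto simp: incseq_def intro: mD_mono)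
  have "mD R f' = (\<integral>\<^sup>+ y. (SUP n. f n y * indicator {-R..R} y) \<partial>lborel)"
    unfolding mD_def assms(3) by (simp add: SUP_mult_right_ennreal)
  also have "\<dots> = (SUP n. mD R (f n))"
    unfolding mD_def using assms(1,2)
    by (intro nn_integral_monotone_convergence_SUP) (auto simp: incseq_def le_fun_def intro: mult_right_mono)
  finally show "mD R f' = (SUP n. mD R (f n))" .
qed

lemma PP_SUP:
  assumes "\<And>n. f n \<in> borel_measurable borel" "\<And>x. incseq (\<lambda>n. f n x)" "\<And>x. f' x = (SUP n. f n x)"
  shows "PP f' x = (SUP n. PP (f n) x)" "incseq (\<lambda>n. PP (f n) x)"
proof -
  show "incseq (\<lambda>n. PP (f n) x)" using assms(2) by (auto simp: incseq_def intro: PP_mono)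
  have "PP f' x = (\<integral>\<^sup>+ y. (SUP n. ennreal (p (y - \<alpha> * x)) * f n y) \<partial>lborel)"
    unfolding PP_def assms(3) by (simp add: SUP_mult_left_ennreal)
  also have "\<dots> = (SUP n. PP (f n) x)"
    unfolding PP_def using assms(1,2)
    by (intro nn_integral_monotone_convergence_SUP) (auto simp: incseq_def le_fun_def intro: mult_left_mono)
  finally show "PP f' x = (SUP n. PP (f n) x)" .
qed

definition nu_seq :: "nat \<Rightarrow> real" where "nu_seq n = nu + 1 / real (Suc n)"

lemma nu_seq: "decseq nu_seq" "nu_seq \<longlonglongrightarrow> nu" "nu_seq n > nu" "nu_seq n \<le> nu + 1"
proof -
  show "decseq nu_seq" unfolding nu_seq_def by (auto simp: decseq_def intro!: divide_left_mono)
  have "(\<lambda>n. nu + 1 / real (Suc n)) \<longlonglongrightarrow> nu + 0" by (intro tendsto_intros LIMSEQ_Suc lim_1_over_n)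
  then show "nu_seq \<longlonglongrightarrow> nu" unfolding nu_seq_def[abs_def] by simp
qed (auto simp: nu_seq_def)

text \<open>On the interval \<open>sw\<close> is bounded below uniformly for exponents up to
  \<open>nu + 1\<close>, so the known bound on the potential of \<open>sw\<close> controls that of
  the indicator, and then that of 1. The bound passes to \<open>nu\<close> as a supremum and to
  larger exponents by monotonicity.\<close>

lemma pot_Tk_one_le:
  assumes "good_radius R nu"
  shows "\<exists>M. \<forall>\<gamma>\<ge>nu. \<forall>x. potT R \<gamma> (\<lambda>_. 1) x \<le> ennreal M"
proof -
  have R1: "R \<ge> 1" using assms by (simp add: good_radius_def)
  obtain c where "c > 0" and c: "\<And>\<gamma> x. \<gamma> > nu \<Longrightarrow> potT R \<gamma> (sw R \<gamma>) x \<le> ennreal c \<and>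
      mD R (potT R \<gamma> (sw R \<gamma>)) \<le> 1"
    using pot_Tk_sw_le[OF assms] by blast
  obtain l0 where l0: "l0 > 0" "\<And>x. x \<in> {-R..R} \<Longrightarrow> l0 \<le> exp (- (nu + 1) * \<xi> x)"
    using exp_xi_locally_bounded_below[of "nu + 1" R] nu_pos by auto
  \<comment> \<open>A lower bound of \<open>sw\<close> on \<open>[-R, R]\<close>: there
    \<open>wt\<close> is at least \<open>l0\<close>, and \<open>R + |x| <= 2 R\<close>.\<close>
  define l where "l = l0 * pmin (2 * R)"
  have l: "l > 0" unfolding l_def using l0 pmin_pos by simp
  define M where "M = 2 * (1 + K * (c / l))"
  have *: "potT R \<gamma> (\<lambda>_. 1) x \<le> ennreal M" if g: "\<gamma> > nu" "\<gamma> \<le> nu + 1" for \<gamma> x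
  proof -
    interpret T: pos_kernel lborel "Tk R \<gamma>" by (rule pos_kernel_Tk)
    have "indicator {-R..R} x \<le> ennreal (1 / l) * sw R \<gamma> x" for x
    proof (cases "x \<in> {-R..R}")
      case True
      have "ennreal l = ennreal l0 * ennreal (pmin (2 * R))"
        unfolding l_def using l0 by (intro ennreal_mult less_imp_le pmin_pos) auto
      also have "\<dots> \<le> wt (nu + 1) x * ennreal (pmin (R + \<bar>x\<bar>))"
        using True l0 by (intro mult_mono ennreal_leI pmin_antimono order_trans[OF ennreal_leI exp_le_wt]) auto
      also have "\<dots> \<le> sw R \<gamma> x" unfolding sw_def using g by (intro mult_right_mono wt_antimono) auto
      finally have "ennreal (1 / l) * ennreal l \<le> ennreal (1 / l) * sw R \<gamma> x" by (intro mult_left_mono) auto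
      moreover have "ennreal (1 / l) * ennreal l = 1" using l by (simp flip: ennreal_mult)
      ultimately show ?thesis using True by simp
    qed simp
    then have "potT R \<gamma> (indicator {-R..R}) x \<le> ennreal (1 / l) * potT R \<gamma> (sw R \<gamma>) x"
      by (subst T.pot_cmult[symmetric]) (auto intro!: pot_mono)
    also have "\<dots> \<le> ennreal (1 / l) * ennreal c" using c[OF g(1), THEN conjunct1] by (intro mult_left_mono) auto
    also have "\<dots> = ennreal (c / l)" using l \<open>c > 0\<close> by (subst ennreal_mult[symmetric]) auto
    finally have le: "potT R \<gamma> (indicator {-R..R}) x \<le> ennreal (c / l)" .
    have "potT R \<gamma> (\<lambda>_. 1) x \<le> 2 * (1 + ennreal K * potT R \<gamma> (indicator {-R..R}) x)"
      using pot_one_le_pot_indicator[OF assms nu_pos less_imp_le[OF g(1)] pos_kernel_Tk Tk_le_Qk] .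
    also have "\<dots> \<le> 2 * (1 + ennreal K * ennreal (c / l))"
      by (intro mult_left_mono add_left_mono le) auto
    also have "\<dots> = ennreal M"
    proof -
      have "ennreal K * ennreal q = ennreal (K * q)" "0 \<le> K * q" if "q \<ge> 0" for q
        using K_ge2 that by (simp_all add: ennreal_mult)
      from this[of "c / l"] show ?thesis
        unfolding M_def using l \<open>c > 0\<close> by (simp add: ennreal_mult' del: times_divide_eq_right)
    qed
    finally show ?thesis .
  qed
  have nu: "potT R nu (\<lambda>_. 1) x \<le> ennreal M" for x
    by (subst pot_Tk_SUP(1)[OF nu_seq(1,2), of "\<lambda>_ _. 1"]) (auto intro!: SUP_least * nu_seq)
  have "potT R \<gamma> (\<lambda>_. 1) x \<le> ennreal M" if "\<gamma> \<ge> nu" for \<gamma> x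
    using pot_mono[of "Tk R \<gamma>" "Tk R nu" "\<lambda>_. 1" "\<lambda>_. 1" lborel x] Tk_antimono[OF that] nu[of x] order_trans by auto
  then show ?thesis by blast
qed

lemma pot_Tk_le:
  assumes "\<And>x. potT R \<gamma> (\<lambda>_. 1) x \<le> ennreal M" "\<And>x. f x \<le> c"
  shows "potT R \<gamma> f x \<le> c * ennreal M"
proof -
  interpret T: pos_kernel lborel "Tk R \<gamma>" by (rule pos_kernel_Tk)
  have "potT R \<gamma> f x \<le> potT R \<gamma> (\<lambda>_. c * 1) x"
    by (rule pot_mono) (auto simp: assms)
  also have "\<dots> = c * potT R \<gamma> (\<lambda>_. 1) x" by (subst T.pot_cmult) auto
  also have "\<dots> \<le> c * ennreal M" by (intro mult_left_mono assms) auto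
  finally show ?thesis .
qed

lemma sw_le: "\<gamma> \<ge> 0 \<Longrightarrow> sw R \<gamma> x \<le> ennreal (K * p 0)" if "R \<ge> 0"
proof -
  assume g: "\<gamma> \<ge> 0"
  have "sw R \<gamma> x \<le> ennreal K * ennreal (p 0)"
    unfolding sw_def using that by (intro mult_mono wt_le g ennreal_leI pmin_le) auto
  then show ?thesis using K_ge2 less_imp_le[OF p_pos[of 0]] by (simp add: ennreal_mult)
qed

text \<open>If the value were below \<open>1\<close>, a suitable combination of the two potentials would be a
  bounded supersolution for \<open>Q\<close> at \<open>nu\<close>, contradicting that \<open>Q\<close> is unbounded there.\<close>

lemma mD_pot_Tk_sw_nu:
  assumes R: "good_radius R nu"
  shows "mD R (potT R nu (sw R nu)) = 1"
proof (rule antisym)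
  have R1: "R \<ge> 1" using R by (simp add: good_radius_def)
  have le1: "\<gamma> > nu \<Longrightarrow> mD R (potT R \<gamma> (sw R \<gamma>)) \<le> 1" for \<gamma>
    by (rule pot_Tk_sw_le[OF R]) blast
  have "mD R (potT R nu (sw R nu)) = (SUP n. mD R (potT R (nu_seq n) (sw R (nu_seq n))))"
    using pot_Tk_SUP[OF nu_seq(1,2), of "\<lambda>n. sw R (nu_seq n)" "sw R nu" R]
      sw_SUP[OF nu_seq(1,2), of R] by (intro mD_SUP(1)) auto
  also have "\<dots> \<le> 1" by (intro SUP_least le1 nu_seq)
  finally show le: "mD R (potT R nu (sw R nu)) \<le> 1" .
  show "1 \<le> mD R (potT R nu (sw R nu))"
  proof (rule ccontr)
    assume less: "\<not> ?thesis"
    interpret T: pos_kernel lborel "Tk R nu" by (rule pos_kernel_Tk)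
    obtain M where M: "\<And>x. potT R nu (\<lambda>_. 1) x \<le> ennreal M"
      using pot_Tk_one_le[OF R] by auto
    define u1 where "u1 = potT R nu (\<lambda>_. 1)"
    define us where "us = potT R nu (sw R nu)"
    have [measurable]: "u1 \<in> borel_measurable borel" "us \<in> borel_measurable borel"
      unfolding u1_def us_def by measurable
    have us_le: "us x \<le> ennreal (K * p 0) * ennreal M" for x
      unfolding us_def by (intro pot_Tk_le M sw_le) (use R1 nu_pos in auto)
    obtain \<phi> where phi: "mD R us = ennreal \<phi>" "0 \<le> \<phi>" "\<phi> < 1"
      using less unfolding us_def by (cases "mD R (potT R nu (sw R nu))") (auto simp: not_le)
    have "mD R u1 \<le> mD R (\<lambda>_. ennreal M)" unfolding u1_def by (intro mD_mono M)
    also have "\<dots> < \<top>" using R1 by (simp add: mD_const ennreal_mult_less_top)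
    finally obtain a where a: "mD R u1 = ennreal a" "a \<ge> 0" by (cases "mD R u1") auto
    \<comment> \<open>The fixed point of \<open>b = a + b \<phi>\<close>, positive because
      \<open>\<phi> < 1\<close> whenever \<open>a\<close> is. It gives
      \<open>m(V) = \<beta>\<close>, so the rank one part of \<open>Q V\<close> is exactly
      \<open>\<beta>\<close> times \<open>sw\<close>, as the equation \<open>V = 1 + Q V\<close>
      requires.\<close>
    define \<beta> where "\<beta> = a / (1 - \<phi>)"
    have beta: "\<beta> \<ge> 0" "a + \<beta> * \<phi> = \<beta>" unfolding \<beta>_def using a phi by (auto simp: field_simps)
    define V where "V x = u1 x + ennreal \<beta> * us x" for x
    have [measurable]: "V \<in> borel_measurable borel" unfolding V_def[abs_def] by measurable
    have mV: "mD R V = ennreal \<beta>"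
    proof -
      have "mD R V = ennreal a + ennreal \<beta> * ennreal \<phi>"
        unfolding V_def[abs_def] by (simp add: mD_add mD_cmult a phi)
      also have "\<dots> = ennreal (a + \<beta> * \<phi>)" using a phi beta(1) by (simp add: ennreal_mult)
      finally show ?thesis using beta by simp
    qed
    have V: "1 + kopQ nu V x \<le> V x" for x
    proof -
      have "kopT R nu V x = kopT R nu u1 x + ennreal \<beta> * kopT R nu us x"
        unfolding V_def[abs_def] by (simp add: T.kop_add T.kop_cmult)
      then have "1 + kopQ nu V x
          = (1 + kopT R nu u1 x) + ennreal \<beta> * (sw R nu x + kopT R nu us x)"
        by (simp add: kop_decomp[of V nu x R] mV algebra_simps)
      also have "\<dots> = V x"
        unfolding V_def u1_def us_def using T.pot_eq[of "\<lambda>_. 1" x] T.pot_eq[of "sw R nu" x] by simp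
      finally show ?thesis by simp
    qed
    have "V x \<le> ennreal M + ennreal \<beta> * (ennreal (K * p 0) * ennreal M)" for x
      unfolding V_def by (intro add_mono mult_left_mono us_le) (auto simp: u1_def M)
    moreover obtain B where "ennreal M + ennreal \<beta> * (ennreal (K * p 0) * ennreal M) = ennreal B"
      by (cases "ennreal M + ennreal \<beta> * (ennreal (K * p 0) * ennreal M)") (auto simp: ennreal_mult_eq_top_iff)
    ultimately have "\<exists>\<gamma>'>0. \<gamma>' < nu \<and> potQ_bounded \<gamma>'"
      using potQ_bounded_left[OF _ V _ nu_pos, of B] by simp
    then show False using potQ_bounded_iff by fastforce
  qed
qed

end

section \<open>The simple pole\<close>

text \<open>Convexity of \<open>exp\<close> on the segment from \<open>- b * u\<close> to 0. It
  makes the difference quotients of the weights increase as the exponent decreases to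
  \<open>nu\<close>, so monotone convergence applies to them as well.\<close>

lemma exp_diff_quotient_antimono:
  fixes u a b :: real
  assumes "0 < a" "a \<le> b" "0 \<le> u"
  shows "(1 - exp (- b * u)) / b \<le> (1 - exp (- a * u)) / a"
proof -
  have b: "b > 0" using assms by simp
  have "exp ((1 - a / b) * 0 + (a / b) * (- b * u)) \<le> (1 - a / b) * exp 0 + (a / b) * exp (- b * u)"
    using convex_onD[OF exp_convex, of "a / b" 0 "- b * u"] assms by simp
  then have "exp (- a * u) \<le> 1 - a / b + (a / b) * exp (- b * u)" using b by simp
  then have "b * exp (- a * u) \<le> b * (1 - a / b + (a / b) * exp (- b * u))"
    using b by (intro mult_left_mono) auto
  also have "\<dots> = b - a + a * exp (- b * u)" using b by (simp add: distrib_left right_diff_distrib)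
  finally have "a * (1 - exp (- b * u)) \<le> b * (1 - exp (- a * u))" by (simp add: algebra_simps)
  then show ?thesis using assms b by (simp add: field_simps)
qed

lemma exp_diff_quotient_tendsto:
  fixes u :: real
  assumes "a \<longlonglongrightarrow> 0" "\<And>n. a n > 0"
  shows "(\<lambda>n. (1 - exp (- a n * u)) / a n) \<longlonglongrightarrow> u"
proof -
  have "((\<lambda>h. (1 - exp (- h * u)) / h) \<longlongrightarrow> u) (at_right 0)" by real_asymp
  moreover have "filterlim a (at_right 0) sequentially"
    using assms(1) less_imp_neq[OF assms(2), symmetric] assms(2)
    by (auto simp: filterlim_at intro!: always_eventually)
  ultimately show ?thesis by (rule filterlim_compose)
qed

context weighted_ar
begin

text \<open>The quotient of \<open>wt nu x - wt \<gamma> x\<close> by \<open>\<gamma> - nu\<close>,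
  with the subtraction carried out in the reals. \<open>dq0\<close> is minus the derivative of the
  weight in the exponent at \<open>nu\<close>.\<close>

definition dq :: "real \<Rightarrow> real \<Rightarrow> ennreal" where
  "dq \<gamma> x = ennreal (real (\<kappa> x) * exp (- nu * \<xi> x) * ((1 - exp (- (\<gamma> - nu) * \<xi> x)) / (\<gamma> - nu)))"

definition dq0 :: "real \<Rightarrow> ennreal" where
  "dq0 x = ennreal (real (\<kappa> x) * exp (- nu * \<xi> x) * \<xi> x)"

lemma dq_measurable [measurable]: "dq \<gamma> \<in> borel_measurable borel" "dq0 \<in> borel_measurable borel"
  unfolding dq_def[abs_def] dq0_def[abs_def] by measurable

lemma wt_nu_eq:
  assumes "\<gamma> > nu"
  shows "wt nu x = wt \<gamma> x + ennreal (\<gamma> - nu) * dq \<gamma> x"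
proof -
  define e where "e = exp (- nu * \<xi> x)"
  define d where "d = exp (- (\<gamma> - nu) * \<xi> x)"
  have "d \<le> 1" unfolding d_def using assms xi_nonneg[of x] by (simp add: mult_nonpos_nonneg)
  have ed: "exp (- \<gamma> * \<xi> x) = e * d" unfolding e_def d_def by (simp add: exp_add[symmetric] algebra_simps)
  have "ennreal (\<gamma> - nu) * dq \<gamma> x = ennreal ((\<gamma> - nu) * (real (\<kappa> x) * e * ((1 - d) / (\<gamma> - nu))))"
    unfolding dq_def e_def[symmetric] d_def[symmetric] using assms \<open>d \<le> 1\<close>
    by (intro ennreal_mult'[symmetric]) simp
  also have "(\<gamma> - nu) * (real (\<kappa> x) * e * ((1 - d) / (\<gamma> - nu))) = real (\<kappa> x) * e * (1 - d)"
    using assms by simp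
  finally have "wt \<gamma> x + ennreal (\<gamma> - nu) * dq \<gamma> x = ennreal (real (\<kappa> x) * (e * d) + real (\<kappa> x) * e * (1 - d))"
    unfolding wt_def ed using \<open>d \<le> 1\<close> by (subst ennreal_plus) (auto simp: e_def d_def)
  also have "real (\<kappa> x) * (e * d) + real (\<kappa> x) * e * (1 - d) = real (\<kappa> x) * e" by (simp add: algebra_simps)
  finally show ?thesis by (simp add: wt_def e_def)
qed

lemma dq_le:
  assumes "\<gamma> > nu"
  shows "dq \<gamma> x \<le> ennreal (K / nu)"
proof -
  have "wt \<gamma> x + ennreal (\<gamma> - nu) * dq \<gamma> x \<le> wt \<gamma> x + ennreal (K * ((\<gamma> - nu) / nu))"
    using wt_lipschitz[OF nu_pos, of \<gamma> x] wt_nu_eq[OF assms, of x] assms by simp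
  then have "ennreal (\<gamma> - nu) * dq \<gamma> x \<le> ennreal (K * ((\<gamma> - nu) / nu))"
    by (simp add: wt_def)
  also have "\<dots> = ennreal (\<gamma> - nu) * ennreal (K / nu)"
    using assms K_ge2 nu_pos by (simp add: ennreal_mult[symmetric] mult.commute)
  finally show ?thesis using assms by (simp add: ennreal_mult_le_mult_iff)
qed

lemma dq_SUP:
  assumes g: "decseq g" "g \<longlonglongrightarrow> nu" "\<And>n. g n > nu"
  shows "(SUP n. dq (g n) x) = dq0 x" "incseq (\<lambda>n. dq (g n) x)"
proof -
  show "incseq (\<lambda>n. dq (g n) x)"
    unfolding incseq_def dq_def
    by (intro allI impI ennreal_leI mult_left_mono exp_diff_quotient_antimono)
      (use g(1,3) xi_nonneg in \<open>auto simp: decseq_def\<close>)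
  moreover have "(\<lambda>n. (1 - exp (- (g n - nu) * \<xi> x)) / (g n - nu)) \<longlonglongrightarrow> \<xi> x"
    using g by (intro exp_diff_quotient_tendsto) (auto simp: LIM_zero)
  then have "(\<lambda>n. dq (g n) x) \<longlonglongrightarrow> dq0 x"
    unfolding dq_def dq0_def by (intro tendsto_ennrealI tendsto_mult tendsto_const)
  ultimately show "(SUP n. dq (g n) x) = dq0 x" by (rule incseq_SUP_eqI)
qed

text \<open>The left eigenmeasure of \<open>Q\<close> at \<open>nu\<close>.\<close>

definition sigma :: "real \<Rightarrow> (real \<Rightarrow> ennreal) \<Rightarrow> ennreal" where
  "sigma R f = mD R (potT R nu f)"

lemma sigma_mono: "(\<And>x. f x \<le> g x) \<Longrightarrow> sigma R f \<le> sigma R g"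
  unfolding sigma_def by (intro mD_mono pot_mono) auto

lemma sigma_add: "f \<in> borel_measurable borel \<Longrightarrow> g \<in> borel_measurable borel \<Longrightarrow>
    sigma R (\<lambda>x. f x + g x) = sigma R f + sigma R g"
proof -
  assume [measurable]: "f \<in> borel_measurable borel" "g \<in> borel_measurable borel"
  have "potT R nu (\<lambda>x. f x + g x) = (\<lambda>x. potT R nu f x + potT R nu g x)"
    by (rule ext, rule pos_kernel.pot_add[OF pos_kernel_Tk]) simp_all
  then show ?thesis unfolding sigma_def by (simp add: mD_add)
qed

lemma sigma_cmult: "f \<in> borel_measurable borel \<Longrightarrow> sigma R (\<lambda>x. c * f x) = c * sigma R f"
proof -
  assume [measurable]: "f \<in> borel_measurable borel"
  have "potT R nu (\<lambda>x. c * f x) = (\<lambda>x. c * potT R nu f x)"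
    by (rule ext, rule pos_kernel.pot_cmult[OF pos_kernel_Tk]) simp_all
  then show ?thesis unfolding sigma_def by (simp add: mD_cmult)
qed

lemma mD_le_sigma: "mD R f \<le> sigma R f"
  unfolding sigma_def by (intro mD_mono le_pot)

lemma sigma_SUP:
  assumes "\<And>n. f n \<in> borel_measurable borel" "\<And>x. incseq (\<lambda>n. f n x)" "\<And>x. f' x = (SUP n. f n x)"
  shows "sigma R f' = (SUP n. sigma R (f n))" "incseq (\<lambda>n. sigma R (f n))"
  unfolding sigma_def using assms pot_Tk_SUP[of "\<lambda>_. nu" nu f f' R]
  by (auto intro!: mD_SUP simp: decseq_def)

text \<open>The splitting gives \<open>\<sigma>(Q f) = \<sigma>(T f) + m(f) \<sigma>(s)\<close>. At
  \<open>nu\<close> the factor \<open>\<sigma>(s)\<close> is 1, and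
  \<open>m(f) + \<sigma>(T f) = \<sigma>(f)\<close> is \<open>pot_eq'\<close> integrated over the
  interval.\<close>

lemma sigma_kop_Qk:
  assumes R: "good_radius R nu" and [measurable]: "f \<in> borel_measurable borel"
  shows "sigma R (kopQ nu f) = sigma R f"
proof -
  have [measurable]: "kopT R nu f \<in> borel_measurable borel"
    using pos_kernel.kop_measurable[OF pos_kernel_Tk, of f R nu] by simp
  have "kopQ nu f = (\<lambda>x. kopT R nu f x + mD R f * sw R nu x)"
    using kop_decomp[of f nu _ R] by (auto simp: mult.commute)
  then have "sigma R (kopQ nu f) = sigma R (kopT R nu f) + mD R f * sigma R (sw R nu)"
    by (simp add: sigma_add sigma_cmult)
  also have "\<dots> = mD R f + sigma R (kopT R nu f)"
    using mD_pot_Tk_sw_nu[OF R] by (simp add: sigma_def add.commute)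
  also have "\<dots> = mD R (\<lambda>x. f x + potT R nu (kopT R nu f) x)"
    unfolding sigma_def by (simp add: mD_add)
  also have "\<dots> = sigma R f"
    unfolding sigma_def using pos_kernel.pot_eq'[OF pos_kernel_Tk, of R nu f] by presburger
  finally show ?thesis .
qed

lemma sigma_one_finite:
  assumes "good_radius R nu"
  shows "sigma R (\<lambda>_. 1) < \<top>"
proof -
  obtain M where M: "\<And>\<gamma> x. \<gamma> \<ge> nu \<Longrightarrow> potT R \<gamma> (\<lambda>_. 1) x \<le> ennreal M"
    using pot_Tk_one_le[OF assms] by auto
  have "sigma R (\<lambda>_. 1) \<le> mD R (\<lambda>_. ennreal M)" unfolding sigma_def by (intro mD_mono M) simp
  also have "\<dots> < \<top>"
    using assms by (simp add: good_radius_def mD_const ennreal_mult_less_top)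
  finally show ?thesis .
qed

lemma sigma_le:
  assumes "\<And>x. f x \<le> b"
  shows "sigma R f \<le> b * sigma R (\<lambda>_. 1)"
  using sigma_mono[of f "\<lambda>_. b * 1" R] assms by (subst sigma_cmult[symmetric]) auto

lemma mD_pos:
  assumes [measurable]: "f \<in> borel_measurable borel" and pos: "AE x in lborel. f x > 0" and "R > 0"
  shows "mD R f > 0"
proof -
  let ?N = "density lborel (indicator {-R..R} :: real \<Rightarrow> ennreal)"
  have "mD R f = (\<integral>\<^sup>+ x. f x \<partial>?N)"
    unfolding mD_def by (subst nn_integral_density) (auto simp: mult.commute)
  also have "\<dots> > 0"
  proof (rule nn_integral_pos)
    show "emeasure ?N (space ?N) \<noteq> 0" using assms(3) by (simp add: emeasure_density)
    show "AE x in ?N. f x > 0" 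
    proof (subst AE_density)
      show "AE x in lborel. (0::ennreal) < indicator {-R..R} x \<longrightarrow> f x > 0"
        using pos by eventually_elim simp
    qed simp
  qed simp
  finally show ?thesis .
qed

lemma PP_pos:
  assumes [measurable]: "f \<in> borel_measurable borel" and "\<And>x. f x > 0"
  shows "PP f x > 0"
  unfolding PP_def using assms(2) p_pos
  by (intro nn_integral_pos) (auto simp: ennreal_zero_less_mult_iff)

text \<open>\<open>f\<close> is a bounded solution of \<open>f = (h + m(f) s) + T f\<close>, so
  uniqueness expresses it through potentials of \<open>T\<close>. As those stay bounded down to
  \<open>nu\<close>, any divergence of \<open>f\<close> is carried by the single scalar
  \<open>m(f)\<close>.\<close>

lemma pot_Qk_hw:
  assumes R: "good_radius R nu" and g: "\<gamma> > nu"
  defines "f \<equiv> potQ \<gamma> (hw \<gamma>)"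
  shows "\<exists>B. \<forall>x. f x \<le> ennreal B"
    and "mD R f < \<top>"
    and "f x = potT R \<gamma> (hw \<gamma>) x + mD R f * potT R \<gamma> (sw R \<gamma>) x"
proof -
  interpret Q: pos_kernel lborel "Qk \<gamma>" by (rule pos_kernel_Qk)
  interpret T: pos_kernel lborel "Tk R \<gamma>" by (rule pos_kernel_Tk)
  have g0: "\<gamma> > 0" using g nu_pos by simp
  have R1: "R \<ge> 1" using R by (simp add: good_radius_def)
  have [measurable]: "f \<in> borel_measurable borel" unfolding f_def by measurable
  obtain B where B: "\<And>x. potQ \<gamma> (\<lambda>_. 1) x \<le> ennreal B"
    using potQ_bounded_iff[OF g0] g by (auto simp: potQ_bounded_def)
  have le: "f x \<le> ennreal (K * B)" for x
  proof -
    have "f x \<le> potQ \<gamma> (\<lambda>_. ennreal K * 1) x"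
      unfolding f_def using g0 by (intro pot_mono) (auto intro: order_trans[OF hw_le_wt wt_le])
    also have "\<dots> \<le> ennreal K * ennreal B"
      by (subst Q.pot_cmult) (auto intro!: mult_left_mono B)
    finally show ?thesis using K_ge2 by (simp add: ennreal_mult')
  qed
  then show "\<exists>B. \<forall>x. f x \<le> ennreal B" by blast
  have "mD R f \<le> mD R (\<lambda>_. ennreal (K * B))" by (intro mD_mono le)
  also have "\<dots> < \<top>" using R1 by (simp add: mD_const ennreal_mult_less_top)
  finally show "mD R f < \<top>" .
  obtain M where M: "\<And>\<gamma> x. \<gamma> \<ge> nu \<Longrightarrow> potT R \<gamma> (\<lambda>_. 1) x \<le> ennreal M"
    using pot_Tk_one_le[OF R] by auto
  have "f x = potT R \<gamma> (\<lambda>x. hw \<gamma> x + mD R f * sw R \<gamma> x) x"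
  proof (rule T.pot_unique[where c="ennreal (K * B)"])
    show "f x = hw \<gamma> x + mD R f * sw R \<gamma> x + kopT R \<gamma> f x" for x
      using Q.pot_eq[of "hw \<gamma>" x] kop_decomp[of f \<gamma> x R] unfolding f_def[symmetric] by (simp add: ac_simps)
    show "potT R \<gamma> (\<lambda>_. 1) x \<noteq> \<top>" using M[of \<gamma> x] g by (auto simp: top_unique)
  qed (use le in auto)
  also have "\<dots> = potT R \<gamma> (hw \<gamma>) x + mD R f * potT R \<gamma> (sw R \<gamma>) x"
    by (simp add: T.pot_add T.pot_cmult)
  finally show "f x = potT R \<gamma> (hw \<gamma>) x + mD R f * potT R \<gamma> (sw R \<gamma>) x" .
qed

text \<open>Pairing \<open>f = h + Q\<^sub>\<gamma> f\<close> with the eigenmeasure at \<open>nu\<close> leaves only the difference of the weights.\<close>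

lemma sigma_hw_eq:
  assumes R: "good_radius R nu" and g: "\<gamma> > nu"
  shows "sigma R (hw \<gamma>) = ennreal (\<gamma> - nu) *
    (sigma R (\<lambda>x. dq \<gamma> x * PP (potT R \<gamma> (hw \<gamma>)) x)
      + mD R (potQ \<gamma> (hw \<gamma>)) * sigma R (\<lambda>x. dq \<gamma> x * PP (potT R \<gamma> (sw R \<gamma>)) x))"
proof -
  interpret Q: pos_kernel lborel "Qk \<gamma>" by (rule pos_kernel_Qk)
  define f where "f = potQ \<gamma> (hw \<gamma>)"
  define th where "th = potT R \<gamma> (hw \<gamma>)"
  define ts where "ts = potT R \<gamma> (sw R \<gamma>)"
  have [measurable]: "f \<in> borel_measurable borel" "th \<in> borel_measurable borel" "ts \<in> borel_measurable borel"
    unfolding f_def th_def ts_def by measurable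
  obtain B where B: "\<And>x. f x \<le> ennreal B" using pot_Qk_hw(1)[OF R g] unfolding f_def by blast
  define c where "c = sigma R (\<lambda>_. 1)"
  have c1: "c < \<top>" unfolding c_def by (rule sigma_one_finite[OF R])
  have c2: "sigma R f \<le> b * c" if "\<And>x. f x \<le> b" for f b
    unfolding c_def by (rule sigma_le[OF that])
  have "PP f x \<le> ennreal B" for x using PP_mono[OF B] by (simp add: PP_const)
  \<comment> \<open>This term will occur on both sides of the paired equation, and
    \<open>ennreal\<close> permits cancelling it only if it is finite.\<close>
  then have "sigma R (\<lambda>x. wt \<gamma> x * PP f x) \<le> (ennreal K * ennreal B) * c"
    using g nu_pos by (intro c2 mult_mono wt_le) auto
  also have "\<dots> < \<top>" using c1 by (simp add: ennreal_mult_less_top)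
  finally have fin: "sigma R (\<lambda>x. wt \<gamma> x * PP f x) < \<top>" .
  have "sigma R (hw \<gamma>) + sigma R (\<lambda>x. wt \<gamma> x * PP f x) = sigma R (\<lambda>x. hw \<gamma> x + wt \<gamma> x * PP f x)"
    by (simp add: sigma_add)
  also have "(\<lambda>x. hw \<gamma> x + wt \<gamma> x * PP f x) = f"
  proof
    show "hw \<gamma> x + wt \<gamma> x * PP f x = f x" for x
      using Q.pot_eq[of "hw \<gamma>" x] kop_Qk[of f \<gamma> x] unfolding f_def[symmetric] by simp
  qed
  also have "sigma R f = sigma R (\<lambda>x. ennreal (\<gamma> - nu) * (dq \<gamma> x * PP f x) + wt \<gamma> x * PP f x)"
  proof -
    have "kopQ nu f = (\<lambda>x. ennreal (\<gamma> - nu) * (dq \<gamma> x * PP f x) + wt \<gamma> x * PP f x)"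
      by (simp add: fun_eq_iff kop_Qk wt_nu_eq[OF g] algebra_simps)
    then show ?thesis using sigma_kop_Qk[OF R, of f] by simp
  qed
  also have "\<dots> = ennreal (\<gamma> - nu) * sigma R (\<lambda>x. dq \<gamma> x * PP f x) + sigma R (\<lambda>x. wt \<gamma> x * PP f x)"
    by (simp add: sigma_add sigma_cmult)
  finally have "sigma R (hw \<gamma>) = ennreal (\<gamma> - nu) * sigma R (\<lambda>x. dq \<gamma> x * PP f x)"
    using fin by (auto simp: add.commute[of _ "sigma R (\<lambda>x. wt \<gamma> x * PP f x)"] ennreal_add_left_cancel)
  moreover have "f = (\<lambda>x. th x + mD R f * ts x)"
    unfolding th_def ts_def f_def by (rule ext) (rule pot_Qk_hw(3)[OF R g])
  then have "PP f x = PP (\<lambda>x. th x + mD R f * ts x) x" for x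
    by (rule arg_cong)
  then have "PP f x = PP th x + mD R f * PP ts x" for x
    by (simp add: PP_add PP_cmult)
  then have "(\<lambda>x. dq \<gamma> x * PP f x) = (\<lambda>x. dq \<gamma> x * PP th x + mD R f * (dq \<gamma> x * PP ts x))"
    by (simp add: algebra_simps)
  then have "sigma R (\<lambda>x. dq \<gamma> x * PP f x)
      = sigma R (\<lambda>x. dq \<gamma> x * PP th x) + mD R f * sigma R (\<lambda>x. dq \<gamma> x * PP ts x)"
    by (simp add: sigma_add sigma_cmult)
  ultimately show ?thesis unfolding f_def th_def ts_def by simp
qed

text \<open>Put \<open>e = \<gamma> - nu\<close>. By \<open>sigma_hw_eq\<close>,
  \<open>\<sigma>(h) = e a + (e m(f)) j\<close> with \<open>a\<close> bounded, so
  \<open>e m(f)\<close> tends to \<open>s / J\<close>. The mean of \<open>f\<close> is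
  \<open>b + m(f) u\<close> with \<open>b\<close> bounded, so \<open>e\<close> times it tends to
  \<open>s / J\<close> times the limit of \<open>u\<close>. The limit is the same for every
  sequence, which later yields a genuine one-sided limit.\<close>

theorem mean_pot_pole:
  assumes "prob_space \<mu>" and sets_mu [measurable_cong]: "sets \<mu> = sets borel"
  obtains C where "C > 0" "\<And>g. decseq g \<Longrightarrow> g \<longlonglongrightarrow> nu \<Longrightarrow> (\<And>n. g n > nu) \<Longrightarrow>
    (\<lambda>n. ennreal (g n - nu) * (\<integral>\<^sup>+ x. potQ (g n) (hw (g n)) x \<partial>\<mu>)) \<longlonglongrightarrow> ennreal C"
proof -
  obtain R where R: "good_radius R nu" using good_radius_exists[OF nu_pos] by blast
  have R1: "R \<ge> 1" using R by (simp add: good_radius_def)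
  obtain M where M: "\<And>\<gamma> x. \<gamma> \<ge> nu \<Longrightarrow> potT R \<gamma> (\<lambda>_. 1) x \<le> ennreal M"
    using pot_Tk_one_le[OF R] by auto
  define c where "c = sigma R (\<lambda>_. 1)"
  have c1: "c < \<top>" unfolding c_def by (rule sigma_one_finite[OF R])
  have c2: "sigma R f \<le> b * c" if "\<And>x. f x \<le> b" for f b
    unfolding c_def by (rule sigma_le[OF that])
  interpret mu: prob_space \<mu> by fact
  define th where "th \<gamma> = potT R \<gamma> (hw \<gamma>)" for \<gamma>
  define ts where "ts \<gamma> = potT R \<gamma> (sw R \<gamma>)" for \<gamma>
  have [measurable]: "th \<gamma> \<in> borel_measurable borel" "ts \<gamma> \<in> borel_measurable borel" for \<gamma>
    unfolding th_def ts_def by measurable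
  define bh where "bh = ennreal K * ennreal M"
  define bs where "bs = ennreal (K * p 0) * ennreal M"
  have b_fin: "bh < \<top>" "bs < \<top>" unfolding bh_def bs_def by (auto simp: ennreal_mult_less_top)
  have th_le: "th \<gamma> x \<le> bh" if "\<gamma> \<ge> nu" for \<gamma> x
    unfolding th_def bh_def using that nu_pos
    by (intro pot_Tk_le[OF M order_trans[OF hw_le_wt wt_le]]) auto
  have ts_le: "ts \<gamma> x \<le> bs" if "\<gamma> \<ge> nu" for \<gamma> x
    unfolding ts_def bs_def using that nu_pos R1 by (intro pot_Tk_le[OF M sw_le]) auto
  define s where "s = sigma R (hw nu)"
  define J where "J = sigma R (\<lambda>x. dq0 x * PP (ts nu) x)"
  define u where "u = (\<integral>\<^sup>+ x. ts nu x \<partial>\<mu>)"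
  have ts_pos: "ts \<gamma> x > 0" for \<gamma> x
    unfolding ts_def using sw_pos[of R \<gamma> x] le_pot[of "sw R \<gamma>" x lborel "Tk R \<gamma>"] by (rule less_le_trans)
  have "s \<le> ennreal K * c"
    unfolding s_def
  proof (rule c2)
    show "hw nu x \<le> ennreal K" for x using hw_le_wt[of nu x] wt_le[of nu x] nu_pos by simp
  qed
  also have "\<dots> < \<top>" using c1 by (simp add: ennreal_mult_less_top)
  finally have s_fin: "s < \<top>" .
  have s_pos: "s > 0"
    unfolding s_def by (rule less_le_trans[OF mD_pos mD_le_sigma]) (use R1 hw_pos in auto)
  have "u \<le> (\<integral>\<^sup>+ x. bs \<partial>\<mu>)" unfolding u_def by (intro nn_integral_mono ts_le) simp
  also have "\<dots> < \<top>" using b_fin by (simp add: mu.emeasure_space_1)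
  finally have u_fin: "u < \<top>" .
  have u_pos: "u > 0" unfolding u_def by (rule nn_integral_pos) (auto simp: ts_pos mu.emeasure_space_1)
  have dq0_le: "dq0 x \<le> ennreal (K / nu)" for x
    by (subst dq_SUP(1)[OF nu_seq(1,2,3), symmetric]) (intro SUP_least dq_le nu_seq)
  have PP_le: "PP f x \<le> b" if "\<And>x. f x \<le> b" for f b x using PP_mono[OF that] by (simp add: PP_const)
  have "J \<le> (ennreal (K / nu) * bs) * c"
    unfolding J_def
  proof (rule c2)
    show "dq0 x * PP (ts nu) x \<le> ennreal (K / nu) * bs" for x
      by (intro mult_mono dq0_le PP_le ts_le) auto
  qed
  also have "\<dots> < \<top>" using b_fin c1 by (simp add: ennreal_mult_less_top)
  finally have J_fin: "J < \<top>" .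
  have J_pos: "J > 0"
  proof -
    \<comment> \<open>\<open>dq0\<close> vanishes exactly where \<xi> does. Nullity of that set
      makes \<open>J\<close> positive, hence the pole no worse than simple.\<close>
    have "AE x in lborel. \<xi> x \<noteq> 0"
      using xi_zero_null by (intro AE_I[of _ _ "{x. \<xi> x = 0}"]) auto
    then have "AE x in lborel. dq0 x * PP (ts nu) x > 0"
    proof eventually_elim
      case (elim x)
      then have "\<xi> x > 0" using xi_nonneg[of x] by simp
      then have "dq0 x > 0" unfolding dq0_def using kappa_ge2_real[of x] by simp
      then show ?case using PP_pos[of "ts nu" x] ts_pos by (simp add: ennreal_zero_less_mult_iff)
    qed
    then show ?thesis unfolding J_def
      by (intro less_le_trans[OF mD_pos mD_le_sigma]) (use R1 in auto)
  qed
  define C where "C = enn2real s / enn2real J * enn2real u"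
  have C_pos: "C > 0"
    unfolding C_def using s_fin s_pos J_fin J_pos u_fin u_pos
    by (intro mult_pos_pos divide_pos_pos) (auto simp: enn2real_positive_iff)
  have "(\<lambda>n. ennreal (g n - nu) * (\<integral>\<^sup>+ x. potQ (g n) (hw (g n)) x \<partial>\<mu>)) \<longlonglongrightarrow> ennreal C"
    if g: "decseq g" "g \<longlonglongrightarrow> nu" "\<And>n. g n > nu" for g
  proof -
    define e where "e n = g n - nu" for n
    have e: "e \<longlonglongrightarrow> 0" "\<And>n. e n > 0" unfolding e_def using g LIM_zero[OF g(2)] by auto
    define a where "a n = sigma R (\<lambda>x. dq (g n) x * PP (th (g n)) x)" for n
    define j where "j n = sigma R (\<lambda>x. dq (g n) x * PP (ts (g n)) x)" for n
    define sn where "sn n = sigma R (hw (g n))" for n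
    define mf where "mf n = mD R (potQ (g n) (hw (g n)))" for n
    define un where "un n = (\<integral>\<^sup>+ x. ts (g n) x \<partial>\<mu>)" for n
    define b where "b n = (\<integral>\<^sup>+ x. th (g n) x \<partial>\<mu>)" for n
    have ts_inc: "incseq (\<lambda>n. ts (g n) x)" and ts_sup: "ts nu x = (SUP n. ts (g n) x)" for x
      using pot_Tk_SUP[OF g(1,2), of "\<lambda>n. sw R (g n)" "sw R nu" R] sw_SUP[OF g(1,2), of R]
      by (auto simp: ts_def)
    have sn_lim: "sn \<longlonglongrightarrow> s"
      using sigma_SUP[of "\<lambda>n. hw (g n)" "hw nu" R] hw_SUP[OF g(1,2)] LIMSEQ_SUP
      by (auto simp: s_def sn_def[abs_def])
    have PP_inc: "incseq (\<lambda>n. PP (ts (g n)) x)" and PP_sup: "PP (ts nu) x = (SUP n. PP (ts (g n)) x)" for x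
      using PP_SUP[of "\<lambda>n. ts (g n)" "ts nu" x] ts_inc ts_sup by auto
    have j_lim: "j \<longlonglongrightarrow> J"
    proof -
      have "dq0 x * PP (ts nu) x = (SUP n. dq (g n) x * PP (ts (g n)) x)" for x
        by (simp add: SUP_mult_incseq_ennreal[OF dq_SUP(2)[OF g] PP_inc] dq_SUP(1)[OF g] PP_sup)
      moreover have "incseq (\<lambda>n. dq (g n) x * PP (ts (g n)) x)" for x
        using dq_SUP(2)[OF g, of x] PP_inc[of x] by (auto simp: incseq_def intro: mult_mono)
      ultimately show ?thesis
        using sigma_SUP[of "\<lambda>n x. dq (g n) x * PP (ts (g n)) x" "\<lambda>x. dq0 x * PP (ts nu) x" R] LIMSEQ_SUP
        by (auto simp: J_def j_def[abs_def])
    qed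
    have un_lim: "un \<longlonglongrightarrow> u"
    proof -
      have "u = (SUP n. un n)"
        unfolding u_def un_def ts_sup using ts_inc
        by (intro nn_integral_monotone_convergence_SUP) (auto simp: incseq_def le_fun_def)
      moreover have "incseq un"
        unfolding un_def[abs_def] using ts_inc by (auto simp: incseq_def intro!: nn_integral_mono)
      ultimately show ?thesis using LIMSEQ_SUP by simp
    qed
    have a_le: "a n \<le> (ennreal (K / nu) * bh) * c" and j_le: "j n \<le> (ennreal (K / nu) * bs) * c" for n
    proof -
      have "dq (g n) x * PP (th (g n)) x \<le> ennreal (K / nu) * bh"
        "dq (g n) x * PP (ts (g n)) x \<le> ennreal (K / nu) * bs" for x
        using g(3)[of n] by (auto intro!: mult_mono dq_le PP_le th_le ts_le)
      then show "a n \<le> (ennreal (K / nu) * bh) * c" "j n \<le> (ennreal (K / nu) * bs) * c"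
        unfolding a_def j_def by (auto intro!: c2)
    qed
    have b_le: "b n \<le> bh" and un_le: "un n \<le> bs" for n
    proof -
      have "b n \<le> (\<integral>\<^sup>+ x. bh \<partial>\<mu>)"
        unfolding b_def using g(3)[of n] by (intro nn_integral_mono th_le) simp
      moreover have "un n \<le> (\<integral>\<^sup>+ x. bs \<partial>\<mu>)"
        unfolding un_def using g(3)[of n] by (intro nn_integral_mono ts_le) simp
      ultimately show "b n \<le> bh" "un n \<le> bs" by (simp_all add: mu.emeasure_space_1)
    qed
    have fin: "a n < \<top>" "j n < \<top>" "b n < \<top>" "un n < \<top>" "mf n < \<top>" for n
      using le_less_trans[OF a_le] le_less_trans[OF j_le] le_less_trans[OF b_le] le_less_trans[OF un_le]
        b_fin c1 pot_Qk_hw(2)[OF R g(3)] by (auto simp: ennreal_mult_less_top mf_def)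
    have s_eq: "sn n = ennreal (e n) * (a n + mf n * j n)" for n
      unfolding sn_def e_def a_def j_def mf_def th_def ts_def by (rule sigma_hw_eq[OF R g(3)])
    have F_eq: "(\<integral>\<^sup>+ x. potQ (g n) (hw (g n)) x \<partial>\<mu>) = b n + mf n * un n" for n
      unfolding b_def un_def mf_def
      by (subst pot_Qk_hw(3)[OF R g(3), abs_def])
        (simp add: th_def[symmetric] ts_def[symmetric] nn_integral_add nn_integral_cmult)
    \<comment> \<open>The renormalised diverging scalar. Passing to the reals makes it possible to
      solve for it by division.\<close>
    define z where "z n = e n * enn2real (mf n)" for n
    have s_real: "enn2real (sn n) = e n * enn2real (a n) + z n * enn2real (j n)" for n
      unfolding s_eq z_def using fin[of n] e(2)[of n]
      by (simp add: enn2real_mult enn2real_plus ennreal_mult_less_top distrib_left)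
    have "(\<lambda>n. enn2real (sn n)) \<longlonglongrightarrow> enn2real s" "(\<lambda>n. enn2real (j n)) \<longlonglongrightarrow> enn2real J"
      "(\<lambda>n. enn2real (un n)) \<longlonglongrightarrow> enn2real u"
      using sn_lim j_lim un_lim s_fin J_fin u_fin by (auto intro!: tendsto_enn2real)
    note lims = this
    have zero: "(\<lambda>n. e n * enn2real (f n)) \<longlonglongrightarrow> 0" if "\<And>n. f n \<le> B" "B < \<top>" for f B
    proof (rule tendsto_sandwich[OF _ _ tendsto_const])
      show "(\<lambda>n. e n * enn2real B) \<longlonglongrightarrow> 0" using tendsto_mult_right[OF e(1), of "enn2real B"] by simp
      show "eventually (\<lambda>n. e n * enn2real (f n) \<le> e n * enn2real B) sequentially"
        using e(2) that by (intro always_eventually allI mult_left_mono enn2real_mono) (auto intro: less_imp_le)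
    qed (use e(2) in \<open>auto intro!: always_eventually simp: less_imp_le\<close>)
    have J_real: "enn2real J > 0" using J_pos J_fin by (simp add: enn2real_positive_iff)
    have z_lim: "z \<longlonglongrightarrow> enn2real s / enn2real J"
    proof -
      have "(\<lambda>n. (enn2real (sn n) - e n * enn2real (a n)) / enn2real (j n))
          \<longlonglongrightarrow> (enn2real s - 0) / enn2real J"
        using J_real b_fin c1
        by (intro tendsto_divide tendsto_diff lims zero[OF a_le]) (auto simp: ennreal_mult_less_top)
      \<comment> \<open>Solving for \<open>z n\<close> needs a nonzero \<open>j n\<close>, which the
        positive limit \<open>J\<close> provides for large \<open>n\<close>.\<close>
      moreover have "eventually (\<lambda>n. (enn2real (sn n) - e n * enn2real (a n)) / enn2real (j n) = z n) sequentially"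
        using order_tendstoD(1)[OF lims(2) J_real] by eventually_elim (simp add: s_real)
      ultimately show ?thesis by (auto intro: Lim_transform_eventually)
    qed
    have "(\<lambda>n. e n * enn2real (b n) + z n * enn2real (un n)) \<longlonglongrightarrow> 0 + C"
      unfolding C_def using b_fin by (intro tendsto_add tendsto_mult z_lim lims zero[OF b_le]) auto
    then have "(\<lambda>n. ennreal (e n * enn2real (b n) + z n * enn2real (un n))) \<longlonglongrightarrow> ennreal C"
      by (intro tendsto_ennrealI) simp
    moreover have "ennreal (e n * enn2real (b n) + z n * enn2real (un n))
        = ennreal (e n) * (b n + mf n * un n)" for n
    proof -
      obtain b' m' u' where "b n = ennreal b'" "mf n = ennreal m'" "un n = ennreal u'" "b' \<ge> 0" "m' \<ge> 0" "u' \<ge> 0"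
        using fin[of n] by (metis ennreal_cases less_top)
      then show ?thesis using e(2)[of n]
        by (simp add: z_def distrib_left ennreal_mult ennreal_plus mult.assoc less_imp_le)
    qed
    ultimately show ?thesis unfolding F_eq e_def[symmetric] by simp
  qed
  with C_pos show thesis using that by blast
qed

end

section \<open>The Markov property\<close>

context linear_ar
begin

text \<open>Initial state and noise as one independent sequence, of which each \<open>X n\<close> is
  a deterministic function, namely \<open>ar_path\<close>. The Markov property then reduces to
  Fubini for product measures.\<close>

definition driver :: "nat \<Rightarrow> 'a \<Rightarrow> real" where
  "driver n = (if n = 0 then X 0 else \<theta> n)"

primrec ar_path :: "(nat \<Rightarrow> real) \<Rightarrow> nat \<Rightarrow> real" where
  "ar_path z 0 = z 0"
| "ar_path z (Suc n) = \<alpha> * ar_path z n + z (Suc n)"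

lemma X_eq_ar_path: "\<omega> \<in> space M \<Longrightarrow> X n \<omega> = ar_path (\<lambda>i. driver i \<omega>) n"
  by (induction n) (auto simp: driver_def recursion)

lemma ar_path_cong: "(\<And>i. i \<le> n \<Longrightarrow> z i = z' i) \<Longrightarrow> ar_path z n = ar_path z' n"
  by (induction n) auto

lemma ar_path_measurable [measurable (raw)]:
  "\<lbrakk>\<And>i. i \<le> n \<Longrightarrow> (\<lambda>\<omega>. z \<omega> i) \<in> borel_measurable N\<rbrakk> \<Longrightarrow> (\<lambda>\<omega>. ar_path (z \<omega>) n) \<in> borel_measurable N"
  by (induction n) auto

lemma theta_measurable: "n \<ge> 1 \<Longrightarrow> random_variable borel (\<theta> n)"
  using noise_indep by (auto simp: indep_vars_def)

lemma driver_measurable [measurable]: "random_variable borel (driver n)"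
  unfolding driver_def using rv_X0 theta_measurable[of n] by auto

lemma X_measurable [measurable]: "random_variable borel (X n)"
  by (subst measurable_cong[OF X_eq_ar_path]) auto

text \<open>Only index sets containing both 0 and a noise index need \<open>X0_indep_noise\<close>:
  the intersection of the noise events belongs to the \<sigma>-algebra of the whole noise sequence,
  and independence of the noise factorises its probability.\<close>

lemma indep_driver: "indep_vars (\<lambda>_. borel) driver UNIV"
  unfolding indep_vars_def2
proof (intro conjI ballI indep_setsI)
  let ?F = "\<lambda>i. {driver i -` A \<inter> space M | A. A \<in> sets borel}"
  let ?V = "vimage_algebra (space M) (\<lambda>\<omega>. \<lambda>n\<in>{1..}. \<theta> n \<omega>) (PiM {1..} (\<lambda>_. borel))"
  have noise: "indep_sets ?F {1..}"
  proof -
    have "indep_sets (\<lambda>i. {\<theta> i -` A \<inter> space M | A. A \<in> sets borel}) {1..}"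
      using noise_indep unfolding indep_vars_def2 by blast
    then show ?thesis by (rule indep_sets_cong[THEN iffD1, rotated 2]) (auto simp: driver_def)
  qed
  fix A and J :: "nat set"
  assume J: "J \<noteq> {}" "J \<subseteq> UNIV" "finite J" and A: "\<forall>j\<in>J. A j \<in> ?F j"
  show "prob (\<Inter>j\<in>J. A j) = (\<Prod>j\<in>J. prob (A j))"
  proof (cases "0 \<in> J \<and> J \<noteq> {0}")
    case False
    then consider "J = {0}" | "J \<subseteq> {1..}"
      by (metis atLeast_iff less_one not_le subsetI)
    then show ?thesis
    proof cases
      case 2
      then show ?thesis using indep_setsD[OF noise 2 J(1,3)] A by blast
    qed simp
  next
    case True
    define J' where "J' = J - {0}"
    have J': "J' \<noteq> {}" "J' \<subseteq> {1..}" "finite J'" "J = insert 0 J'" "0 \<notin> J'"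
      using True J unfolding J'_def by (auto simp: Suc_le_eq)
    have "A 0 \<in> sets (vimage_algebra (space M) (X 0) borel)"
    proof -
      have "A 0 \<in> ?F 0" using A True by blast
      then show ?thesis by (auto simp: driver_def intro: in_vimage_algebra)
    qed
    moreover have "(\<Inter>j\<in>J'. A j) \<in> sets ?V"
    proof (rule sets.finite_INT[OF J'(3,1)])
      fix j assume j: "j \<in> J'"
      have "A j \<in> ?F j" "j \<noteq> 0" using A J'(4,5) j by (blast, metis)
      then obtain B where B: "B \<in> sets borel" "A j = \<theta> j -` B \<inter> space M"
        by (auto simp: driver_def)
      have "{z \<in> space (PiM {1..} (\<lambda>_. borel)). z j \<in> B} \<in> sets (PiM {1..} (\<lambda>_. borel))"
        using B(1) subsetD[OF J'(2) j] by measurable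
      from in_vimage_algebra[OF this, of "\<lambda>\<omega>. \<lambda>n\<in>{1..}. \<theta> n \<omega>" "space M"]
      show "A j \<in> sets ?V"
        using j J' unfolding B(2) by (auto simp: space_PiM vimage_def Int_def elim!: back_subst[where P="\<lambda>S. S \<in> sets ?V"])
    qed
    ultimately have "prob (A 0 \<inter> (\<Inter>j\<in>J'. A j)) = prob (A 0) * prob (\<Inter>j\<in>J'. A j)"
      by (rule indep_setD[OF X0_indep_noise])
    moreover have "prob (\<Inter>j\<in>J'. A j) = (\<Prod>j\<in>J'. prob (A j))"
      using A J' by (intro indep_setsD[OF noise]) auto
    ultimately show ?thesis using J' by (simp add: J'(4))
  qed
qed auto

lemma distr_theta: "n \<ge> 1 \<Longrightarrow> distr M borel (\<theta> n) = density lborel (\<lambda>y. ennreal (p y))"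
  using noise_ident distributed_distr_eq_density[OF p_density]
  by (metis distr_cong sets_lborel)

lemma p_borel [measurable]: "p \<in> borel_measurable borel"
  using p_cont by (rule borel_measurable_continuous_onI)

lemma p_integral: "(\<integral>\<^sup>+ y. ennreal (p y) \<partial>lborel) = 1"
proof -
  interpret T: prob_space "distr M borel (\<theta> 1)" by (rule prob_space_distr) (simp add: theta_measurable)
  show ?thesis using T.emeasure_space_1 by (simp add: distr_theta emeasure_density)
qed

text \<open>Under the product law the last coordinate is integrated first, as the factor
  \<open>\<Phi>\<close> and the state \<open>X n\<close> depend only on coordinates up to
  \<open>n\<close>. Translation by \<open>\<alpha> * X n\<close> turns the noise density into the
  transition density.\<close>

lemma markov_step:
  assumes [measurable]: "\<Phi> \<in> borel_measurable (PiM {..n} (\<lambda>_. borel))" "f \<in> borel_measurable borel"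
  shows "(\<integral>\<^sup>+ \<omega>. \<Phi> (\<lambda>i\<in>{..n}. driver i \<omega>) * f (X (Suc n) \<omega>) \<partial>M)
    = (\<integral>\<^sup>+ \<omega>. \<Phi> (\<lambda>i\<in>{..n}. driver i \<omega>) * (\<integral>\<^sup>+ y. ennreal (p (y - \<alpha> * X n \<omega>)) * f y \<partial>lborel) \<partial>M)"
proof -
  let ?L = "\<lambda>i. distr M borel (driver i)"
  have prob: "prob_space (?L i)" for i by (rule prob_space_distr) measurable
  interpret P: product_sigma_finite ?L
    by (simp add: product_sigma_finite_def prob prob_space_imp_sigma_finite)
  have law: "distr M (PiM J (\<lambda>_. borel)) (\<lambda>\<omega>. \<lambda>i\<in>J. driver i \<omega>) = PiM J ?L" if "J \<noteq> {}" for J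
    using indep_vars_subset[OF indep_driver, of J] that
    by (subst indep_vars_iff_distr_eq_PiM[symmetric]) auto
  have sets_L: "sets (PiM J ?L) = sets (PiM J (\<lambda>_. borel))" for J by (intro sets_PiM_cong) auto
  note [measurable_cong] = sets_L
  have ins: "{..Suc n} = insert (Suc n) {..n}" by auto
  define F where "F z = \<Phi> (restrict z {..n}) * f (\<alpha> * ar_path z n + z (Suc n))" for z
  have [measurable]: "(\<lambda>z. restrict z {..n}) \<in> measurable (PiM {..Suc n} (\<lambda>_. borel)) (PiM {..n} (\<lambda>_. borel :: real measure))"
    by (intro measurable_restrict_subset) auto
  have F_meas [measurable]: "F \<in> borel_measurable (PiM {..Suc n} (\<lambda>_. borel))"
    unfolding F_def[abs_def] by measurable
  define H where "H z = (\<integral>\<^sup>+ y. ennreal (p (y - \<alpha> * ar_path z n)) * f y \<partial>lborel)" for z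
  have [measurable]: "H \<in> borel_measurable (PiM {..n} (\<lambda>_. borel))"
    unfolding H_def[abs_def] by measurable
  have "(\<integral>\<^sup>+ \<omega>. \<Phi> (\<lambda>i\<in>{..n}. driver i \<omega>) * f (X (Suc n) \<omega>) \<partial>M) = (\<integral>\<^sup>+ \<omega>. F (\<lambda>i\<in>{..Suc n}. driver i \<omega>) \<partial>M)"
  proof (rule nn_integral_cong)
    fix \<omega> assume "\<omega> \<in> space M"
    have "restrict (\<lambda>i\<in>{..Suc n}. driver i \<omega>) {..n} = (\<lambda>i\<in>{..n}. driver i \<omega>)" by auto
    moreover have "ar_path (\<lambda>i\<in>{..Suc n}. driver i \<omega>) n = ar_path (\<lambda>i. driver i \<omega>) n"
      by (rule ar_path_cong) auto
    ultimately show "\<Phi> (\<lambda>i\<in>{..n}. driver i \<omega>) * f (X (Suc n) \<omega>) = F (\<lambda>i\<in>{..Suc n}. driver i \<omega>)"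
      unfolding F_def using X_eq_ar_path[OF \<open>\<omega> \<in> space M\<close>, of "Suc n"] by simp
  qed
  also have "\<dots> = integral\<^sup>N (PiM {..Suc n} ?L) F"
    by (subst law[symmetric]) (auto simp: nn_integral_distr)
  also have "\<dots> = (\<integral>\<^sup>+ z. (\<integral>\<^sup>+ y. F (z(Suc n := y)) \<partial>?L (Suc n)) \<partial>PiM {..n} ?L)"
    unfolding ins by (intro P.product_nn_integral_insert) (auto simp: ins[symmetric])
  also have "\<dots> = (\<integral>\<^sup>+ z. \<Phi> z * H z \<partial>PiM {..n} ?L)"
  proof (rule nn_integral_cong)
    fix z assume z: "z \<in> space (PiM {..n} ?L)"
    have "F (z(Suc n := y)) = \<Phi> z * f (\<alpha> * ar_path z n + y)" for y
    proof -
      have "restrict (z(Suc n := y)) {..n} = z"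
        using z by (auto simp: space_PiM PiE_def extensional_def restrict_def fun_eq_iff)
      moreover have "ar_path (z(Suc n := y)) n = ar_path z n" by (rule ar_path_cong) auto
      ultimately show ?thesis by (simp add: F_def)
    qed
    moreover have "?L (Suc n) = density lborel (\<lambda>y. ennreal (p y))"
      by (simp add: driver_def distr_theta)
    ultimately have "(\<integral>\<^sup>+ y. F (z(Suc n := y)) \<partial>?L (Suc n))
        = (\<integral>\<^sup>+ y. ennreal (p y) * (\<Phi> z * f (\<alpha> * ar_path z n + y)) \<partial>lborel)"
      by (simp add: nn_integral_density)
    also have "\<dots> = \<Phi> z * (\<integral>\<^sup>+ y. ennreal (p y) * f (\<alpha> * ar_path z n + y) \<partial>lborel)"
      by (subst nn_integral_cmult[symmetric]) (auto simp: mult.left_commute)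
    also have "(\<integral>\<^sup>+ y. ennreal (p y) * f (\<alpha> * ar_path z n + y) \<partial>lborel) = H z"
      unfolding H_def by (subst nn_integral_real_affine[of _ 1 "- \<alpha> * ar_path z n"]) (auto simp: algebra_simps)
    finally show "(\<integral>\<^sup>+ y. F (z(Suc n := y)) \<partial>?L (Suc n)) = \<Phi> z * H z" .
  qed
  also have "\<dots> = (\<integral>\<^sup>+ \<omega>. \<Phi> (\<lambda>i\<in>{..n}. driver i \<omega>) * H (\<lambda>i\<in>{..n}. driver i \<omega>) \<partial>M)"
    by (subst law[symmetric]) (auto simp: nn_integral_distr)
  also have "\<dots> = (\<integral>\<^sup>+ \<omega>. \<Phi> (\<lambda>i\<in>{..n}. driver i \<omega>) * (\<integral>\<^sup>+ y. ennreal (p (y - \<alpha> * X n \<omega>)) * f y \<partial>lborel) \<partial>M)"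
  proof (rule nn_integral_cong)
    fix \<omega> assume "\<omega> \<in> space M"
    moreover have "ar_path (\<lambda>i\<in>{..n}. driver i \<omega>) n = ar_path (\<lambda>i. driver i \<omega>) n"
      by (rule ar_path_cong) auto
    ultimately show "\<Phi> (\<lambda>i\<in>{..n}. driver i \<omega>) * H (\<lambda>i\<in>{..n}. driver i \<omega>)
        = \<Phi> (\<lambda>i\<in>{..n}. driver i \<omega>) * (\<integral>\<^sup>+ y. ennreal (p (y - \<alpha> * X n \<omega>)) * f y \<partial>lborel)"
      unfolding H_def by (simp add: X_eq_ar_path)
  qed
  finally show ?thesis .
qed

text \<open>The induction removes the last step of the path: \<open>markov_step\<close> replaces
  \<open>w (X n) * f (X (n + 1))\<close> by \<open>k f\<close> at \<open>X n\<close>. The function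
  \<open>f\<close> must therefore be arbitrary.\<close>

lemma expectation_eq_kop_funpow:
  fixes w f :: "real \<Rightarrow> ennreal"
  assumes [measurable]: "w \<in> borel_measurable borel" "f \<in> borel_measurable borel"
  defines "k \<equiv> \<lambda>x y. w x * ennreal (p (y - \<alpha> * x))"
  shows "(\<integral>\<^sup>+ \<omega>. (\<Prod>j<n. w (X j \<omega>)) * f (X n \<omega>) \<partial>M)
    = (\<integral>\<^sup>+ x. (kop lborel k ^^ n) f x \<partial>distr M borel (X 0))"
proof -
  interpret k: pos_kernel lborel k by unfold_locales (unfold k_def, measurable)
  have kop: "kop lborel k g x = w x * (\<integral>\<^sup>+ y. ennreal (p (y - \<alpha> * x)) * g y \<partial>lborel)"
    if [measurable]: "g \<in> borel_measurable borel" for g x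
    unfolding kop_def k_def by (simp add: mult.assoc nn_integral_cmult)
  have "(\<integral>\<^sup>+ \<omega>. (\<Prod>j<n. w (X j \<omega>)) * f (X n \<omega>) \<partial>M) = (\<integral>\<^sup>+ \<omega>. (kop lborel k ^^ n) f (X 0 \<omega>) \<partial>M)"
    using assms(2)
  proof (induction n arbitrary: f)
    case (Suc n)
    note [measurable] = Suc.prems
    define \<Phi> where "\<Phi> z = (\<Prod>j<Suc n. w (ar_path z j))" for z
    have [measurable]: "\<Phi> \<in> borel_measurable (PiM {..n} (\<lambda>_. borel))"
      unfolding \<Phi>_def[abs_def] by measurable
    have Phi: "\<Phi> (\<lambda>i\<in>{..n}. driver i \<omega>) = (\<Prod>j<Suc n. w (X j \<omega>))" if "\<omega> \<in> space M" for \<omega>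
      unfolding \<Phi>_def
    proof (rule prod.cong)
      fix j assume "j \<in> {..<Suc n}"
      then have "ar_path (\<lambda>i\<in>{..n}. driver i \<omega>) j = ar_path (\<lambda>i. driver i \<omega>) j"
        by (intro ar_path_cong) auto
      then show "w (ar_path (\<lambda>i\<in>{..n}. driver i \<omega>) j) = w (X j \<omega>)"
        using X_eq_ar_path[OF that, of j] by simp
    qed simp
    have "(\<integral>\<^sup>+ \<omega>. (\<Prod>j<Suc n. w (X j \<omega>)) * f (X (Suc n) \<omega>) \<partial>M)
        = (\<integral>\<^sup>+ \<omega>. \<Phi> (\<lambda>i\<in>{..n}. driver i \<omega>) * f (X (Suc n) \<omega>) \<partial>M)"
      by (intro nn_integral_cong) (simp add: Phi)
    also have "\<dots> = (\<integral>\<^sup>+ \<omega>. \<Phi> (\<lambda>i\<in>{..n}. driver i \<omega>) *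
        (\<integral>\<^sup>+ y. ennreal (p (y - \<alpha> * X n \<omega>)) * f y \<partial>lborel) \<partial>M)"
      by (rule markov_step) measurable
    also have "\<dots> = (\<integral>\<^sup>+ \<omega>. (\<Prod>j<n. w (X j \<omega>)) * kop lborel k f (X n \<omega>) \<partial>M)"
      by (intro nn_integral_cong) (simp add: Phi kop mult.assoc)
    also have "\<dots> = (\<integral>\<^sup>+ \<omega>. (kop lborel k ^^ n) (kop lborel k f) (X 0 \<omega>) \<partial>M)"
      using k.kop_measurable[of f] by (intro Suc.IH) simp
    finally show ?case by (simp add: funpow_swap1)
  qed simp
  also have "\<dots> = (\<integral>\<^sup>+ x. (kop lborel k ^^ n) f x \<partial>distr M borel (X 0))"
    using k.kop_funpow_measurable[of f n] by (subst nn_integral_distr) auto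
  finally show ?thesis .
qed

end

section \<open>The mean number of living cells\<close>

lemma nn_integral_exp_Ico:
  fixes a b :: real
  assumes "a \<le> b" "\<gamma> > 0"
  shows "(\<integral>\<^sup>+ s. ennreal (exp (- \<gamma> * s)) * indicator {a..<b} s \<partial>lborel)
    = ennreal ((exp (- \<gamma> * a) - exp (- \<gamma> * b)) / \<gamma>)"
proof -
  have "(\<integral>\<^sup>+ s. ennreal (exp (- \<gamma> * s)) * indicator {a..<b} s \<partial>lborel)
      = (\<integral>\<^sup>+ s. ennreal (exp (- \<gamma> * s)) * indicator {a..b} s \<partial>lborel)"
    by (rule nn_integral_cong_AE, rule AE_mp[OF AE_lborel_singleton[of b]]) (auto simp: indicator_def)
  also have "\<dots> = ennreal (- exp (- \<gamma> * b) / \<gamma> - - exp (- \<gamma> * a) / \<gamma>)"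
    using assms by (intro nn_integral_FTC_Icc) (auto intro!: derivative_eq_intros)
  finally show ?thesis by (simp add: diff_divide_distrib)
qed

context
  fixes \<xi> :: "real \<Rightarrow> real" and \<kappa> :: "real \<Rightarrow> nat"
  assumes xi_measurable [measurable]: "\<xi> \<in> borel_measurable borel"
    and xi_nonneg: "\<And>x. \<xi> x \<ge> 0"
    and kappa_measurable [measurable]: "\<kappa> \<in> measurable borel (count_space UNIV)"
    and kappa_ge2: "\<And>x. \<kappa> x \<ge> 2"
begin

text \<open>Whether a cell is alive depends only on the values at the prefixes of its label.
  Indexing them by generation instead of by label makes the event one about a single line of
  descent, whose law is known.\<close>

definition path_alive :: "real \<Rightarrow> label \<Rightarrow> (nat \<Rightarrow> real) \<Rightarrow> bool" where
  "path_alive t v x \<longleftrightarrow> (\<forall>i<length v. 1 \<le> v ! i \<and> v ! i \<le> \<kappa> (x i)) \<and>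
     (\<Sum>i<length v. \<xi> (x i)) \<le> t \<and> t < (\<Sum>i<Suc (length v). \<xi> (x i))"

definition path_labels :: "nat \<Rightarrow> (nat \<Rightarrow> real) \<Rightarrow> label set" where
  "path_labels n x = {v. length v = n \<and> (\<forall>i<n. 1 \<le> v ! i \<and> v ! i \<le> \<kappa> (x i))}"

lemma alive_iff_path_alive: "v \<in> alive \<xi> \<kappa> x t \<longleftrightarrow> path_alive t v (\<lambda>i. x (take i v))"
  by (auto simp: alive_def path_alive_def cell_exists_def birth_time_def)

lemma path_labels_Suc: "path_labels (Suc n) x = (\<lambda>(v, k). v @ [k]) ` (path_labels n x \<times> {1..\<kappa> (x n)})"
proof (intro set_eqI iffI)
  fix v assume v: "v \<in> path_labels (Suc n) x"
  then obtain u k where "v = u @ [k]"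
    by (cases v rule: rev_cases) (auto simp: path_labels_def)
  moreover have "1 \<le> u ! i \<and> u ! i \<le> \<kappa> (x i)" if "i < n" for i
    using v that \<open>v = u @ [k]\<close> by (auto simp: path_labels_def nth_append dest!: spec[of _ i])
  moreover have "1 \<le> k \<and> k \<le> \<kappa> (x n)"
    using v \<open>v = u @ [k]\<close> by (auto simp: path_labels_def nth_append dest!: spec[of _ n])
  ultimately show "v \<in> (\<lambda>(v, k). v @ [k]) ` (path_labels n x \<times> {1..\<kappa> (x n)})"
    using v by (auto simp: path_labels_def)
next
  fix v assume "v \<in> (\<lambda>(v, k). v @ [k]) ` (path_labels n x \<times> {1..\<kappa> (x n)})"
  then show "v \<in> path_labels (Suc n) x"
    by (auto simp: path_labels_def nth_append less_Suc_eq)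
qed

lemma card_path_labels: "finite (path_labels n x) \<and> card (path_labels n x) = (\<Prod>i<n. \<kappa> (x i))"
proof (induction n)
  case 0
  have "path_labels 0 x = {[]}" by (auto simp: path_labels_def)
  then show ?case by simp
next
  case (Suc n)
  have "inj_on (\<lambda>(v, k). v @ [k]) (path_labels n x \<times> {1..\<kappa> (x n)})" by (auto simp: inj_on_def)
  then show ?case using Suc by (simp add: path_labels_Suc card_image card_cartesian_product)
qed

text \<open>When all labels read the same path \<open>x\<close>, the cells of generation
  \<open>n\<close> are alive simultaneously, and their number is the product of the \<kappa> values
  before \<open>n\<close>.\<close>

definition generation_alive :: "real \<Rightarrow> (nat \<Rightarrow> real) \<Rightarrow> nat \<Rightarrow> ennreal" where
  "generation_alive t x n = ennreal (\<Prod>i<n. real (\<kappa> (x i))) *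
     indicator {(\<Sum>i<n. \<xi> (x i))..<(\<Sum>i<Suc n. \<xi> (x i))} t"

lemma count_path_alive:
  "emeasure (count_space UNIV) {v. path_alive t v x} = (\<Sum>n. generation_alive t x n)"
proof -
  have "{v. path_alive t v x} = (\<Union>n. {v. length v = n \<and> path_alive t v x})" by auto
  moreover have "emeasure (count_space UNIV) (\<Union>n. {v. length v = n \<and> path_alive t v x})
      = (\<Sum>n. emeasure (count_space UNIV) {v. length v = n \<and> path_alive t v x})"
    by (rule suminf_emeasure[symmetric]) (auto simp: disjoint_family_on_def)
  moreover have "emeasure (count_space UNIV) {v. length v = n \<and> path_alive t v x} = generation_alive t x n" for n
  proof (cases "t \<in> {(\<Sum>i<n. \<xi> (x i))..<(\<Sum>i<Suc n. \<xi> (x i))}")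
    case True
    then have "{v. length v = n \<and> path_alive t v x} = path_labels n x"
      by (auto simp: path_alive_def path_labels_def)
    then show ?thesis using True card_path_labels[of n x]
      by (simp add: emeasure_count_space_finite generation_alive_def of_nat_prod ennreal_of_nat_eq_real_of_nat del: sum.lessThan_Suc)
  next
    case False
    then have "{v. length v = n \<and> path_alive t v x} = {}" by (auto simp: path_alive_def)
    then show ?thesis using False by (simp only: generation_alive_def) simp
  qed
  ultimately show ?thesis by simp
qed

context
  fixes M :: "'a measure" and X :: "nat \<Rightarrow> 'a \<Rightarrow> real"
  assumes prob_M: "prob_space M" and X_measurable [measurable]: "\<And>n. X n \<in> borel_measurable M"
begin

text \<open>A many-to-one formula. Expectation is linear over labels, so each label contributes a
  probability that involves only its own line of descent, and the joint law of different lines is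
  irrelevant. Once that law is replaced by the law of \<open>X\<close>, the sum over labels is taken
  back inside the expectation.\<close>

lemma mean_alive_eq:
  assumes "branching_family M X W Y"
  shows "mean_alive W Y \<xi> \<kappa> t = (\<integral>\<^sup>+ \<omega>. (\<Sum>n. generation_alive t (\<lambda>n. X n \<omega>) n) \<partial>M)"
proof -
  from assms interpret W: prob_space W by (simp add: branching_family_def)
  interpret M: prob_space M by (rule prob_M)
  interpret C: sigma_finite_measure "count_space (UNIV :: label set)"
    by (rule sigma_finite_measure_count_space_countable) simp
  have Y_meas: "Y v \<in> borel_measurable W" if "v \<in> labels" for v
    using assms that by (simp add: branching_family_def)
  have law: "distr W (PiM UNIV (\<lambda>_. borel)) (\<lambda>\<omega> n. Y (map k [0..<n]) \<omega>)
      = distr M (PiM UNIV (\<lambda>_. borel)) (\<lambda>\<omega> n. X n \<omega>)" if "\<forall>i. 1 \<le> k i" for k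
    using assms that by (simp add: branching_family_def)
  have path_meas [measurable]: "Measurable.pred (PiM UNIV (\<lambda>_. borel)) (path_alive t v)" for v
    unfolding path_alive_def[abs_def] by measurable
  define ind where "ind v x = (indicator {x. path_alive t v x} x :: ennreal)" for v x
  have ind_meas [measurable]: "ind v \<in> borel_measurable (PiM UNIV (\<lambda>_. borel))" for v
    unfolding ind_def[abs_def] by measurable
  have key: "(\<lambda>\<omega>. ind v (\<lambda>i. Y (take i v) \<omega>)) \<in> borel_measurable W \<and>
      (\<integral>\<^sup>+ \<omega>. ind v (\<lambda>i. Y (take i v) \<omega>) \<partial>W) = (\<integral>\<^sup>+ \<omega>. ind v (\<lambda>n. X n \<omega>) \<partial>M)" for v
  proof (cases "v \<in> labels")
    case True
    \<comment> \<open>The law is given along infinite lines, so the label is prolonged by 1, an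
      arbitrary positive integer.\<close>
    define k where "k i = (if i < length v then v ! i else 1)" for i
    have k: "\<forall>i. 1 \<le> k i" using True by (auto simp: k_def labels_def)
    have take: "map k [0..<i] = take i v" if "i \<le> length v" for i
      using that by (intro nth_equalityI) (auto simp: k_def)
    have eq: "ind v (\<lambda>i. Y (take i v) \<omega>) = ind v (\<lambda>n. Y (map k [0..<n]) \<omega>)" for \<omega>
    proof -
      have "(\<Sum>i<m. \<xi> (Y (take i v) \<omega>)) = (\<Sum>i<m. \<xi> (Y (map k [0..<i]) \<omega>))" if "m \<le> Suc (length v)" for m
        using that by (intro sum.cong) (auto simp: take)
      then have "path_alive t v (\<lambda>i. Y (take i v) \<omega>) \<longleftrightarrow> path_alive t v (\<lambda>n. Y (map k [0..<n]) \<omega>)"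
        unfolding path_alive_def by (simp add: take del: sum.lessThan_Suc)
      then show ?thesis by (simp add: ind_def indicator_def)
    qed
    have "map k [0..<n] \<in> labels" for n using k by (auto simp: labels_def)
    then have [measurable]: "(\<lambda>\<omega> n. Y (map k [0..<n]) \<omega>) \<in> measurable W (PiM UNIV (\<lambda>_. borel))"
      by (intro measurable_PiM_single') (auto intro: Y_meas)
    have [measurable]: "(\<lambda>\<omega> n. X n \<omega>) \<in> measurable M (PiM UNIV (\<lambda>_. borel))"
      by (intro measurable_PiM_single') auto
    have "(\<integral>\<^sup>+ \<omega>. ind v (\<lambda>n. Y (map k [0..<n]) \<omega>) \<partial>W)
        = integral\<^sup>N (distr W (PiM UNIV (\<lambda>_. borel)) (\<lambda>\<omega> n. Y (map k [0..<n]) \<omega>)) (ind v)"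
      by (simp add: nn_integral_distr)
    also have "\<dots> = (\<integral>\<^sup>+ \<omega>. ind v (\<lambda>n. X n \<omega>) \<partial>M)"
      unfolding law[OF k] by (simp add: nn_integral_distr)
    finally show ?thesis unfolding eq by simp
  next
    \<comment> \<open>A label with an entry 0 never belongs to an existing cell, so both sides
      vanish.\<close>
    case False
    then have "\<not> path_alive t v x" for x
      by (fastforce simp: labels_def path_alive_def in_set_conv_nth)
    then show ?thesis by (simp add: ind_def)
  qed
  have count: "emeasure (count_space UNIV) A = (\<integral>\<^sup>+ v. indicator A v \<partial>count_space UNIV)" for A :: "label set"
    by simp
  have "mean_alive W Y \<xi> \<kappa> t = (\<integral>\<^sup>+ \<omega>. \<integral>\<^sup>+ v. ind v (\<lambda>i. Y (take i v) \<omega>) \<partial>count_space UNIV \<partial>W)"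
    unfolding mean_alive_def N_alive_def count
    by (intro nn_integral_cong) (simp add: ind_def indicator_def alive_iff_path_alive)
  also have "\<dots> = (\<integral>\<^sup>+ v. \<integral>\<^sup>+ \<omega>. ind v (\<lambda>i. Y (take i v) \<omega>) \<partial>W \<partial>count_space UNIV)"
  proof (rule pair_sigma_finite.Fubini')
    show "pair_sigma_finite (count_space (UNIV :: label set)) W"
      by (rule pair_sigma_finite.intro[OF C.sigma_finite_measure_axioms W.sigma_finite_measure_axioms])
    show "(\<lambda>(v, \<omega>). ind v (\<lambda>i. Y (take i v) \<omega>)) \<in> borel_measurable (count_space UNIV \<Otimes>\<^sub>M W)"
      by (rule measurable_pair_measure_countable1) (use key in auto)
  qed
  also have "\<dots> = (\<integral>\<^sup>+ v. \<integral>\<^sup>+ \<omega>. ind v (\<lambda>n. X n \<omega>) \<partial>M \<partial>count_space UNIV)"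
    using key by simp
  also have "\<dots> = (\<integral>\<^sup>+ \<omega>. \<integral>\<^sup>+ v. ind v (\<lambda>n. X n \<omega>) \<partial>count_space UNIV \<partial>M)"
  proof (rule pair_sigma_finite.Fubini'[symmetric])
    show "pair_sigma_finite (count_space (UNIV :: label set)) M"
      by (rule pair_sigma_finite.intro[OF C.sigma_finite_measure_axioms M.sigma_finite_measure_axioms])
    have [measurable]: "(\<lambda>\<omega> n. X n \<omega>) \<in> measurable M (PiM UNIV (\<lambda>_. borel))"
      by (intro measurable_PiM_single') auto
    show "(\<lambda>(v, \<omega>). ind v (\<lambda>n. X n \<omega>)) \<in> borel_measurable (count_space UNIV \<Otimes>\<^sub>M M)"
      by (rule measurable_pair_measure_countable1) auto
  qed
  also have "\<dots> = (\<integral>\<^sup>+ \<omega>. (\<Sum>n. generation_alive t (\<lambda>n. X n \<omega>) n) \<partial>M)"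
  proof (rule nn_integral_cong)
    fix \<omega>
    have "(\<integral>\<^sup>+ v. ind v (\<lambda>n. X n \<omega>) \<partial>count_space UNIV)
        = (\<integral>\<^sup>+ v. indicator {v. path_alive t v (\<lambda>n. X n \<omega>)} v \<partial>count_space UNIV)"
      by (simp add: ind_def indicator_def)
    then show "(\<integral>\<^sup>+ v. ind v (\<lambda>n. X n \<omega>) \<partial>count_space UNIV) = (\<Sum>n. generation_alive t (\<lambda>n. X n \<omega>) n)"
      unfolding count[symmetric] count_path_alive .
  qed
  finally show ?thesis .
qed

lemma generation_alive_measurable [measurable]:
  "(\<lambda>(t, \<omega>). generation_alive t (\<lambda>n. X n \<omega>) n) \<in> borel_measurable (borel \<Otimes>\<^sub>M M)"
proof -
  have "(\<lambda>(t, \<omega>). generation_alive t (\<lambda>n. X n \<omega>) n) = (\<lambda>(t, \<omega>). ennreal (\<Prod>i<n. real (\<kappa> (X i \<omega>))) *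
      (if (\<Sum>i<n. \<xi> (X i \<omega>)) \<le> t \<and> t < (\<Sum>i<Suc n. \<xi> (X i \<omega>)) then 1 else 0))"
    by (auto simp: generation_alive_def indicator_def fun_eq_iff)
  also have "\<dots> \<in> borel_measurable (borel \<Otimes>\<^sub>M M)" by measurable
  finally show ?thesis .
qed

lemma mean_alive_measurable:
  assumes "branching_family M X W Y"
  shows "mean_alive W Y \<xi> \<kappa> \<in> borel_measurable borel"
proof -
  interpret M: prob_space M by (rule prob_M)
  show ?thesis unfolding mean_alive_eq[OF assms, abs_def] by measurable
qed

text \<open>Telescoping over the generations without subtraction: \<open>A n = D n + B n\<close> and
  \<open>A (n + 1) = gn n + B n\<close>, and \<open>A n\<close> vanishes in the limit since \<open>B n \<le> gn n\<close>.\<close>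

lemma Laplace_mean_alive:
  assumes br: "branching_family M X W Y" and g: "\<gamma> > 0" and fin: "G_fun M X \<xi> \<kappa> \<gamma> < \<top>"
  shows "(\<integral>\<^sup>+ s. ennreal (exp (- \<gamma> * s)) * (mean_alive W Y \<xi> \<kappa> s * indicator {0..} s) \<partial>lborel)
    = ennreal (1 / \<gamma>) * (1 + G_fun M X \<xi> \<kappa> \<gamma>)"
proof -
  interpret M: prob_space M by (rule prob_M)
  have [measurable]: "(\<lambda>x. real (\<kappa> x)) \<in> borel_measurable borel" by measurable
  define S where "S n \<omega> = (\<Sum>i<n. \<xi> (X i \<omega>))" for n \<omega>
  define kp where "kp n \<omega> = (\<Prod>i<n. real (\<kappa> (X i \<omega>)))" for n \<omega>
  have [measurable]: "S n \<in> borel_measurable M" "kp n \<in> borel_measurable M" for n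
    unfolding S_def[abs_def] kp_def[abs_def] by measurable
  have S0: "S n \<omega> \<ge> 0" and S_Suc: "S n \<omega> \<le> S (Suc n) \<omega>" for n \<omega>
    unfolding S_def using xi_nonneg by (auto intro: sum_nonneg)
  have Pi0: "kp n \<omega> \<ge> 0" for n \<omega> unfolding kp_def by (auto intro: prod_nonneg)
  \<comment> \<open>\<open>A n\<close> discounts generation \<open>n\<close> at its birth,
    \<open>B n\<close> at its death; \<open>D n\<close>, divided by \<gamma>, is the Laplace
    transform of the time it is alive.\<close>
  define A where "A n = (\<integral>\<^sup>+ \<omega>. ennreal (kp n \<omega> * exp (- \<gamma> * S n \<omega>)) \<partial>M)" for n
  define B where "B n = (\<integral>\<^sup>+ \<omega>. ennreal (kp n \<omega> * exp (- \<gamma> * S (Suc n) \<omega>)) \<partial>M)" for n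
  define D where "D n = (\<integral>\<^sup>+ \<omega>. ennreal (kp n \<omega> * (exp (- \<gamma> * S n \<omega>) - exp (- \<gamma> * S (Suc n) \<omega>))) \<partial>M)" for n
  define gn where "gn n = g_fun M X \<xi> \<kappa> n \<gamma>" for n
  have exp_le: "exp (- \<gamma> * S (Suc n) \<omega>) \<le> exp (- \<gamma> * S n \<omega>)" for n \<omega>
    using S_Suc g by (simp add: mult_left_mono)
  have gn_eq: "gn n = (\<integral>\<^sup>+ \<omega>. ennreal (kp n \<omega> * (real (\<kappa> (X n \<omega>)) - 1) * exp (- \<gamma> * S (Suc n) \<omega>)) \<partial>M)" for n
    unfolding gn_def g_fun_def S_sum_def kp_def S_def lessThan_Suc_atMost by simp
  have k2: "real (\<kappa> x) \<ge> 2" for x using kappa_ge2[of x] by linarith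
  have A0: "A 0 = 1" unfolding A_def by (simp add: kp_def S_def M.emeasure_space_1)
  have AD: "A n = D n + B n" for n
    unfolding A_def D_def B_def
  proof (subst nn_integral_add[symmetric])
    show "(\<integral>\<^sup>+ \<omega>. ennreal (kp n \<omega> * exp (- \<gamma> * S n \<omega>)) \<partial>M)
      = (\<integral>\<^sup>+ \<omega>. ennreal (kp n \<omega> * (exp (- \<gamma> * S n \<omega>) - exp (- \<gamma> * S (Suc n) \<omega>)))
          + ennreal (kp n \<omega> * exp (- \<gamma> * S (Suc n) \<omega>)) \<partial>M)"
      using Pi0 exp_le by (subst ennreal_plus[symmetric]) (auto simp: algebra_simps mult_left_mono)
  qed measurable
  have AS: "A (Suc n) = gn n + B n" for n
    unfolding A_def gn_eq B_def
  proof (subst nn_integral_add[symmetric])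
    have "kp (Suc n) \<omega> * exp (- \<gamma> * S (Suc n) \<omega>)
        = kp n \<omega> * (real (\<kappa> (X n \<omega>)) - 1) * exp (- \<gamma> * S (Suc n) \<omega>) + kp n \<omega> * exp (- \<gamma> * S (Suc n) \<omega>)" for \<omega>
      unfolding kp_def by (simp add: algebra_simps)
    moreover have "0 \<le> kp n \<omega> * (real (\<kappa> (X n \<omega>)) - 1) * exp (- \<gamma> * S (Suc n) \<omega>)" for \<omega>
      using Pi0[of n \<omega>] k2[of "X n \<omega>"] by simp
    ultimately show "(\<integral>\<^sup>+ \<omega>. ennreal (kp (Suc n) \<omega> * exp (- \<gamma> * S (Suc n) \<omega>)) \<partial>M)
      = (\<integral>\<^sup>+ \<omega>. ennreal (kp n \<omega> * (real (\<kappa> (X n \<omega>)) - 1) * exp (- \<gamma> * S (Suc n) \<omega>))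
          + ennreal (kp n \<omega> * exp (- \<gamma> * S (Suc n) \<omega>)) \<partial>M)"
      using Pi0 by (simp add: ennreal_plus[symmetric] del: ennreal_plus)
  qed measurable
  have Bg: "B n \<le> gn n" for n
    unfolding B_def gn_eq
  proof (intro nn_integral_mono ennreal_leI mult_right_mono)
    show "kp n \<omega> \<le> kp n \<omega> * (real (\<kappa> (X n \<omega>)) - 1)" for \<omega>
      using Pi0[of n \<omega>] k2[of "X n \<omega>"] by (simp add: mult_le_cancel_left1)
  qed simp
  have tele: "(\<Sum>i<n. D i) + A n = 1 + (\<Sum>i<n. gn i)" for n
  proof (induction n)
    case (Suc n)
    have "(\<Sum>i<Suc n. D i) + A (Suc n) = ((\<Sum>i<n. D i) + A n) + gn n"
      by (simp add: AS AD[of n] ac_simps)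
    also have "\<dots> = 1 + (\<Sum>i<Suc n. gn i)" unfolding Suc.IH by (simp only: sum.lessThan_Suc add.assoc)
    finally show ?case .
  qed (simp add: A0)
  have G: "G_fun M X \<xi> \<kappa> \<gamma> = (\<Sum>n. gn n)" by (simp add: G_fun_def gn_def)
  have gn_fin: "gn n < \<top>" for n
    using fin unfolding G by (rule ennreal_suminf_lessD)
  have gn_0: "gn \<longlonglongrightarrow> 0"
  proof -
    have eq: "ennreal (enn2real (gn n)) = gn n" for n using gn_fin[of n] by simp
    have "summable (\<lambda>n. enn2real (gn n))"
      using fin unfolding G by (intro summable_suminf_not_top) (auto simp only: eq enn2real_nonneg)
    then have "(\<lambda>n. ennreal (enn2real (gn n))) \<longlonglongrightarrow> ennreal 0"
      by (intro tendsto_ennrealI summable_LIMSEQ_zero)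
    then show ?thesis by (simp only: eq ennreal_0)
  qed
  have "A \<longlonglongrightarrow> 0"
  proof (rule LIMSEQ_imp_Suc, rule tendsto_sandwich[OF _ _ tendsto_const])
    show "(\<lambda>n. gn n + gn n) \<longlonglongrightarrow> 0" using tendsto_add[OF gn_0 gn_0] by simp
    show "\<forall>\<^sub>F n in sequentially. A (Suc n) \<le> gn n + gn n"
      by (simp add: AS add_left_mono Bg)
  qed simp
  then have "(\<lambda>n. (\<Sum>i<n. D i) + A n) \<longlonglongrightarrow> (\<Sum>n. D n) + 0"
    by (intro tendsto_add summable_LIMSEQ) auto
  moreover have "(\<lambda>n. 1 + (\<Sum>i<n. gn i)) \<longlonglongrightarrow> 1 + (\<Sum>n. gn n)"
    by (intro tendsto_add tendsto_const summable_LIMSEQ) auto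
  ultimately have sum_D: "(\<Sum>n. D n) = 1 + G_fun M X \<xi> \<kappa> \<gamma>"
    unfolding tele G using LIMSEQ_unique by fastforce
  have "(\<integral>\<^sup>+ s. ennreal (exp (- \<gamma> * s)) * (mean_alive W Y \<xi> \<kappa> s * indicator {0..} s) \<partial>lborel)
      = (\<integral>\<^sup>+ s. (\<integral>\<^sup>+ \<omega>. (\<Sum>n. ennreal (exp (- \<gamma> * s)) * generation_alive s (\<lambda>n. X n \<omega>) n) \<partial>M) \<partial>lborel)"
  proof (rule nn_integral_cong)
    fix s :: real
    have [measurable]: "(\<lambda>\<omega>. generation_alive s (\<lambda>n. X n \<omega>) n) \<in> borel_measurable M" for n
      using measurable_compose[OF measurable_Pair1' generation_alive_measurable, of s n] by simp
    have "generation_alive s (\<lambda>n. X n \<omega>) n * indicator {0..} s = generation_alive s (\<lambda>n. X n \<omega>) n" for \<omega> n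
      using S0[of n \<omega>] unfolding generation_alive_def S_def by (auto simp: indicator_def)
    then have "(\<Sum>n. generation_alive s (\<lambda>n. X n \<omega>) n) * indicator {0..} s
        = (\<Sum>n. generation_alive s (\<lambda>n. X n \<omega>) n)" for \<omega>
      by (simp add: ennreal_suminf_multc[symmetric])
    then have "mean_alive W Y \<xi> \<kappa> s * indicator {0..} s = (\<integral>\<^sup>+ \<omega>. (\<Sum>n. generation_alive s (\<lambda>n. X n \<omega>) n) \<partial>M)"
      unfolding mean_alive_eq[OF br] by (subst nn_integral_multc[symmetric]) auto
    then show "ennreal (exp (- \<gamma> * s)) * (mean_alive W Y \<xi> \<kappa> s * indicator {0..} s)
        = (\<integral>\<^sup>+ \<omega>. (\<Sum>n. ennreal (exp (- \<gamma> * s)) * generation_alive s (\<lambda>n. X n \<omega>) n) \<partial>M)"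
      by (simp add: nn_integral_cmult)
  qed
  also have "\<dots> = (\<integral>\<^sup>+ \<omega>. (\<integral>\<^sup>+ s. (\<Sum>n. ennreal (exp (- \<gamma> * s)) * generation_alive s (\<lambda>n. X n \<omega>) n) \<partial>lborel) \<partial>M)"
    by (rule pair_sigma_finite.Fubini'[symmetric])
      (auto intro!: pair_sigma_finite.intro lborel.sigma_finite_measure_axioms M.sigma_finite_measure_axioms)
  also have "\<dots> = (\<integral>\<^sup>+ \<omega>. (\<Sum>n. ennreal (1 / \<gamma>) *
      ennreal (kp n \<omega> * (exp (- \<gamma> * S n \<omega>) - exp (- \<gamma> * S (Suc n) \<omega>)))) \<partial>M)"
  proof (rule nn_integral_cong)
    fix \<omega>
    have "(\<integral>\<^sup>+ s. (\<Sum>n. ennreal (exp (- \<gamma> * s)) * generation_alive s (\<lambda>n. X n \<omega>) n) \<partial>lborel)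
        = (\<Sum>n. \<integral>\<^sup>+ s. ennreal (exp (- \<gamma> * s)) * generation_alive s (\<lambda>n. X n \<omega>) n \<partial>lborel)"
      unfolding generation_alive_def by (intro nn_integral_suminf) measurable
    also have "\<dots> = (\<Sum>n. ennreal (1 / \<gamma>) * ennreal (kp n \<omega> * (exp (- \<gamma> * S n \<omega>) - exp (- \<gamma> * S (Suc n) \<omega>))))"
    proof (rule suminf_cong)
      fix n
      have "(\<integral>\<^sup>+ s. ennreal (exp (- \<gamma> * s)) * generation_alive s (\<lambda>n. X n \<omega>) n \<partial>lborel)
          = (\<integral>\<^sup>+ s. ennreal (kp n \<omega>) * (ennreal (exp (- \<gamma> * s)) * indicator {S n \<omega>..<S (Suc n) \<omega>} s) \<partial>lborel)"
        unfolding generation_alive_def S_def kp_def by (simp add: ac_simps)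
      also have "\<dots> = ennreal (kp n \<omega>) * ennreal ((exp (- \<gamma> * S n \<omega>) - exp (- \<gamma> * S (Suc n) \<omega>)) / \<gamma>)"
        by (simp add: nn_integral_cmult nn_integral_exp_Ico[OF S_Suc g, simplified])
      also have "\<dots> = ennreal (1 / \<gamma> * (kp n \<omega> * (exp (- \<gamma> * S n \<omega>) - exp (- \<gamma> * S (Suc n) \<omega>))))"
        using Pi0[of n \<omega>] by (subst ennreal_mult'[symmetric]) auto
      also have "\<dots> = ennreal (1 / \<gamma>) * ennreal (kp n \<omega> * (exp (- \<gamma> * S n \<omega>) - exp (- \<gamma> * S (Suc n) \<omega>)))"
        using g by (intro ennreal_mult') simp
      finally show "(\<integral>\<^sup>+ s. ennreal (exp (- \<gamma> * s)) * generation_alive s (\<lambda>n. X n \<omega>) n \<partial>lborel)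
          = ennreal (1 / \<gamma>) * ennreal (kp n \<omega> * (exp (- \<gamma> * S n \<omega>) - exp (- \<gamma> * S (Suc n) \<omega>)))" .
    qed
    finally show "(\<integral>\<^sup>+ s. (\<Sum>n. ennreal (exp (- \<gamma> * s)) * generation_alive s (\<lambda>n. X n \<omega>) n) \<partial>lborel)
        = (\<Sum>n. ennreal (1 / \<gamma>) * ennreal (kp n \<omega> * (exp (- \<gamma> * S n \<omega>) - exp (- \<gamma> * S (Suc n) \<omega>))))" .
  qed
  also have "\<dots> = ennreal (1 / \<gamma>) * (\<Sum>n. D n)"
    unfolding D_def by (simp add: nn_integral_suminf nn_integral_cmult)
  finally show ?thesis unfolding sum_D .
qed

end

end

section \<open>Karamata's Tauberian theorem\<close>

lemma integral_inverse:
  assumes "0 < c" "c \<le> (1::real)"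
  shows "((\<lambda>x. 1 / x) has_integral (- ln c)) {c..1}"
proof -
  have "((\<lambda>x. 1 / x) has_integral (ln 1 - ln c)) {c..1}"
    by (rule fundamental_theorem_of_calculus)
      (use assms in \<open>auto simp: has_real_derivative_iff_has_vector_derivative[symmetric]
        intro!: derivative_eq_intros\<close>)
  then show ?thesis by simp
qed

text \<open>Zero up to \<open>a\<close>, equal to \<open>1 / x\<close> from \<open>b\<close> on,
  with a linear ramp as factor in between; \<open>max x a\<close> removes the singularity at
  0.\<close>

definition cutoff :: "real \<Rightarrow> real \<Rightarrow> real \<Rightarrow> real" where
  "cutoff a b x = 1 / max x a * min 1 (max 0 ((x - a) / (b - a)))"

context
  fixes a b :: real
  assumes ab: "0 < a" "a < b"
begin

lemma continuous_cutoff: "continuous_on A (cutoff a b)"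
  unfolding cutoff_def using ab by (intro continuous_intros) auto

lemma cutoff_nonneg: "0 \<le> cutoff a b x"
  unfolding cutoff_def using ab by auto

lemma cutoff_eq_0: "x \<le> a \<Longrightarrow> cutoff a b x = 0"
  unfolding cutoff_def using ab by (simp add: divide_le_0_iff max_absorb1)

lemma cutoff_eq: "b \<le> x \<Longrightarrow> cutoff a b x = 1 / x"
  unfolding cutoff_def using ab by (simp add: max_absorb1 max_absorb2 min_absorb1)

lemma cutoff_le: "a \<le> x \<Longrightarrow> cutoff a b x \<le> 1 / x"
  unfolding cutoff_def using ab by (simp add: max_absorb1 divide_le_cancel)

lemma integrable_cutoff: "cutoff a b integrable_on {c..d}"
  by (intro integrable_continuous_interval continuous_cutoff)

text \<open>On \<open>[0, 1]\<close> the function lies between the restrictions of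
  \<open>1 / x\<close> to \<open>[b, 1]\<close> and to \<open>[a, 1]\<close>.\<close>

lemma integral_cutoff_bounds:
  assumes "b \<le> 1"
  shows "integral {0..1} (cutoff a b) \<le> - ln a" "integral {0..1} (cutoff a b) \<ge> - ln b"
proof -
  have "integral {0..1} (cutoff a b) = integral {0..a} (cutoff a b) + integral {a..1} (cutoff a b)"
    using ab assms by (intro Henstock_Kurzweil_Integration.integral_combine[symmetric] integrable_cutoff) auto
  also have "integral {0..a} (cutoff a b) = integral {0..a} (\<lambda>_. 0)"
    by (intro integral_cong cutoff_eq_0) auto
  also have "integral {a..1} (cutoff a b) \<le> - ln a"
    by (rule has_integral_le[OF integrable_integral[OF integrable_cutoff] integral_inverse])
      (use ab assms in \<open>auto intro: cutoff_le\<close>)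
  finally show "integral {0..1} (cutoff a b) \<le> - ln a" by simp
  have "- ln b \<le> integral {b..1} (cutoff a b)"
    by (rule has_integral_le[OF integral_inverse integrable_integral[OF integrable_cutoff]])
      (use ab assms in \<open>auto simp: cutoff_eq\<close>)
  also have "\<dots> \<le> integral {0..b} (cutoff a b) + integral {b..1} (cutoff a b)"
    using integral_nonneg[OF integrable_cutoff] cutoff_nonneg by simp
  also have "\<dots> = integral {0..1} (cutoff a b)"
    using ab assms by (intro Henstock_Kurzweil_Integration.integral_combine integrable_cutoff) auto
  finally show "integral {0..1} (cutoff a b) \<ge> - ln b" .
qed

end

text \<open>Karamata's proof: along \<open>\<gamma> \<rightarrow> 0\<close> the moments of the image of \<open>\<gamma> e\<^sup>-\<^sup>\<gamma>\<^sup>s m(ds)\<close> under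
  \<open>s \<mapsto> e\<^sup>-\<^sup>\<gamma>\<^sup>s\<close> converge to those of \<open>C\<close> times Lebesgue measure on \<open>[0, 1]\<close>; test this against
  \<open>x \<mapsto> 1 / x\<close> cut off at \<open>1 / e\<close>.\<close>

locale karamata =
  fixes m :: "real measure" and C :: real
  assumes sets_m [measurable_cong]: "sets m = sets borel"
    and supp: "AE s in m. 0 \<le> s"
    and C_nonneg: "C \<ge> 0"
    and lim: "((\<lambda>\<gamma>. ennreal \<gamma> * (\<integral>\<^sup>+ s. ennreal (exp (- \<gamma> * s)) \<partial>m)) \<longlongrightarrow> ennreal C) (at_right 0)"
begin

definition I :: "real \<Rightarrow> (real \<Rightarrow> real) \<Rightarrow> real" where
  "I \<gamma> g = \<gamma> * (\<integral> s. exp (- \<gamma> * s) * g (exp (- \<gamma> * s)) \<partial>m)"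

lemma finite_Laplace: "eventually (\<lambda>\<gamma>. (\<integral>\<^sup>+ s. ennreal (exp (- \<gamma> * s)) \<partial>m) < \<top>) (at_right 0)"
proof -
  have "eventually (\<lambda>\<gamma>. ennreal \<gamma> * (\<integral>\<^sup>+ s. ennreal (exp (- \<gamma> * s)) \<partial>m) < \<top>) (at_right 0)"
    using lim by (rule order_tendstoD) simp
  moreover have "eventually (\<lambda>\<gamma>::real. \<gamma> > 0) (at_right 0)" by (simp add: eventually_at_right_less)
  ultimately show ?thesis
    by eventually_elim (auto simp: ennreal_mult_less_top)
qed

lemma integrable_exp:
  assumes "(\<integral>\<^sup>+ s. ennreal (exp (- \<gamma> * s)) \<partial>m) < \<top>"
  shows "integrable m (\<lambda>s. exp (- \<gamma> * s))"
  using assms by (intro integrableI_bounded) auto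

lemma exp_in_01: "\<gamma> \<ge> 0 \<Longrightarrow> AE s in m. exp (- \<gamma> * s) \<in> {0..1}"
  using supp by eventually_elim auto

lemma integrable_I:
  assumes "integrable m (\<lambda>s. exp (- \<gamma> * s))" "\<gamma> \<ge> 0"
    and [measurable]: "g \<in> borel_measurable borel" and B: "\<And>x. x \<in> {0..1} \<Longrightarrow> \<bar>g x\<bar> \<le> B"
  shows "integrable m (\<lambda>s. exp (- \<gamma> * s) * g (exp (- \<gamma> * s)))"
proof (rule Bochner_Integration.integrable_bound)
  show "integrable m (\<lambda>s. B * exp (- \<gamma> * s))" using assms(1) by simp
  have "B \<ge> 0" using B[of 0] by auto
  show "AE s in m. norm (exp (- \<gamma> * s) * g (exp (- \<gamma> * s))) \<le> norm (B * exp (- \<gamma> * s))"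
    using exp_in_01[OF assms(2)] 
  proof eventually_elim
    case (elim s)
    have "exp (- \<gamma> * s) * \<bar>g (exp (- \<gamma> * s))\<bar> \<le> exp (- \<gamma> * s) * B"
      using B[OF elim] by (intro mult_left_mono) auto
    then show ?case using \<open>B \<ge> 0\<close> by (simp add: abs_mult mult.commute)
  qed
qed simp

section \<open>Convergence on constants, powers, polynomials and continuous functions\<close>

lemma I_one_tendsto: "((\<lambda>\<gamma>. \<gamma> * (\<integral> s. exp (- \<gamma> * s) \<partial>m)) \<longlongrightarrow> C) (at_right 0)"
proof -
  have "((\<lambda>\<gamma>. ennreal (\<gamma> * (\<integral> s. exp (- \<gamma> * s) \<partial>m))) \<longlongrightarrow> ennreal C) (at_right 0)"
  proof (rule Lim_transform_eventually[OF lim])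
    have "eventually (\<lambda>\<gamma>::real. \<gamma> > 0) (at_right 0)" by (simp add: eventually_at_right_less)
    with finite_Laplace show "eventually (\<lambda>\<gamma>. ennreal \<gamma> * (\<integral>\<^sup>+ s. ennreal (exp (- \<gamma> * s)) \<partial>m)
        = ennreal (\<gamma> * (\<integral> s. exp (- \<gamma> * s) \<partial>m))) (at_right 0)"
    proof eventually_elim
      case (elim \<gamma>)
      have "(\<integral>\<^sup>+ s. ennreal (exp (- \<gamma> * s)) \<partial>m) = ennreal (\<integral> s. exp (- \<gamma> * s) \<partial>m)"
        by (rule nn_integral_eq_integral[OF integrable_exp[OF elim(1)]]) simp
      then show ?case using elim by (simp only: ennreal_mult less_imp_le integral_nonneg_AE AE_I2 exp_ge_zero)
    qed
  qed
  moreover have "eventually (\<lambda>\<gamma>. 0 \<le> \<gamma> * (\<integral> s. exp (- \<gamma> * s) \<partial>m)) (at_right 0)"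
    using eventually_at_right_less[of "0::real"] by eventually_elim auto
  ultimately show ?thesis using C_nonneg by (subst (asm) tendsto_ennreal_iff) auto
qed

text \<open>The integrand is \<open>exp (- (n + 1) \<gamma> s)\<close>, so the claim is the case of
  constants at the exponent \<open>(n + 1) \<gamma>\<close>, divided by \<open>n + 1\<close>. The
  number \<open>1 / (n + 1)\<close> is the moment of Lebesgue measure on
  \<open>[0, 1]\<close>.\<close>

lemma I_power_tendsto: "((\<lambda>\<gamma>. I \<gamma> (\<lambda>x. x ^ n)) \<longlongrightarrow> C / real (Suc n)) (at_right 0)"
proof -
  have "filterlim (\<lambda>\<gamma>. real (Suc n) * \<gamma>) (at_right 0) (at_right (0::real))"
  proof (rule filterlim_at_withinI)
    show "((\<lambda>\<gamma>. real (Suc n) * \<gamma>) \<longlongrightarrow> 0) (at_right (0::real))"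
      by (rule tendsto_eq_intros | simp)+
    show "eventually (\<lambda>\<gamma>::real. real (Suc n) * \<gamma> \<in> {0<..} - {0}) (at_right 0)"
      using eventually_at_right_less[of "0::real"] by eventually_elim auto
  qed
  from filterlim_compose[OF I_one_tendsto this]
  have "((\<lambda>\<gamma>. real (Suc n) * \<gamma> * (\<integral> s. exp (- (real (Suc n) * \<gamma>) * s) \<partial>m) / real (Suc n))
      \<longlongrightarrow> C / real (Suc n)) (at_right 0)"
    by (intro tendsto_divide tendsto_const) auto
  moreover have "real (Suc n) * \<gamma> * (\<integral> s. exp (- (real (Suc n) * \<gamma>) * s) \<partial>m) / real (Suc n) = I \<gamma> (\<lambda>x. x ^ n)" for \<gamma>
  proof -
    have "exp (- (real (Suc n) * \<gamma>) * s) = exp (- \<gamma> * s) * exp (- \<gamma> * s) ^ n" for s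
      by (simp add: exp_of_nat_mult[symmetric] exp_add[symmetric] algebra_simps)
    then show ?thesis unfolding I_def by simp
  qed
  ultimately show ?thesis by simp
qed

lemma I_polynomial_tendsto:
  "((\<lambda>\<gamma>. I \<gamma> (\<lambda>x. \<Sum>i\<le>n. c i * x ^ i)) \<longlongrightarrow> C * integral {0..1} (\<lambda>x. \<Sum>i\<le>n. c i * x ^ i)) (at_right 0)"
proof -
  have "((\<lambda>\<gamma>. \<Sum>i\<le>n. c i * I \<gamma> (\<lambda>x. x ^ i)) \<longlongrightarrow> (\<Sum>i\<le>n. c i * (C / real (Suc i)))) (at_right 0)"
    by (intro tendsto_sum tendsto_mult tendsto_const I_power_tendsto)
  moreover have "integral {0..1} (\<lambda>x. \<Sum>i\<le>n. c i * x ^ i) = (\<Sum>i\<le>n. c i * (1 / real (Suc i)))"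
  proof (rule integral_unique, intro has_integral_sum has_integral_mult_right)
    show "((\<lambda>x::real. x ^ i) has_integral 1 / real (Suc i)) {0..1}" for i
    proof -
      have "((\<lambda>x::real. x ^ i) has_integral (1 ^ Suc i / real (Suc i) - 0 ^ Suc i / real (Suc i))) {0..1}"
        by (rule fundamental_theorem_of_calculus)
          (auto simp: has_real_derivative_iff_has_vector_derivative[symmetric]
            simp del: of_nat_Suc power_Suc intro!: derivative_eq_intros)
      then show ?thesis by simp
    qed
  qed simp
  moreover have "eventually (\<lambda>\<gamma>. (\<Sum>i\<le>n. c i * I \<gamma> (\<lambda>x. x ^ i)) = I \<gamma> (\<lambda>x. \<Sum>i\<le>n. c i * x ^ i)) (at_right 0)"
    using finite_Laplace eventually_at_right_less[of "0::real"]
  proof eventually_elim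
    case (elim \<gamma>)
    have "integrable m (\<lambda>s. exp (- \<gamma> * s) * exp (- \<gamma> * s) ^ i)" for i
      using elim by (intro integrable_I[of \<gamma> "\<lambda>x. x ^ i" 1] integrable_exp) (auto simp: power_abs power_le_one)
    then show ?case unfolding I_def
      by (simp add: sum_distrib_left mult.left_commute Bochner_Integration.integral_sum)
  qed
  moreover have "C * (\<Sum>i\<le>n. c i * (1 / real (Suc i))) = (\<Sum>i\<le>n. c i * (C / real (Suc i)))"
    unfolding sum_distrib_left by (intro sum.cong) (simp_all add: mult.commute)
  ultimately show ?thesis by (simp only: Lim_transform_eventually)
qed

lemma I_mono:
  assumes "integrable m (\<lambda>s. exp (- \<gamma> * s))" "\<gamma> \<ge> 0"
    and [measurable]: "g \<in> borel_measurable borel" "h \<in> borel_measurable borel"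
    and "\<And>x. x \<in> {0..1} \<Longrightarrow> \<bar>g x\<bar> \<le> B" "\<And>x. x \<in> {0..1} \<Longrightarrow> \<bar>h x\<bar> \<le> B'"
    and le: "\<And>x. x \<in> {0..1} \<Longrightarrow> g x \<le> h x"
  shows "I \<gamma> g \<le> I \<gamma> h"
  unfolding I_def
proof (intro mult_left_mono integral_mono_AE)
  show "AE s in m. exp (- \<gamma> * s) * g (exp (- \<gamma> * s)) \<le> exp (- \<gamma> * s) * h (exp (- \<gamma> * s))"
    using exp_in_01[OF assms(2)] by eventually_elim (use le in auto)
  show "integrable m (\<lambda>s. exp (- \<gamma> * s) * g (exp (- \<gamma> * s)))"
    by (rule integrable_I[OF assms(1-3,5)])
  show "integrable m (\<lambda>s. exp (- \<gamma> * s) * h (exp (- \<gamma> * s)))"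
    by (rule integrable_I[OF assms(1,2,4,6)])
qed (use assms in auto)

lemma I_continuous_tendsto:
  assumes g: "continuous_on UNIV g"
  shows "((\<lambda>\<gamma>. I \<gamma> g) \<longlongrightarrow> C * integral {0..1} g) (at_right 0)"
proof (rule tendstoI)
  fix e :: real assume e: "e > 0"
  \<comment> \<open>The errors are \<open>d (C + 1)\<close> for replacing \<open>g\<close> by the
    polynomial under \<open>I\<close>, \<open>d\<close> for the polynomial limit and
    \<open>C d\<close> for the integrals: \<open>d (2 C + 2)\<close> in all, below
    \<open>e\<close>.\<close>
  define d where "d = e / (2 * C + 3)"
  have d: "d > 0" unfolding d_def using e C_nonneg by simp
  obtain q where "real_polynomial_function q" and q: "\<And>x. x \<in> {0..1} \<Longrightarrow> \<bar>g x - q x\<bar> < d"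
    using Stone_Weierstrass_real_polynomial_function[of "{0..1}" g d] continuous_on_subset[OF g] d by auto
  then obtain c n where q_eq: "q = (\<lambda>x. \<Sum>i\<le>n. c i * x ^ i)"
    by (auto simp: real_polynomial_function_iff_sum)
  have q_cont: "continuous_on A q" for A unfolding q_eq by (intro continuous_intros)
  have [measurable]: "g \<in> borel_measurable borel" "q \<in> borel_measurable borel"
    using g q_cont by (auto intro: borel_measurable_continuous_onI)
  have bdd: "\<exists>B. \<forall>x\<in>{0..1}. \<bar>f x\<bar> \<le> B" if "continuous_on {0..1} f" for f :: "real \<Rightarrow> real"
    using compact_imp_bounded[OF compact_continuous_image[OF that]] by (auto simp: bounded_iff)
  obtain Bg Bq where Bg: "\<And>x. x \<in> {0..1} \<Longrightarrow> \<bar>g x\<bar> \<le> Bg" and Bq: "\<And>x. x \<in> {0..1} \<Longrightarrow> \<bar>q x\<bar> \<le> Bq"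
    using bdd[of g] bdd[of q] continuous_on_subset[OF g] q_cont by blast
  have "\<bar>integral {0..1} g - integral {0..1} q\<bar> \<le> d * 1"
  proof -
    have "norm (integral {0..1} (\<lambda>x. g x - q x)) \<le> d * (1 - 0)"
      using q continuous_on_subset[OF g] q_cont
      by (intro integral_bound) (auto intro!: continuous_intros less_imp_le)
    also have "integral {0..1} (\<lambda>x. g x - q x) = integral {0..1} g - integral {0..1} q"
      using continuous_on_subset[OF g] q_cont
      by (intro Henstock_Kurzweil_Integration.integral_diff integrable_continuous_interval) auto
    finally show ?thesis by simp
  qed
  then have int_le: "\<bar>C * integral {0..1} g - C * integral {0..1} q\<bar> \<le> C * d"
    using C_nonneg by (simp add: abs_mult right_diff_distrib[symmetric] mult_left_mono)
  have "eventually (\<lambda>\<gamma>. \<gamma> * (\<integral> s. exp (- \<gamma> * s) \<partial>m) < C + 1) (at_right 0)"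
    using I_one_tendsto by (rule order_tendstoD) simp
  moreover have "eventually (\<lambda>\<gamma>. dist (I \<gamma> q) (C * integral {0..1} q) < d) (at_right 0)"
    using I_polynomial_tendsto d unfolding q_eq by (rule tendstoD)
  ultimately show "eventually (\<lambda>\<gamma>. dist (I \<gamma> g) (C * integral {0..1} g) < e) (at_right 0)"
    using finite_Laplace eventually_at_right_less[of "0::real"]
  proof eventually_elim
    case (elim \<gamma>)
    note int = integrable_exp[OF elim(3)]
    have g0: "\<gamma> \<ge> 0" using elim by simp
    have ig: "integrable m (\<lambda>s. exp (- \<gamma> * s) * g (exp (- \<gamma> * s)))"
      and iq: "integrable m (\<lambda>s. exp (- \<gamma> * s) * q (exp (- \<gamma> * s)))"
      by (rule integrable_I[OF int g0 _ Bg] integrable_I[OF int g0 _ Bq]; simp)+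
    have "\<bar>\<integral> s. exp (- \<gamma> * s) * g (exp (- \<gamma> * s)) - exp (- \<gamma> * s) * q (exp (- \<gamma> * s)) \<partial>m\<bar>
        \<le> (\<integral> s. d * exp (- \<gamma> * s) \<partial>m)"
    proof (rule order_trans[OF integral_abs_bound integral_mono_AE])
      show "AE s in m. \<bar>exp (- \<gamma> * s) * g (exp (- \<gamma> * s)) - exp (- \<gamma> * s) * q (exp (- \<gamma> * s))\<bar> \<le> d * exp (- \<gamma> * s)"
        using exp_in_01[OF g0]
      proof eventually_elim
        case (elim s)
        have "exp (- \<gamma> * s) * \<bar>g (exp (- \<gamma> * s)) - q (exp (- \<gamma> * s))\<bar> \<le> exp (- \<gamma> * s) * d"
          using q[OF elim] by (intro mult_left_mono) auto
        then show ?case by (simp add: abs_mult right_diff_distrib[symmetric] mult.commute)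
      qed
    qed (use ig iq int in auto)
    then have "\<gamma> * \<bar>(\<integral> s. exp (- \<gamma> * s) * g (exp (- \<gamma> * s)) \<partial>m) - (\<integral> s. exp (- \<gamma> * s) * q (exp (- \<gamma> * s)) \<partial>m)\<bar>
        \<le> \<gamma> * (d * (\<integral> s. exp (- \<gamma> * s) \<partial>m))"
      using g0 ig iq by (intro mult_left_mono) (auto simp: Bochner_Integration.integral_diff)
    then have "\<bar>I \<gamma> g - I \<gamma> q\<bar> \<le> d * (\<gamma> * (\<integral> s. exp (- \<gamma> * s) \<partial>m))"
      unfolding I_def using g0 by (simp add: abs_mult right_diff_distrib[symmetric] mult.left_commute)
    also have "\<dots> \<le> d * (C + 1)" using elim d by (intro mult_left_mono) auto
    finally have "\<bar>I \<gamma> g - C * integral {0..1} g\<bar> < d * (C + 1) + d + C * d"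
      using elim(2) int_le unfolding dist_real_def by linarith
    also have "\<dots> = d * (2 * C + 2)" by (simp add: algebra_simps)
    also have "\<dots> \<le> d * (2 * C + 3)" using d by (intro mult_left_mono) auto
    also have "\<dots> = e" unfolding d_def using C_nonneg by simp
    finally show ?case by (simp add: dist_real_def)
  qed
qed

text \<open>For positive \<gamma>, \<open>x * target x\<close> at
  \<open>x = exp (- \<gamma> * s)\<close> is the indicator of \<open>s <= 1 / \<gamma>\<close>. With
  \<open>\<gamma> = 1 / t\<close> the functional becomes the mass of \<open>[0, t]\<close> divided
  by \<open>t\<close>, while the integral of \<open>target\<close> over \<open>[0, 1]\<close> is 1,
  so the limit is \<open>C\<close> itself.\<close>

definition target :: "real \<Rightarrow> real" where
  "target x = (if exp (-1) \<le> x then 1 / x else 0)"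

lemma target_measurable [measurable]: "target \<in> borel_measurable borel"
  unfolding target_def[abs_def] by measurable

lemma target_bound: "\<bar>target x\<bar> \<le> exp 1"
proof (cases "exp (-1) \<le> x")
  case True
  then have "0 < x" by (rule less_le_trans[OF exp_gt_zero])
  with True have "1 / x \<le> 1 / exp (-1)" by (intro divide_left_mono) auto
  with \<open>0 < x\<close> True show ?thesis by (simp add: target_def exp_minus inverse_eq_divide)
qed (simp add: target_def)

lemma cutoff_bound:
  assumes "0 < a" "a < b"
  shows "\<bar>cutoff a b x\<bar> \<le> 1 / a"
proof (cases "a \<le> x")
  case True
  then have "1 / x \<le> 1 / a" using assms by (intro divide_left_mono) auto
  then show ?thesis using cutoff_le[OF assms True] cutoff_nonneg[OF assms, of x] by simp
next
  case False
  then show ?thesis using cutoff_eq_0[OF assms, of x] assms by simp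
qed

lemma I_target_tendsto: "((\<lambda>\<gamma>. I \<gamma> target) \<longlongrightarrow> C) (at_right 0)"
proof (rule tendstoI)
  fix e :: real assume e: "e > 0"
  \<comment> \<open>The bound \<open>1/2\<close> keeps \<open>b\<close> below 1, and the other one
    ensures \<open>C * d < e\<close>.\<close>
  define d where "d = min (1/2) (e / (2 * (C + 1)))"
  have d: "d > 0" "d < 1" "C * d < e"
  proof -
    show "d > 0" "d < 1" unfolding d_def using e C_nonneg by auto
    have "C * d \<le> C * (e / (2 * (C + 1)))" using C_nonneg by (intro mult_left_mono) (auto simp: d_def)
    also have "\<dots> < e" using C_nonneg e by (simp add: field_simps add_strict_increasing)
    finally show "C * d < e" .
  qed
  \<comment> \<open>The jump of \<open>target\<close> at \<open>exp (-1)\<close> is smoothed once to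
    its left and once to its right. The logarithms of \<open>a\<close> and \<open>b\<close> bound
    the two integrals by \<open>1 + d\<close> from above and by \<open>1 - d\<close> from
    below.\<close>
  define a b where "a = exp (- (1 + d))" and "b = exp (- (1 - d))"
  let ?r = "exp (-1) :: real"
  have ab: "0 < a" "a < ?r" "0 < ?r" "?r < b" "b \<le> 1" "?r \<le> 1" unfolding a_def b_def using d by auto
  note cu = continuous_cutoff[OF ab(1,2), of UNIV] and cl = continuous_cutoff[OF ab(3,4), of UNIV]
  have [measurable]: "cutoff a ?r \<in> borel_measurable borel" "cutoff ?r b \<in> borel_measurable borel"
    using cu cl by (auto intro: borel_measurable_continuous_onI)
  have "C * integral {0..1} (cutoff a ?r) \<le> C * (1 + d)"
    using integral_cutoff_bounds(1)[OF ab(1,2,6)] C_nonneg by (intro mult_left_mono) (auto simp: a_def)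
  also have "\<dots> < C + e" using d by (simp add: algebra_simps)
  finally have up: "eventually (\<lambda>\<gamma>. I \<gamma> (cutoff a ?r) < C + e) (at_right 0)"
    by (rule order_tendstoD(2)[OF I_continuous_tendsto[OF cu]])
  have "C - e < C * (1 - d)" using d by (simp add: algebra_simps)
  also have "\<dots> \<le> C * integral {0..1} (cutoff ?r b)"
    using integral_cutoff_bounds(2)[OF ab(3,4,5)] C_nonneg by (intro mult_left_mono) (auto simp: b_def)
  finally have lo: "eventually (\<lambda>\<gamma>. C - e < I \<gamma> (cutoff ?r b)) (at_right 0)"
    by (rule order_tendstoD(1)[OF I_continuous_tendsto[OF cl]])
  show "eventually (\<lambda>\<gamma>. dist (I \<gamma> target) C < e) (at_right 0)"
    using up lo finite_Laplace eventually_at_right_less[of "0::real"]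
  proof eventually_elim
    case (elim \<gamma>)
    note int = integrable_exp[OF elim(3)]
    have g0: "\<gamma> \<ge> 0" using elim by simp
    have "I \<gamma> target \<le> I \<gamma> (cutoff a ?r)"
      by (rule I_mono[OF int g0 _ _ target_bound cutoff_bound[OF ab(1,2)]])
        (auto simp: target_def cutoff_eq[OF ab(1,2)] cutoff_nonneg[OF ab(1,2)])
    moreover have "I \<gamma> (cutoff ?r b) \<le> I \<gamma> target"
      by (rule I_mono[OF int g0 _ _ cutoff_bound[OF ab(3,4)] target_bound])
        (auto simp: target_def cutoff_eq_0[OF ab(3,4)] cutoff_le[OF ab(3,4)])
    ultimately show ?case using elim(1,2) by (simp add: dist_real_def abs_less_iff)
  qed
qed

theorem cesaro_limit: "((\<lambda>t. emeasure m {0..t} / ennreal t) \<longlongrightarrow> ennreal C) at_top"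
proof -
  have "((\<lambda>t. I (1 / t) target) \<longlongrightarrow> C) at_top"
    using I_target_tendsto by (rule filterlim_compose) real_asymp
  then have "((\<lambda>t. ennreal (I (1 / t) target)) \<longlongrightarrow> ennreal C) at_top" by (rule tendsto_ennrealI)
  moreover have "eventually (\<lambda>t. ennreal (I (1 / t) target) = emeasure m {0..t} / ennreal t) at_top"
  proof -
    have "filterlim (\<lambda>t::real. 1 / t) (at_right 0) at_top" by real_asymp
    from this[unfolded filterlim_iff, rule_format, OF finite_Laplace] eventually_gt_at_top[of "0::real"]
    show ?thesis
    proof eventually_elim
      case (elim t)
      have int: "integrable m (\<lambda>s. exp (- (1 / t) * s) * target (exp (- (1 / t) * s)))"
        by (rule integrable_I[OF integrable_exp[OF elim(1)]]) (use elim target_bound in auto)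
      have eq: "exp (- (1 / t) * s) * target (exp (- (1 / t) * s)) = indicator {..t} s" for s
        using elim(2) by (auto simp: target_def indicator_def field_simps)
      have "(\<integral>\<^sup>+ s. ennreal (indicator {..t} s) \<partial>m) = ennreal (\<integral> s. indicator {..t} s \<partial>m)"
        using int unfolding eq by (intro nn_integral_eq_integral) auto
      moreover have "(\<integral>\<^sup>+ s. ennreal (indicator {..t} s) \<partial>m) = emeasure m {0..t}"
      proof -
        have "(\<integral>\<^sup>+ s. ennreal (indicator {..t} s) \<partial>m) = (\<integral>\<^sup>+ s. indicator {0..t} s \<partial>m)"
          by (rule nn_integral_cong_AE, rule AE_mp[OF supp]) (auto simp: indicator_def)
        then show ?thesis by simp
      qed
      ultimately have "ennreal (I (1 / t) target) = ennreal (1 / t) * emeasure m {0..t}"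
        unfolding I_def eq using elim(2) by (simp add: ennreal_mult''[symmetric])
      then show ?case using elim(2)
        by (simp add: divide_ennreal_def inverse_ennreal mult.commute inverse_eq_divide)
    qed
  qed
  ultimately show ?thesis by (rule Lim_transform_eventually)
qed

end

section \<open>The main theorem\<close>

context weighted_ar
begin

text \<open>The integrand of each term factorises along the path, with one \<open>wt\<close> per
  earlier state and \<open>hw\<close> for the last, so the term is an iterate of the kernel
  \<open>Qk\<close> averaged over the initial law.\<close>

lemma G_fun_eq:
  assumes "linear_ar M \<alpha> r\<^sub>0 p \<theta> X"
  shows "G_fun M X \<xi> \<kappa> \<gamma> = (\<integral>\<^sup>+ x. potQ \<gamma> (hw \<gamma>) x \<partial>distr M borel (X 0))"
proof -
  interpret AR: linear_ar M \<alpha> r\<^sub>0 p \<theta> X by fact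
  interpret Q: pos_kernel lborel "Qk \<gamma>" by (rule pos_kernel_Qk)
  have "g_fun M X \<xi> \<kappa> n \<gamma> = (\<integral>\<^sup>+ x. (kopQ \<gamma> ^^ n) (hw \<gamma>) x \<partial>distr M borel (X 0))" for n
  proof -
    have "(\<Prod>j<n. wt \<gamma> (X j \<omega>)) * hw \<gamma> (X n \<omega>) = ennreal ((\<Prod>j<n. real (\<kappa> (X j \<omega>)))
        * (real (\<kappa> (X n \<omega>)) - 1) * exp (- \<gamma> * S_sum \<xi> X n \<omega>))" for \<omega>
    proof -
      have "exp (- \<gamma> * S_sum \<xi> X n \<omega>) = (\<Prod>j<n. exp (- \<gamma> * \<xi> (X j \<omega>))) * exp (- \<gamma> * \<xi> (X n \<omega>))"
        unfolding S_sum_def lessThan_Suc_atMost[symmetric]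
        by (simp add: exp_sum[symmetric] exp_add[symmetric] sum_distrib_left algebra_simps)
      moreover have "(\<Prod>j<n. wt \<gamma> (X j \<omega>)) = ennreal ((\<Prod>j<n. real (\<kappa> (X j \<omega>))) * (\<Prod>j<n. exp (- \<gamma> * \<xi> (X j \<omega>))))"
        unfolding wt_def by (subst prod_ennreal) (auto simp: prod.distrib)
      moreover have "0 \<le> (\<Prod>j<n. real (\<kappa> (X j \<omega>))) * (\<Prod>j<n. exp (- \<gamma> * \<xi> (X j \<omega>)))"
        by (intro mult_nonneg_nonneg prod_nonneg) auto
      ultimately show ?thesis
        unfolding hw_def by (simp only: ennreal_mult'[symmetric]) (simp only: ac_simps)
    qed
    then have "g_fun M X \<xi> \<kappa> n \<gamma> = (\<integral>\<^sup>+ \<omega>. (\<Prod>j<n. wt \<gamma> (X j \<omega>)) * hw \<gamma> (X n \<omega>) \<partial>M)"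
      by (simp add: g_fun_def)
    also have "\<dots> = (\<integral>\<^sup>+ x. (kopQ \<gamma> ^^ n) (hw \<gamma>) x \<partial>distr M borel (X 0))"
      unfolding Qk_def[abs_def] by (rule AR.expectation_eq_kop_funpow) measurable
    finally show ?thesis .
  qed
  then show ?thesis unfolding G_fun_def pot_def
    using Q.kop_funpow_measurable[of "hw \<gamma>"] by (subst nn_integral_suminf) auto
qed

lemma G_fun_finite_iff:
  assumes "linear_ar M \<alpha> r\<^sub>0 p \<theta> X" "\<gamma> > 0"
  shows "G_fun M X \<xi> \<kappa> \<gamma> < \<top> \<longleftrightarrow> \<gamma> > nu"
proof -
  interpret AR: linear_ar M \<alpha> r\<^sub>0 p \<theta> X by fact
  have "prob_space (distr M borel (X 0))" by (rule AR.prob_space_distr) measurable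
  then show ?thesis
    unfolding G_fun_eq[OF assms(1)] using assms(2) mean_pot_finite_iff potQ_bounded_iff by simp
qed

lemma nu_rate_eq:
  assumes "linear_ar M \<alpha> r\<^sub>0 p \<theta> X"
  shows "nu_rate M X \<xi> \<kappa> = ereal nu"
proof -
  have "{\<gamma>. \<gamma> > 0 \<and> G_fun M X \<xi> \<kappa> \<gamma> < \<infinity>} = {nu<..}"
    using G_fun_finite_iff[OF assms] nu_pos by auto
  moreover have "(INF \<gamma>\<in>{nu<..}. ereal \<gamma>) = ereal nu"
  proof (rule antisym)
    show "(INF \<gamma>\<in>{nu<..}. ereal \<gamma>) \<le> ereal nu"
    proof (rule ereal_le_epsilon2)
      fix e :: real assume "e > 0"
      then show "(INF \<gamma>\<in>{nu<..}. ereal \<gamma>) \<le> ereal nu + ereal e"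
        by (intro INF_lower2[of "nu + e"]) auto
    qed
  qed (auto intro: INF_greatest)
  ultimately show ?thesis by (simp add: nu_rate_def)
qed

text \<open>The factor \<open>1 / (\<gamma> + nu)\<close> tends to \<open>1 / nu\<close>, so the
  constant is that of \<open>mean_pot_pole\<close> divided by \<open>nu\<close>. A limit from the
  right may be tested on decreasing sequences, the kind on which monotone convergence
  operates.\<close>

lemma G_fun_pole:
  assumes "linear_ar M \<alpha> r\<^sub>0 p \<theta> X"
  obtains C where "C > 0"
    "((\<lambda>\<gamma>. ennreal (\<gamma> / (\<gamma> + nu)) * G_fun M X \<xi> \<kappa> (nu + \<gamma>)) \<longlongrightarrow> ennreal C) (at_right 0)"
proof -
  interpret AR: linear_ar M \<alpha> r\<^sub>0 p \<theta> X by fact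
  have prob: "prob_space (distr M borel (X 0))" by (rule AR.prob_space_distr) measurable
  obtain C\<^sub>0 where C0: "C\<^sub>0 > 0" and lim: "\<And>g. decseq g \<Longrightarrow> g \<longlonglongrightarrow> nu \<Longrightarrow> (\<And>n. g n > nu) \<Longrightarrow>
    (\<lambda>n. ennreal (g n - nu) * (\<integral>\<^sup>+ x. potQ (g n) (hw (g n)) x \<partial>distr M borel (X 0))) \<longlonglongrightarrow> ennreal C\<^sub>0"
    by (rule mean_pot_pole[OF prob sets_distr]) blast
  have "((\<lambda>\<gamma>. ennreal (\<gamma> / (\<gamma> + nu)) * G_fun M X \<xi> \<kappa> (nu + \<gamma>)) \<longlongrightarrow> ennreal (1 / nu * C\<^sub>0)) (at_right 0)"
  proof (rule tendsto_at_right_sequentially[of 0 1])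
    fix S :: "nat \<Rightarrow> real" assume S: "\<And>n. 0 < S n" "decseq S" "S \<longlonglongrightarrow> 0"
    have "(\<lambda>n. ennreal (nu + S n - nu) * (\<integral>\<^sup>+ x. potQ (nu + S n) (hw (nu + S n)) x \<partial>distr M borel (X 0)))
        \<longlonglongrightarrow> ennreal C\<^sub>0"
    proof (rule lim)
      show "decseq (\<lambda>n. nu + S n)" using S(2) by (simp add: decseq_def)
      show "(\<lambda>n. nu + S n) \<longlonglongrightarrow> nu" using tendsto_add[OF tendsto_const S(3), of nu] by simp
    qed (use S in simp)
    moreover have "(\<lambda>n. ennreal (1 / (S n + nu))) \<longlonglongrightarrow> ennreal (1 / (0 + nu))"
      using nu_pos S(3) by (intro tendsto_ennrealI tendsto_divide tendsto_add tendsto_const) auto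
    ultimately have "(\<lambda>n. ennreal (1 / (S n + nu)) * (ennreal (S n) * G_fun M X \<xi> \<kappa> (nu + S n)))
        \<longlonglongrightarrow> ennreal (1 / (0 + nu)) * ennreal C\<^sub>0"
      unfolding G_fun_eq[OF assms] by (intro tendsto_mult_ennreal) (auto simp: C0)
    moreover have "ennreal (S n / (S n + nu)) = ennreal (1 / (S n + nu)) * ennreal (S n)" for n
      using S(1)[of n] nu_pos by (subst ennreal_mult[symmetric]) auto
    moreover have "ennreal (1 / (0 + nu)) * ennreal C\<^sub>0 = ennreal (1 / nu * C\<^sub>0)"
      using C0 nu_pos by (subst ennreal_mult[symmetric]) auto
    ultimately show "(\<lambda>n. ennreal (S n / (S n + nu)) * G_fun M X \<xi> \<kappa> (nu + S n)) \<longlonglongrightarrow> ennreal (1 / nu * C\<^sub>0)"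
      by (simp only: mult.assoc)
  qed simp
  moreover have "1 / nu * C\<^sub>0 > 0" using C0 nu_pos by simp
  ultimately show thesis using that by blast
qed

text \<open>Karamata's theorem is applied to the measure with density \<open>exp (- nu * s)\<close>
  times the mean number of living cells on \<open>[0, \<infinity>)\<close>. Its Laplace transform
  times \<gamma> is \<open>\<gamma> / (\<gamma> + nu)\<close> times
  \<open>1 + G (nu + \<gamma>)\<close>; the contribution of the 1 vanishes in the limit.\<close>

lemma cesaro_mean_alive:
  assumes ar: "linear_ar M \<alpha> r\<^sub>0 p \<theta> X" and kappa: "\<kappa> \<in> measurable borel (count_space UNIV)"
    and br: "branching_family M X W Y" and "C \<ge> 0"
    and lim: "((\<lambda>\<gamma>. ennreal (\<gamma> / (\<gamma> + nu)) * G_fun M X \<xi> \<kappa> (nu + \<gamma>)) \<longlongrightarrow> ennreal C) (at_right 0)"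
  shows "((\<lambda>t. (\<integral>\<^sup>+ s\<in>{0..t}. (ennreal (exp (- nu * s)) * mean_alive W Y \<xi> \<kappa> s) \<partial>lborel) / ennreal t)
    \<longlongrightarrow> ennreal C) at_top"
proof -
  interpret AR: linear_ar M \<alpha> r\<^sub>0 p \<theta> X by (rule ar)
  note mean = xi_meas xi_nonneg kappa kappa_ge2 AR.prob_space_axioms AR.X_measurable br
  have [measurable]: "mean_alive W Y \<xi> \<kappa> \<in> borel_measurable borel"
    by (rule mean_alive_measurable[OF mean])
  define a where "a s = ennreal (exp (- nu * s)) * mean_alive W Y \<xi> \<kappa> s * indicator {0..} s" for s :: real
  have [measurable]: "a \<in> borel_measurable borel" unfolding a_def[abs_def] by measurable
  have Laplace: "ennreal \<gamma> * (\<integral>\<^sup>+ s. ennreal (exp (- \<gamma> * s)) \<partial>density lborel a)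
      = ennreal (\<gamma> / (\<gamma> + nu)) + ennreal (\<gamma> / (\<gamma> + nu)) * G_fun M X \<xi> \<kappa> (nu + \<gamma>)" if g: "\<gamma> > 0" for \<gamma>
  proof -
    have *: "ennreal (exp (- \<gamma> * s)) * ennreal (exp (- nu * s)) = ennreal (exp (- (nu + \<gamma>) * s))" for s
      by (simp add: ennreal_mult[symmetric] exp_add[symmetric] algebra_simps)
    have eq: "a s * ennreal (exp (- \<gamma> * s))
        = ennreal (exp (- (nu + \<gamma>) * s)) * (mean_alive W Y \<xi> \<kappa> s * indicator {0..} s)" for s
    proof -
      have "a s * ennreal (exp (- \<gamma> * s)) = (ennreal (exp (- \<gamma> * s)) * ennreal (exp (- nu * s)))
          * (mean_alive W Y \<xi> \<kappa> s * indicator {0..} s)"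
        unfolding a_def by (simp only: ac_simps)
      then show ?thesis by (simp only: *)
    qed
    have "(\<integral>\<^sup>+ s. ennreal (exp (- \<gamma> * s)) \<partial>density lborel a)
        = (\<integral>\<^sup>+ s. a s * ennreal (exp (- \<gamma> * s)) \<partial>lborel)"
      by (subst nn_integral_density) auto
    also have "\<dots> = ennreal (1 / (nu + \<gamma>)) * (1 + G_fun M X \<xi> \<kappa> (nu + \<gamma>))"
      unfolding eq using g nu_pos G_fun_finite_iff[OF ar, of "nu + \<gamma>"]
      by (intro Laplace_mean_alive[OF mean]) auto
    finally have "ennreal \<gamma> * (\<integral>\<^sup>+ s. ennreal (exp (- \<gamma> * s)) \<partial>density lborel a)
        = (ennreal \<gamma> * ennreal (1 / (nu + \<gamma>))) * (1 + G_fun M X \<xi> \<kappa> (nu + \<gamma>))"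
      by (simp only: mult.assoc)
    also have "ennreal \<gamma> * ennreal (1 / (nu + \<gamma>)) = ennreal (\<gamma> / (\<gamma> + nu))"
      using g nu_pos by (subst ennreal_mult[symmetric]) (auto simp: add.commute)
    finally show ?thesis by (simp add: distrib_left)
  qed
  interpret karamata "density lborel a" C
  proof
    show "AE s in density lborel a. 0 \<le> s"
      by (subst AE_density) (auto simp: a_def indicator_def)
    have "((\<lambda>\<gamma>. \<gamma> / (\<gamma> + nu)) \<longlongrightarrow> 0 / (0 + nu)) (at_right 0)"
      using nu_pos by (intro tendsto_intros) auto
    then have "((\<lambda>\<gamma>. ennreal (\<gamma> / (\<gamma> + nu)) + ennreal (\<gamma> / (\<gamma> + nu)) * G_fun M X \<xi> \<kappa> (nu + \<gamma>))
        \<longlongrightarrow> ennreal (0 / (0 + nu)) + ennreal C) (at_right 0)"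
      by (intro tendsto_add lim tendsto_ennrealI)
    then have "((\<lambda>\<gamma>. ennreal (\<gamma> / (\<gamma> + nu)) + ennreal (\<gamma> / (\<gamma> + nu)) * G_fun M X \<xi> \<kappa> (nu + \<gamma>))
        \<longlongrightarrow> ennreal C) (at_right 0)" by simp
    then show "((\<lambda>\<gamma>. ennreal \<gamma> * (\<integral>\<^sup>+ s. ennreal (exp (- \<gamma> * s)) \<partial>density lborel a)) \<longlongrightarrow> ennreal C) (at_right 0)"
    proof (rule Lim_transform_eventually)
      show "eventually (\<lambda>\<gamma>. ennreal (\<gamma> / (\<gamma> + nu)) + ennreal (\<gamma> / (\<gamma> + nu)) * G_fun M X \<xi> \<kappa> (nu + \<gamma>)
          = ennreal \<gamma> * (\<integral>\<^sup>+ s. ennreal (exp (- \<gamma> * s)) \<partial>density lborel a)) (at_right 0)"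
        using eventually_at_right_less[of "0::real"] by eventually_elim (simp only: Laplace)
    qed
  qed (use assms in auto)
  have "emeasure (density lborel a) {0..t}
      = (\<integral>\<^sup>+ s\<in>{0..t}. (ennreal (exp (- nu * s)) * mean_alive W Y \<xi> \<kappa> s) \<partial>lborel)" for t
    by (subst emeasure_density) (auto simp: a_def indicator_def intro!: nn_integral_cong)
  then show ?thesis using cesaro_limit by simp
qed

end

theorem theorem2p13:
  fixes M :: "'a measure" and M' :: "'b measure"
    and \<alpha> r\<^sub>0 :: real and p :: "real \<Rightarrow> real"
    and \<theta> X :: "nat \<Rightarrow> 'a \<Rightarrow> real" and \<theta>' X' :: "nat \<Rightarrow> 'b \<Rightarrow> real"
    and \<xi> :: "real \<Rightarrow> real" and \<kappa> :: "real \<Rightarrow> nat"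
  assumes model: "linear_ar M \<alpha> r\<^sub>0 p \<theta> X"
    and init: "ar_initial_law \<alpha> p (distr M borel (X 0))"
    and model': "linear_ar M' \<alpha> r\<^sub>0 p \<theta>' X'"
    and init': "ar_initial_law \<alpha> p (distr M' borel (X' 0))"
    and xi_meas: "\<xi> \<in> borel_measurable borel"
    and xi_nonneg: "\<And>x. \<xi> x \<ge> 0"
    and kappa_meas: "\<kappa> \<in> measurable borel (count_space UNIV)"
    and kappa_ge2: "\<And>x. \<kappa> x \<ge> 2"
    and kappa_bdd: "bdd_above (range \<kappa>)"
    and xi_coercive: "filterlim \<xi> at_top at_infinity"
    and xi_zero_null: "emeasure lborel {x. \<xi> x = 0} = 0"
    and xi_growth: "bdd_above (range (\<lambda>x. \<xi> x / (1 + \<bar>x\<bar>) powr r\<^sub>0))"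
  shows "\<bar>nu_rate M X \<xi> \<kappa>\<bar> \<noteq> \<infinity>
    \<and> nu_rate M X \<xi> \<kappa> = nu_rate M' X' \<xi> \<kappa>
    \<and> ((\<exists>\<tau>>0. bdd_above (range (\<lambda>x. \<xi> x powr (1 + \<tau>) / (1 + \<bar>x\<bar>) powr r\<^sub>0))) \<longrightarrow>
        (let \<nu> = real_of_ereal (nu_rate M X \<xi> \<kappa>) in
         \<exists>C::real. C > 0
           \<and> ((\<lambda>\<gamma>. ennreal (\<gamma> / (\<gamma> + \<nu>)) * G_fun M X \<xi> \<kappa> (\<nu> + \<gamma>)) \<longlongrightarrow> ennreal C) (at_right 0)
           \<and> (\<forall>(W :: 'c measure) Y. branching_family M X W Y \<longrightarrow>
                ((\<lambda>t. (\<integral>\<^sup>+ s\<in>{0..t}. (ennreal (exp (- \<nu> * s)) * mean_alive W Y \<xi> \<kappa> s) \<partial>lborel)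
                       / ennreal t) \<longlongrightarrow> ennreal C) at_top)))"
proof -
  interpret AR: linear_ar M \<alpha> r\<^sub>0 p \<theta> X by (rule model)
  obtain K where K: "\<And>x. \<kappa> x \<le> K" using kappa_bdd by (auto simp: bdd_above_def)
  obtain c where c: "\<And>x. \<xi> x / (1 + \<bar>x\<bar>) powr r\<^sub>0 \<le> c" using xi_growth by (auto simp: bdd_above_def)
  have "0 \<le> c" using c[of 0] xi_nonneg[of 0] by simp
  have locally_bounded: "\<exists>B. \<forall>x. \<bar>x\<bar> \<le> R \<longrightarrow> \<xi> x \<le> B" for R
  proof (intro exI allI impI)
    fix x :: real assume "\<bar>x\<bar> \<le> R"
    have "\<xi> x \<le> c * (1 + \<bar>x\<bar>) powr r\<^sub>0" using c[of x] by (simp add: pos_divide_le_eq)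
    also have "\<dots> \<le> c * (1 + R) powr r\<^sub>0"
      using \<open>0 \<le> c\<close> \<open>\<bar>x\<bar> \<le> R\<close> AR.r0_pos by (intro mult_left_mono powr_mono2) auto
    finally show "\<xi> x \<le> c * (1 + R) powr r\<^sub>0" .
  qed
  have kappa_real: "(\<lambda>x. real (\<kappa> x)) \<in> borel_measurable borel"
    using kappa_meas by measurable
  note kappa_nat = kappa_meas
  \<comment> \<open>One interpretation serves both models, as it refers to neither probability
    space; both rates are then the same number \<open>nu\<close>.\<close>
  interpret weighted_ar \<alpha> p \<xi> \<kappa> "real K"
    by unfold_locales
      (use AR.alpha AR.p_pos AR.p_cont AR.p_integral xi_meas xi_nonneg kappa_real kappa_ge2 K xi_coercive
        xi_zero_null locally_bounded in auto)
  obtain C where C: "C > 0"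
    "((\<lambda>\<gamma>. ennreal (\<gamma> / (\<gamma> + nu)) * G_fun M X \<xi> \<kappa> (nu + \<gamma>)) \<longlongrightarrow> ennreal C) (at_right 0)"
    using G_fun_pole[OF model] by blast
  have "((\<lambda>t. (\<integral>\<^sup>+ s\<in>{0..t}. (ennreal (exp (- nu * s)) * mean_alive W Y \<xi> \<kappa> s) \<partial>lborel) / ennreal t)
      \<longlongrightarrow> ennreal C) at_top" if "branching_family M X W Y" for W :: "'c measure" and Y
    using cesaro_mean_alive[OF model kappa_nat that _ C(2)] C(1) by simp
  then show ?thesis
    using C by (auto simp: nu_rate_eq[OF model] nu_rate_eq[OF model'] Let_def simp del: mult_minus_left)
qed

end
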